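(* Let $N = N_{M,P,\tau}$ be a generalized Nakamura manifold of complex dimension $n+1$, associated with a matrix $M \in \mathrm{SL}(n,\mathbb{Z})$ with eigenvalues $e^{\lambda_1},\dots,e^{\lambda_n}$ ($\lambda_i\in\mathbb{R}$). (1) If $n = 2m$, then $N$ admits invariant symplectic structures if and only if there exists a partition $\mathcal{P} = \{(i_1,i_2),\dots,(i_{2m-1},i_{2m})\}$ of the set $\{1,\dots,2m\}$ into disjoint pairs such that $\lambda_i + \lambda_j = 0$ for every $(i,j)\in\mathcal{P}$. (2) If $n = 2m+1$, then $N$ admits invariant symplectic structures if and only if there exists a partition $\mathcal{P} = \{(i_1,i_2),\dots,(i_{2m-1},i_{2m}), i_{2m+1}\}$ of the set $\{1,\dots,2m+1\}$ into disjoint pairs plus one more index such that $\lambda_i+\lambda_j = 0$ for every pair $(i,j)\in\mathcal{P}$ and $\lambda_{i_{2m+1}} = 0$. Moreover, each of these (invariant) symplectic structures on $N$ satisfies the Hard Lefschetz Condition.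
   Context: Generalized Nakamura manifolds. Let $M\in \mathrm{SL}(n,\mathbb{Z})$ be a matrix with positive eigenvalues $e^{\lambda_1},\dots,e^{\lambda_n}$ such that $PMP^{-1} = \mathrm{diag}(e^{\lambda_1},\dots,e^{\lambda_n})$ for some $P\in \mathrm{GL}(n,\mathbb{R})$; thus $\sum_i\lambda_i = 0$. It is assumed that $\lambda_j\neq 0$ for at least one index $j$. Define $\rho:\mathbb{C}\to \mathrm{GL}(n,\mathbb{C})$ by $\rho(w) = \mathrm{diag}(e^{\frac12\lambda_1(w+\overline{w})},\dots,e^{\frac12\lambda_n(w+\overline{w})})$ and let $G_M = \mathbb{C}\ltimes_\rho\mathbb{C}^n$ be the Lie group with product $(w',z')*(w,z) = (w'+w,\ \rho(w')z+z')$, where $w,w'\in\mathbb{C}$, $z,z'\in\mathbb{C}^n$. Fix $\tau\in\mathbb{R}\setminus\{0\}$ and put $\Gamma'_\tau = \mathbb{Z}\oplus\tau\sqrt{-1}\,\mathbb{Z}\subset\mathbb{C}$, $\Gamma''_P = P\mathbb{Z}^n\oplus\sqrt{-1}\,P\mathbb{Z}^n\subset\mathbb{C}^n$. Then $\Gamma_{P,\tau} = \Gamma'_\tau\ltimes_\rho\Gamma''_P$ is a lattice (discrete cocompact subgroup) in $G_M$, and $N_{M,P,\tau} = \Gamma_{P,\tau}\backslash G_M$ is the generalized Nakamura manifold associated with $(M,P,\tau)$. It is a compact complex manifold of complex dimension $n+1$ with global coframe of $(1,0)$-forms $\varphi^0 = dw$, $\varphi^i = e^{-\frac12\lambda_i(w+\overline{w})}dz_i$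 ($i=1,\dots,n$). A differential form on $N$ is called invariant if it is induced by a left-invariant form on $G_M$. A symplectic manifold $(X,\omega)$ of real dimension $2d$ satisfies the Hard Lefschetz Condition if for every $k=0,\dots,d$ the map $L^{d-k}: H^k_d(X)\to H^{2d-k}_d(X)$, $[\alpha]\mapsto[\omega^{d-k}\wedge\alpha]$, on de Rham cohomology is an isomorphism. *)

theory Defs
  imports
    "HOL-Analysis.Analysis"
    "HOL-Combinatorics.Permutations"
    "HOL-Library.Disjoint_Sets"
    "HOL-Algebra.Coset"
begin

section \<open>Smooth functions on open sets\<close>

text \<open>
  For an open set \<open>S\<close> of a Euclidean space, \<open>Ck_on k f S\<close> says that \<open>f\<close> is of class $C^k$ on \<open>S\<close>.
\<close>

fun Ck_on :: "nat \<Rightarrow> ('e::euclidean_space \<Rightarrow> 'b::real_normed_vector) \<Rightarrow> 'e set \<Rightarrow> bool" where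
  "Ck_on 0 f S \<longleftrightarrow> continuous_on S f"
| "Ck_on (Suc k) f S \<longleftrightarrow> (\<forall>x\<in>S. f differentiable (at x)) \<and>
     (\<forall>v. Ck_on k (\<lambda>x. frechet_derivative f (at x) v) S)"

definition smooth_on :: "('e::euclidean_space \<Rightarrow> 'b::real_normed_vector) \<Rightarrow> 'e set \<Rightarrow> bool" where
  "smooth_on f S \<longleftrightarrow> (\<forall>k. Ck_on k f S)"


section \<open>Alternating multilinear forms\<close>

text \<open>
  A \<open>k\<close>-linear form on \<open>'e\<close> takes its arguments \<open>v 0, \<dots>, v (k - 1)\<close> from a sequence \<open>v\<close>;
  the first clause below says that the later entries of \<open>v\<close> are irrelevant.
\<close>

type_synonym 'e multiform = "(nat \<Rightarrow> 'e) \<Rightarrow> real"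

definition alternating :: "nat \<Rightarrow> 'e::real_vector multiform \<Rightarrow> bool" where
  "alternating k f \<longleftrightarrow>
     (\<forall>v w. (\<forall>i<k. v i = w i) \<longrightarrow> f v = f w) \<and>
     (\<forall>v. \<forall>i<k. linear (\<lambda>a. f (v(i := a)))) \<and>
     (\<forall>v i j. i < j \<and> j < k \<and> v i = v j \<longrightarrow> f v = 0)"

definition alt_wedge :: "nat \<Rightarrow> nat \<Rightarrow> 'e multiform \<Rightarrow> 'e multiform \<Rightarrow> 'e multiform" where
  "alt_wedge k l f g = (\<lambda>v. (\<Sum>\<sigma> | \<sigma> permutes {..<k + l}.
     of_int (sign \<sigma>) * f (\<lambda>i. v (\<sigma> i)) * g (\<lambda>i. v (\<sigma> (k + i)))) / (fact k * fact l))"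

definition pullback :: "('e::real_normed_vector \<Rightarrow> 'f::real_normed_vector) \<Rightarrow>
    ('f \<Rightarrow> 'f multiform) \<Rightarrow> 'e \<Rightarrow> 'e multiform" where
  "pullback h \<alpha> = (\<lambda>x v. \<alpha> (h x) (\<lambda>i. frechet_derivative h (at x) (v i)))"


section \<open>Differential forms on a manifold given by an atlas\<close>

text \<open>
  A chart is a pair of its domain and its coordinate map (whose values off the domain are
  irrelevant); a manifold of dimension \<open>DIM('e)\<close> is given by an atlas of such charts.
\<close>

type_synonym ('p, 'e) chart = "'p set \<times> ('p \<Rightarrow> 'e)"

definition chart_image :: "('p, 'e) chart \<Rightarrow> 'e set" where
  "chart_image c = snd c ` fst c"

definition chart_overlap :: "('p, 'e) chart \<Rightarrow> ('p, 'e) chart \<Rightarrow> 'e set" where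
  "chart_overlap c c' = snd c ` (fst c \<inter> fst c')"

definition transition :: "('p, 'e) chart \<Rightarrow> ('p, 'e) chart \<Rightarrow> 'e \<Rightarrow> 'e" where
  "transition c c' = (\<lambda>x. snd c' (inv_into (fst c) (snd c) x))"

text \<open>
  A differential form is the family of its coordinate representations, one for each chart, which
  are related by the transition maps.  Representations are extended by 0 off the chart image, and
  by 0 to pairs that are not charts of the atlas, so that equality of forms is equality in HOL.
\<close>

type_synonym ('p, 'e) dform = "('p, 'e) chart \<Rightarrow> 'e \<Rightarrow> 'e multiform"

definition diff_forms ::
    "('p, 'e::euclidean_space) chart set \<Rightarrow> nat \<Rightarrow> ('p, 'e) dform set" where
  "diff_forms A k = {\<alpha>.
     (\<forall>c x v. c \<notin> A \<or> x \<notin> chart_image c \<longrightarrow> \<alpha> c x v = 0) \<and>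
     (\<forall>c\<in>A. \<forall>x\<in>chart_image c. alternating k (\<alpha> c x)) \<and>
     (\<forall>c\<in>A. \<forall>v. smooth_on (\<lambda>x. \<alpha> c x v) (chart_image c)) \<and>
     (\<forall>c\<in>A. \<forall>c'\<in>A. \<forall>x\<in>chart_overlap c c'. \<alpha> c x = pullback (transition c c') (\<alpha> c') x)}"

definition wedge ::
    "nat \<Rightarrow> nat \<Rightarrow> ('p, 'e) dform \<Rightarrow> ('p, 'e) dform \<Rightarrow> ('p, 'e) dform" where
  "wedge k l \<alpha> \<beta> = (\<lambda>c x. alt_wedge k l (\<alpha> c x) (\<beta> c x))"

text \<open>
  In coordinates, and for constant vector fields,
  $(d\alpha)_x(v_0,\dots,v_k) = \sum_{i\le k} (-1)^i
    \partial_{v_i}\bigl(\alpha_x(v_0,\dots,\widehat{v_i},\dots,v_k)\bigr)$.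
\<close>

definition ext_deriv :: "nat \<Rightarrow> ('p, 'e::euclidean_space) dform \<Rightarrow> ('p, 'e) dform" where
  "ext_deriv k \<alpha> = (\<lambda>c x v. if x \<in> chart_image c
     then \<Sum>i\<le>k. (- 1) ^ i *
       frechet_derivative (\<lambda>y. \<alpha> c y (\<lambda>j. if j < i then v j else v (Suc j))) (at x) (v i)
     else 0)"


section \<open>De Rham cohomology\<close>

definition closed_forms ::
    "('p, 'e::euclidean_space) chart set \<Rightarrow> nat \<Rightarrow> ('p, 'e) dform set" where
  "closed_forms A k = {\<alpha> \<in> diff_forms A k. ext_deriv k \<alpha> = (\<lambda>c x v. 0)}"

fun exact_forms ::
    "('p, 'e::euclidean_space) chart set \<Rightarrow> nat \<Rightarrow> ('p, 'e) dform set" where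
  "exact_forms A 0 = {\<lambda>c x v. 0}"
| "exact_forms A (Suc k) = ext_deriv k ` diff_forms A k"

definition cohomologous ::
    "('p, 'e::euclidean_space) chart set \<Rightarrow> nat \<Rightarrow> (('p, 'e) dform \<times> ('p, 'e) dform) set" where
  "cohomologous A k = {(\<alpha>, \<beta>). \<alpha> \<in> closed_forms A k \<and> \<beta> \<in> closed_forms A k \<and>
     (\<lambda>c x v. \<alpha> c x v - \<beta> c x v) \<in> exact_forms A k}"

definition de_rham ::
    "('p, 'e::euclidean_space) chart set \<Rightarrow> nat \<Rightarrow> ('p, 'e) dform set set" where
  "de_rham A k = closed_forms A k // cohomologous A k"


section \<open>Symplectic forms and the Hard Lefschetz Condition\<close>

definition symplectic_form ::
    "('p, 'e::euclidean_space) chart set \<Rightarrow> ('p, 'e) dform \<Rightarrow> bool" where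
  "symplectic_form A \<omega> \<longleftrightarrow> \<omega> \<in> closed_forms A 2 \<and>
     (\<forall>c\<in>A. \<forall>x\<in>chart_image c. \<forall>u.
        (\<forall>v. \<omega> c x (\<lambda>i. if i = 0 then u else v) = 0) \<longrightarrow> u = 0)"

fun form_power :: "('p, 'e) dform \<Rightarrow> nat \<Rightarrow> ('p, 'e) dform" where
  "form_power \<omega> 0 = (\<lambda>c x v. 1)"
| "form_power \<omega> (Suc r) = wedge 2 (2 * r) \<omega> (form_power \<omega> r)"

text \<open>
  The map $[\alpha] \mapsto [\omega^r \wedge \alpha]$ from cohomology in degree \<open>k\<close> to cohomology
  in degree \<open>2 * r + k\<close>, defined on equivalence classes in the style of
  \<^theory>\<open>HOL.Equiv_Relations\<close>.
\<close>

definition lefschetz_map :: "('p, 'e::euclidean_space) chart set \<Rightarrow> ('p, 'e) dform \<Rightarrow>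
    nat \<Rightarrow> nat \<Rightarrow> ('p, 'e) dform set \<Rightarrow> ('p, 'e) dform set" where
  "lefschetz_map A \<omega> r k X =
     (\<Union>\<alpha>\<in>X. cohomologous A (2 * r + k) `` {wedge (2 * r) k (form_power \<omega> r) \<alpha>})"

text \<open>
  The real dimension of the manifold is \<open>DIM('e) = 2 * d\<close>.  The Lefschetz maps are induced by
  linear maps of forms and hence linear, so they are isomorphisms iff they are bijective.
\<close>

definition hard_lefschetz ::
    "('p, 'e::euclidean_space) chart set \<Rightarrow> ('p, 'e) dform \<Rightarrow> bool" where
  "hard_lefschetz A \<omega> \<longleftrightarrow> (let d = DIM('e) div 2 in
     \<forall>k\<le>d. bij_betw (lefschetz_map A \<omega> (d - k) k) (de_rham A k) (de_rham A (2 * d - k)))"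


section \<open>Quotients of Lie groups by discrete subgroups\<close>

text \<open>
  Here \<open>G\<close> is a Lie group whose underlying manifold is the whole Euclidean space \<open>'e\<close>, and
  \<open>\<Gamma>\<close> is a discrete subgroup.  The points of $\Gamma\backslash G$ are the right cosets
  \<open>\<Gamma> #> x\<close>, and its smooth structure is the one for which the projection
  $\pi \colon G \to \Gamma\backslash G$ is a local diffeomorphism: the charts are the inverses of
  the restrictions of $\pi$ to the open sets on which it is injective.
\<close>

definition quotient_proj :: "('e, 'b) monoid_scheme \<Rightarrow> 'e set \<Rightarrow> 'e \<Rightarrow> 'e set" where
  "quotient_proj G \<Gamma> x = \<Gamma> #>\<^bsub>G\<^esub> x"

definition quotient_atlas ::
    "('e::euclidean_space, 'b) monoid_scheme \<Rightarrow> 'e set \<Rightarrow> ('e set, 'e) chart set" where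
  "quotient_atlas G \<Gamma> =
     {(quotient_proj G \<Gamma> ` U, inv_into U (quotient_proj G \<Gamma>)) | U.
        open U \<and> inj_on (quotient_proj G \<Gamma>) U}"

definition left_invariant_forms ::
    "('e::euclidean_space, 'b) monoid_scheme \<Rightarrow> nat \<Rightarrow> ('e \<Rightarrow> 'e multiform) set" where
  "left_invariant_forms G k = {\<eta>.
     (\<forall>x. alternating k (\<eta> x)) \<and> (\<forall>v. smooth_on (\<lambda>x. \<eta> x v) UNIV) \<and>
     (\<forall>g\<in>carrier G. pullback (\<lambda>x. g \<otimes>\<^bsub>G\<^esub> x) \<eta> = \<eta>)}"

text \<open>
  The form on $\Gamma\backslash G$ induced by \<open>\<eta>\<close> is the form $\alpha$ with
  $\pi^*\alpha = \eta$.  As the charts are local inverses of $\pi$, its representation in a chart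
  is the restriction of \<open>\<eta>\<close> to the chart image.
\<close>

definition invariant_forms ::
    "('e::euclidean_space, 'b) monoid_scheme \<Rightarrow> 'e set \<Rightarrow> nat \<Rightarrow> ('e set, 'e) dform set" where
  "invariant_forms G \<Gamma> k = {\<alpha> \<in> diff_forms (quotient_atlas G \<Gamma>) k.
     \<exists>\<eta> \<in> left_invariant_forms G k.
       \<forall>c \<in> quotient_atlas G \<Gamma>. \<forall>x \<in> chart_image c. \<alpha> c x = \<eta> x}"


section \<open>Generalized Nakamura manifolds\<close>

definition diag_mat :: "('n \<Rightarrow> 'a) \<Rightarrow> 'a::zero^'n^'n" where
  "diag_mat d = (\<chi> i j. if i = j then d i else 0)"

definition nak_rho :: "('n::finite \<Rightarrow> real) \<Rightarrow> complex \<Rightarrow> complex^'n^'n" where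
  "nak_rho lam w = diag_mat (\<lambda>i. exp (1 / 2 * complex_of_real (lam i) * (w + cnj w)))"

definition nak_group :: "('n::finite \<Rightarrow> real) \<Rightarrow> (complex \<times> (complex^'n)) monoid" where
  "nak_group lam = \<lparr>carrier = UNIV,
     monoid.mult = (\<lambda>(w', z') (w, z). (w' + w, nak_rho lam w' *v z + z')),
     one = (0, 0)\<rparr>"

definition nak_lattice :: "real^'n^'n \<Rightarrow> real \<Rightarrow> (complex \<times> (complex^'n::finite)) set" where
  "nak_lattice P \<tau> =
     {of_int a + complex_of_real \<tau> * \<i> * of_int b | a b. True} \<times>
     {(\<chi> i. complex_of_real ((P *v x) $ i) + \<i> * complex_of_real ((P *v y) $ i)) | x y.
        (\<forall>i. x $ i \<in> \<int>) \<and> (\<forall>i. y $ i \<in> \<int>)}"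

definition nakamura :: "('n::finite \<Rightarrow> real) \<Rightarrow> real^'n^'n \<Rightarrow> real \<Rightarrow>
    ((complex \<times> (complex^'n)) set, complex \<times> (complex^'n)) chart set" where
  "nakamura lam P \<tau> = quotient_atlas (nak_group lam) (nak_lattice P \<tau>)"

definition invariant_symplectic :: "('n::finite \<Rightarrow> real) \<Rightarrow> real^'n^'n \<Rightarrow> real \<Rightarrow>
    ((complex \<times> (complex^'n)) set, complex \<times> (complex^'n)) dform \<Rightarrow> bool" where
  "invariant_symplectic lam P \<tau> \<omega> \<longleftrightarrow>
     \<omega> \<in> invariant_forms (nak_group lam) (nak_lattice P \<tau>) 2 \<and>
     symplectic_form (nakamura lam P \<tau>) \<omega>"

end

theory Submission
  imports Defs
begin

text \<open>
  Write $X = \mathbb{C} \times \mathbb{C}^n$.  The lattice acts on \<open>X\<close> by affine maps: the elements with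
  vanishing real part of the first coordinate act by translations, by a group \<open>\<Lambda>\<close> of periods, and
  one further generator acts by \<open>x \<mapsto> L x + e\<close>, where \<open>e = (1, 0)\<close> and \<open>L\<close> is diagonal with the
  eigenvalues $e^{\lambda_i}$ on the second factor.  So the quotient is the mapping torus of \<open>L\<close>
  acting on a torus, and the forms on the quotient are the forms on \<open>X\<close> that are \<open>\<Lambda>\<close>-periodic and
  invariant under the pullback by that map (\<open>diff_form_descends\<close>, \<open>descend_in_diff_forms\<close>).

  \<^emph>\<open>Cohomology.\<close>  Every de Rham class of the quotient contains exactly one constant form on \<open>X\<close> that
  is invariant under \<open>L\<close> (\<open>invariant_cohomology\<close>, \<open>harmonic_not_exact\<close>); such forms are called
  harmonic below.  Averaging a closed form along the periods, with Cartan's formula giving a primitive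
  for the change, and integrating in the remaining direction \<open>e\<close> makes it constant up to the
  differential of a periodic form (\<open>periodic_cohomology\<close>).  Invariance under the further generator
  leaves an error of the shape \<open>pull \<beta> - \<beta>\<close>, which is controlled by Wang's exact sequence: on exact
  periodic forms the operator \<open>pull - 1\<close> is surjective (\<open>cohomological_equation\<close>), and on constant
  forms its kernel and its image are complementary because \<open>L\<close> is diagonalizable
  (\<open>diagonal_weight_split\<close>).  The second point can fail for a map with Jordan blocks.

  \<^emph>\<open>Hard Lefschetz.\<close>  Harmonic forms are closed under the wedge product, so the Lefschetz map on
  cohomology is the algebraic Lefschetz map of a single alternating 2-form \<open>w\<close>, restricted to
  \<open>L\<close>-invariant forms.  The algebraic map is bijective if \<open>w\<close> is nondegenerate (\<open>lef_injective\<close>,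
  \<open>lef_surjective\<close>), and by injectivity the preimage of an invariant form is invariant.  The form \<open>w\<close>
  is nondegenerate because its top power is cohomologous to that of the symplectic form, which is
  already constant: a left-invariant form is determined by its value at the origin through
  diagonal maps, and these have determinant 1 since $\sum_i \lambda_i = 0$.

  \<^emph>\<open>Existence.\<close>  Let \<open>\<eta>\<close> be a left-invariant closed 2-form, and let \<open>a\<close> and \<open>b\<close> be standard basis
  vectors other than \<open>e\<close>, of weights \<open>s\<close> and \<open>t\<close>.  The coefficient of \<open>\<eta>\<close> at \<open>(a, b)\<close> is, as a
  function of the point $(\zeta, z)$, a multiple of $e^{-(s + t)\,\mathrm{Re}\,\zeta}$, and closedness forces it to
  vanish unless \<open>s + t = 0\<close>
  (\<open>closed_weights\<close>).  Nondegeneracy then embeds the space of weight \<open>t \<noteq> 0\<close> into the dual of the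
  space spanned by \<open>e\<close> and the vectors of weight \<open>- t\<close>.  The weight spaces are even-dimensional, so
  the extra dimension is harmless and the weights \<open>t\<close> and \<open>- t\<close> have equal multiplicity
  (\<open>weight_multiplicity\<close>); this gives a pairing of the indices in which at most one
  index, of weight 0, is left over (\<open>ex_opposite_pairs\<close>).
  Conversely, a pairing gives a constant symplectic form (\<open>symplectic_from_pairs\<close>).
\<close>

section \<open>Smooth real-valued functions\<close>

abbreviation smooth :: "('e::euclidean_space \<Rightarrow> real) \<Rightarrow> bool" where
  "smooth f \<equiv> smooth_on f UNIV"

definition dd :: "'e::euclidean_space \<Rightarrow> ('e \<Rightarrow> real) \<Rightarrow> 'e \<Rightarrow> real" where
  "dd a f p = frechet_derivative f (at p) a"

lemma Ck_on_cong:
  assumes "open S" "\<And>x. x \<in> S \<Longrightarrow> f x = g x" "Ck_on k f S"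
  shows "Ck_on k g S"
  using assms(2,3)
proof (induction k arbitrary: f g)
  case 0
  then show ?case by (auto cong: continuous_on_cong)
next
  case (Suc k)
  have fd: "(g has_derivative frechet_derivative f (at x)) (at x)" if "x \<in> S" for x
  proof (rule has_derivative_transform_within_open[OF _ \<open>open S\<close> that])
    show "(f has_derivative frechet_derivative f (at x)) (at x)"
      using Suc.prems(2) that by (simp add: frechet_derivative_works)
  qed (use Suc.prems in auto)
  then have eq: "frechet_derivative g (at x) = frechet_derivative f (at x)" if "x \<in> S" for x
    using frechet_derivative_at that by metis
  show ?case
    unfolding Ck_on.simps
  proof (intro conjI allI ballI)
    fix x assume "x \<in> S" then show "g differentiable at x" using fd differentiableI by blast
  next
    fix v show "Ck_on k (\<lambda>x. frechet_derivative g (at x) v) S"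
      by (rule Suc.IH[of "\<lambda>x. frechet_derivative f (at x) v"]) (use eq Suc.prems(2) in auto)
  qed
qed

lemma Ck_on_subset: "Ck_on k f S \<Longrightarrow> T \<subseteq> S \<Longrightarrow> Ck_on k f T"
  by (induction k arbitrary: f) (auto intro: continuous_on_subset)

lemma Ck_on_Union:
  assumes "\<And>S. S \<in> \<U> \<Longrightarrow> open S" "\<And>S. S \<in> \<U> \<Longrightarrow> Ck_on k f S"
  shows "Ck_on k f (\<Union>\<U>)"
  using assms(2)
proof (induction k arbitrary: f)
  case 0
  then show ?case using continuous_on_open_Union[of \<U> f] assms(1) by auto
next
  case (Suc k)
  then show ?case by auto
qed

lemma smooth_on_cong:
  assumes "open S" "\<And>x. x \<in> S \<Longrightarrow> f x = g x" "smooth_on f S"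
  shows "smooth_on g S"
  using assms Ck_on_cong unfolding smooth_on_def by blast

lemma smooth_on_subset: "smooth_on f S \<Longrightarrow> T \<subseteq> S \<Longrightarrow> smooth_on f T"
  unfolding smooth_on_def using Ck_on_subset by blast

lemma smooth_on_local:
  assumes "\<And>x. \<exists>T. open T \<and> x \<in> T \<and> smooth_on f T"
  shows "smooth f"
proof -
  let ?U = "{T. open T \<and> smooth_on f T}"
  have "\<Union>?U = UNIV" using assms by blast
  then show ?thesis
    using Ck_on_Union[of ?U _ f] unfolding smooth_on_def by auto
qed

text \<open>
  Smoothness by coinduction: a class of differentiable functions that contains the directional
  derivatives of its members consists of smooth functions.
\<close>

lemma smooth_on_coinduct:
  assumes "P f" "\<And>f x. P f \<Longrightarrow> x \<in> S \<Longrightarrow> f differentiable (at x)"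
    "\<And>f v. P f \<Longrightarrow> P (\<lambda>x. frechet_derivative f (at x) v)"
  shows "smooth_on f S"
  unfolding smooth_on_def
proof
  fix k show "Ck_on k f S"
    using assms(1)
  proof (induction k arbitrary: f)
    case 0
    then show ?case
      using assms(2) differentiable_at_imp_differentiable_on[of S f] differentiable_imp_continuous_on by auto
  next
    case (Suc k)
    then show ?case using assms(2,3) by auto
  qed
qed

lemma smooth_on_differentiable: "smooth_on f S \<Longrightarrow> x \<in> S \<Longrightarrow> f differentiable (at x)"
  unfolding smooth_on_def by (metis Ck_on.simps(2))

lemma smooth_on_frechet: "smooth_on f S \<Longrightarrow> smooth_on (\<lambda>x. frechet_derivative f (at x) v) S"
  unfolding smooth_on_def by (metis Ck_on.simps(2))

text \<open>
  The form used for the closure properties below: it suffices to exhibit a derivative of each member of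
  the class with components in the class, for instance by the product or chain rule.
\<close>

lemma smooth_coinduct:
  assumes "P f"
    and "\<And>f. P f \<Longrightarrow> \<exists>f'. (\<forall>p. (f has_derivative (\<lambda>a. f' a p)) (at p)) \<and> (\<forall>a. P (f' a))"
  shows "smooth f"
proof (rule smooth_on_coinduct[of P])
  fix f :: "'a \<Rightarrow> real" assume "P f"
  then obtain f' where f': "\<And>p. (f has_derivative (\<lambda>a. f' a p)) (at p)" "\<And>a. P (f' a)"
    using assms(2) by blast
  show "f differentiable at x" for x using f' differentiableI by blast
  have "(\<lambda>x. frechet_derivative f (at x) v) = f' v" for v
    by (rule ext) (simp add: frechet_derivative_at[OF f'(1), symmetric])
  then show "P (\<lambda>x. frechet_derivative f (at x) v)" for v using f'(2) by simp
qed (use assms in auto)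

lemma smooth_dd: "smooth f \<Longrightarrow> smooth (dd a f)"
  using smooth_on_frechet[of f UNIV a] unfolding dd_def[abs_def] by simp

lemma smooth_has_derivative: "smooth f \<Longrightarrow> (f has_derivative (\<lambda>a. dd a f p)) (at p)"
  using smooth_on_differentiable[of f UNIV p] frechet_derivative_works unfolding dd_def[abs_def] by auto

lemma dd_eqI: "(f has_derivative f') (at p) \<Longrightarrow> dd a f p = f' a"
  unfolding dd_def using frechet_derivative_at[of f f' p] by simp

lemma smooth_continuous_on: "smooth f \<Longrightarrow> continuous_on S f"
  by (meson continuous_at_imp_continuous_on has_derivative_continuous smooth_has_derivative)

lemma linear_dd: "smooth f \<Longrightarrow> linear (\<lambda>a. dd a f p)"
  using smooth_has_derivative has_derivative_linear by blast

lemma smooth_const [simp]: "smooth (\<lambda>p. c)"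
  by (rule smooth_coinduct[where P="\<lambda>f. \<exists>c. f = (\<lambda>p. c)"]) (auto intro!: exI[of _ "\<lambda>_ _. 0"])

lemma dd_const [simp]: "dd a (\<lambda>p. c) p = 0"
  by (rule dd_eqI) (auto intro!: derivative_eq_intros)

lemma smooth_linear: "linear f \<Longrightarrow> smooth f"
proof (rule smooth_coinduct[where P="\<lambda>g. g = f \<or> (\<exists>c. g = (\<lambda>p. c))"], simp)
  fix g assume f: "linear f" and "g = f \<or> (\<exists>c. g = (\<lambda>p. c))"
  then consider "g = f" | c where "g = (\<lambda>p. c)" by auto
  then show "\<exists>f'. (\<forall>p. (g has_derivative (\<lambda>a. f' a p)) (at p)) \<and>
              (\<forall>a. f' a = f \<or> (\<exists>c. f' a = (\<lambda>p. c)))"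
  proof cases
    case 1
    then show ?thesis
      using f by (intro exI[of _ "\<lambda>a p. f a"])
        (auto simp: linear_conv_bounded_linear intro: bounded_linear_imp_has_derivative)
  next
    case 2
    then show ?thesis by (intro exI[of _ "\<lambda>a p. 0"]) auto
  qed
qed

lemma dd_linear: "linear f \<Longrightarrow> dd a f p = f a"
  by (rule dd_eqI) (simp add: linear_conv_bounded_linear bounded_linear_imp_has_derivative)

lemma smooth_add: "smooth f \<Longrightarrow> smooth g \<Longrightarrow> smooth (\<lambda>p. f p + g p)"
proof (rule smooth_coinduct[where P="\<lambda>h. \<exists>f g. smooth f \<and> smooth g \<and> h = (\<lambda>p. f p + g p)"], blast, clarify)
  fix f g :: "'a \<Rightarrow> real" assume "smooth f" "smooth g"
  then show "\<exists>f'. (\<forall>p. ((\<lambda>p. f p + g p) has_derivative (\<lambda>a. f' a p)) (at p)) \<and>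
         (\<forall>a. \<exists>f g. smooth f \<and> smooth g \<and> f' a = (\<lambda>p. f p + g p))"
    by (intro exI[of _ "\<lambda>a p. dd a f p + dd a g p"] conjI allI has_derivative_add
        smooth_has_derivative) (blast intro: smooth_dd)+
qed

lemma dd_add: "smooth f \<Longrightarrow> smooth g \<Longrightarrow> dd a (\<lambda>p. f p + g p) p = dd a f p + dd a g p"
  by (intro dd_eqI has_derivative_add smooth_has_derivative)

lemma Ck_on_Suc: "Ck_on (Suc k) f S \<Longrightarrow> Ck_on k f S"
proof (induction k arbitrary: f)
  case 0
  then show ?case
    using differentiable_at_imp_differentiable_on[of S f] differentiable_imp_continuous_on by auto
next
  case (Suc k)
  then show ?case by (metis Ck_on.simps(2))
qed

lemma Ck_on_add:
  fixes f g :: "'a::euclidean_space \<Rightarrow> real"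
  shows "open S \<Longrightarrow> Ck_on k f S \<Longrightarrow> Ck_on k g S \<Longrightarrow> Ck_on k (\<lambda>p. f p + g p) S"
proof (induction k arbitrary: f g)
  case 0
  then show ?case by (auto intro: continuous_intros)
next
  case (Suc k)
  have d: "((\<lambda>p. f p + g p) has_derivative
      (\<lambda>v. frechet_derivative f (at x) v + frechet_derivative g (at x) v)) (at x)" if "x \<in> S" for x
    using Suc.prems that by (intro has_derivative_add) (auto simp: frechet_derivative_works)
  have *: "Ck_on k (\<lambda>x. frechet_derivative f (at x) v + frechet_derivative g (at x) v) S" for v
    by (intro Suc.IH) (use Suc.prems in auto)
  show ?case
    unfolding Ck_on.simps
  proof (intro conjI ballI allI)
    fix x assume "x \<in> S"
    then show "(\<lambda>p. f p + g p) differentiable at x" using d differentiableI by blast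
  next
    fix v
    show "Ck_on k (\<lambda>x. frechet_derivative (\<lambda>p. f p + g p) (at x) v) S"
      by (rule Ck_on_cong[OF \<open>open S\<close> _ *[of v]]) (simp add: frechet_derivative_at[OF d, symmetric])
  qed
qed

lemma Ck_on_mult:
  fixes f g :: "'a::euclidean_space \<Rightarrow> real"
  shows "open S \<Longrightarrow> Ck_on k f S \<Longrightarrow> Ck_on k g S \<Longrightarrow> Ck_on k (\<lambda>p. f p * g p) S"
proof (induction k arbitrary: f g)
  case 0
  then show ?case by (auto intro: continuous_intros)
next
  case (Suc k)
  have d: "((\<lambda>p. f p * g p) has_derivative
      (\<lambda>v. f x * frechet_derivative g (at x) v + frechet_derivative f (at x) v * g x)) (at x)" if "x \<in> S" for x
    using Suc.prems that by (intro has_derivative_mult) (auto simp: frechet_derivative_works)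
  have *: "Ck_on k (\<lambda>x. f x * frechet_derivative g (at x) v + frechet_derivative f (at x) v * g x) S" for v
    by (intro Suc.IH Ck_on_add) (use Suc.prems in \<open>auto intro: Ck_on_Suc\<close>)
  show ?case
    unfolding Ck_on.simps
  proof (intro conjI ballI allI)
    fix x assume "x \<in> S"
    then show "(\<lambda>p. f p * g p) differentiable at x" using d differentiableI by blast
  next
    fix v
    show "Ck_on k (\<lambda>x. frechet_derivative (\<lambda>p. f p * g p) (at x) v) S"
      by (rule Ck_on_cong[OF \<open>open S\<close> _ *[of v]]) (simp add: frechet_derivative_at[OF d, symmetric])
  qed
qed

lemma smooth_on_mult:
  fixes f g :: "'a::euclidean_space \<Rightarrow> real"
  shows "open S \<Longrightarrow> smooth_on f S \<Longrightarrow> smooth_on g S \<Longrightarrow> smooth_on (\<lambda>p. f p * g p) S"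
  using Ck_on_mult unfolding smooth_on_def by blast

lemmas smooth_mult = smooth_on_mult[OF open_UNIV]

lemma dd_mult: "smooth f \<Longrightarrow> smooth g \<Longrightarrow> dd a (\<lambda>p. f p * g p) p = dd a f p * g p + f p * dd a g p"
  using dd_eqI[OF has_derivative_mult[OF smooth_has_derivative[of f p] smooth_has_derivative[of g p]]]
  by (simp add: add.commute)

lemma smooth_cmult: "smooth f \<Longrightarrow> smooth (\<lambda>p. c * f p)"
  by (rule smooth_mult) auto

lemma dd_cmult: "smooth f \<Longrightarrow> dd a (\<lambda>p. c * f p) p = c * dd a f p"
  by (simp add: dd_mult)

lemma smooth_minus: "smooth f \<Longrightarrow> smooth (\<lambda>p. - f p)"
  using smooth_cmult[of f "-1"] by simp

lemma dd_minus: "smooth f \<Longrightarrow> dd a (\<lambda>p. - f p) p = - dd a f p"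
  using dd_cmult[of f a "-1"] by simp

lemma smooth_diff: "smooth f \<Longrightarrow> smooth g \<Longrightarrow> smooth (\<lambda>p. f p - g p)"
  using smooth_add[of f "\<lambda>p. - g p"] smooth_minus[of g] by simp

lemma dd_diff: "smooth f \<Longrightarrow> smooth g \<Longrightarrow> dd a (\<lambda>p. f p - g p) p = dd a f p - dd a g p"
  using dd_add[of f "\<lambda>p. - g p"] smooth_minus[of g] dd_minus[of g a] by simp

lemma smooth_sum: "(\<And>i. i \<in> I \<Longrightarrow> smooth (f i)) \<Longrightarrow> smooth (\<lambda>p. \<Sum>i\<in>I. f i p)"
  by (induction I rule: infinite_finite_induct) (auto intro: smooth_add)

lemma dd_sum: "(\<And>i. i \<in> I \<Longrightarrow> smooth (f i)) \<Longrightarrow> dd a (\<lambda>p. \<Sum>i\<in>I. f i p) p = (\<Sum>i\<in>I. dd a (f i) p)"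
  by (induction I rule: infinite_finite_induct) (auto simp: dd_add smooth_sum)

lemma has_derivative_affine:
  fixes f :: "'b::euclidean_space \<Rightarrow> real" and L :: "'a::euclidean_space \<Rightarrow> 'b"
  assumes "smooth f" "linear L"
  shows "((\<lambda>p. f (L p + c)) has_derivative (\<lambda>a. dd (L a) f (L p + c))) (at p)"
proof -
  have "((\<lambda>p. L p + c) has_derivative L) (at p)"
    using assms(2) by (auto intro!: derivative_eq_intros bounded_linear_imp_has_derivative
        simp: linear_conv_bounded_linear)
  from has_derivative_compose[OF this smooth_has_derivative[OF assms(1)]] show ?thesis .
qed

lemma smooth_affine:
  fixes f :: "'b::euclidean_space \<Rightarrow> real" and L :: "'a::euclidean_space \<Rightarrow> 'b"
  assumes "smooth f" "linear L"
  shows "smooth (\<lambda>p. f (L p + c))"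
proof (rule smooth_coinduct[where P="\<lambda>g. \<exists>f. smooth f \<and> g = (\<lambda>p. f (L p + c))"])
  show "\<exists>fa. smooth fa \<and> (\<lambda>p. f (L p + c)) = (\<lambda>p. fa (L p + c))" using assms by auto
  fix g assume "\<exists>f. smooth f \<and> g = (\<lambda>p. f (L p + c))"
  then obtain f where "smooth f" "g = (\<lambda>p. f (L p + c))" by blast
  then show "\<exists>f'. (\<forall>p. (g has_derivative (\<lambda>a. f' a p)) (at p)) \<and> (\<forall>a. \<exists>f. smooth f \<and> f' a = (\<lambda>p. f (L p + c)))"
    using assms(2)
    by (intro exI[of _ "\<lambda>a p. dd (L a) f (L p + c)"])
      (auto intro: has_derivative_affine smooth_dd)
qed

lemma dd_affine:
  fixes f :: "'b::euclidean_space \<Rightarrow> real" and L :: "'a::euclidean_space \<Rightarrow> 'b"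
  assumes "smooth f" "linear L"
  shows "dd a (\<lambda>p. f (L p + c)) p = dd (L a) f (L p + c)"
  by (rule dd_eqI[OF has_derivative_affine[OF assms]])

lemma smooth_translate: "smooth f \<Longrightarrow> smooth (\<lambda>p. f (p + c))"
  using smooth_affine[of f "\<lambda>x. x"] by (simp add: linear_id[unfolded id_def])

lemma dd_translate: "smooth f \<Longrightarrow> dd a (\<lambda>p. f (p + c)) p = dd a f (p + c)"
  using dd_affine[of f "\<lambda>x. x"] by (simp add: linear_id[unfolded id_def])

lemma dd_zero_const:
  assumes "smooth f" "\<And>a p. dd a f p = 0"
  shows "f p = f q"
proof -
  have "(f has_derivative (\<lambda>h. 0)) (at p)" for p
    using smooth_has_derivative[OF assms(1)] assms(2) by simp
  then show ?thesis
    using has_derivative_zero_unique[of UNIV f] by (metis UNIV_I convex_UNIV)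
qed

section \<open>Weighted averages along a segment\<close>

definition segint :: "(real \<Rightarrow> real) \<Rightarrow> 'e::euclidean_space \<Rightarrow> ('e \<Rightarrow> real) \<Rightarrow> 'e \<Rightarrow> real" where
  "segint w a f p = integral {0..1} (\<lambda>s. w s * f (p + s *\<^sub>R a))"

lemma segint_integrable:
  assumes "continuous_on UNIV w" "smooth f"
  shows "(\<lambda>s. w s * f (p + s *\<^sub>R a)) integrable_on {0..1}"
proof (rule integrable_continuous_real)
  show "continuous_on {0..1} (\<lambda>s. w s * f (p + s *\<^sub>R a))"
    by (intro continuous_intros continuous_on_subset[OF assms(1)] 
      continuous_on_compose2[OF smooth_continuous_on[OF assms(2), of UNIV]]) auto
qed

text \<open>
  Differentiation under the integral sign.  The Leibniz rule of the library asks for the derivative as a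
  continuous family of bounded linear maps, hence the detour through the coordinates of the direction.
\<close>

lemma segint_has_derivative:
  assumes w: "continuous_on UNIV w" and f: "smooth f"
  shows "(segint w a f has_derivative (\<lambda>v. segint w a (dd v f) p)) (at p)"
proof -
  define fx where "fx x t = (\<Sum>b\<in>Basis. (w t * dd b f (x + t *\<^sub>R a)) *\<^sub>R blinfun_inner_left b)" for x t
  have lin: "dd v f q = (\<Sum>b\<in>Basis. (v \<bullet> b) * dd b f q)" for v q
  proof -
    have "dd v f q = dd (\<Sum>b\<in>Basis. (v \<bullet> b) *\<^sub>R b) f q" by (simp add: euclidean_representation)
    also have "\<dots> = (\<Sum>b\<in>Basis. (v \<bullet> b) * dd b f q)"
      by (simp only: linear_sum[OF linear_dd[OF f]] linear_scale[OF linear_dd[OF f]] real_scaleR_def)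
    finally show ?thesis .
  qed
  have app: "blinfun_apply (fx x t) v = w t * dd v f (x + t *\<^sub>R a)" for x t v
    by (subst lin) (simp add: fx_def blinfun.sum_left blinfun.scaleR_left sum_distrib_left algebra_simps inner_commute)
  have cont: "continuous_on (UNIV \<times> cbox 0 1) (\<lambda>(x, t). fx x t)"
    unfolding fx_def split_beta
    by (intro continuous_intros continuous_on_compose2[OF w]
        continuous_on_compose2[OF smooth_continuous_on[OF smooth_dd[OF f], of UNIV]]) auto
  have "((\<lambda>x. integral (cbox 0 1) (\<lambda>s. w s * f (x + s *\<^sub>R a))) has_derivative
      blinfun_apply (integral (cbox 0 1) (fx p))) (at p within UNIV)"
  proof (rule leibniz_rule[where U=UNIV])
    show "((\<lambda>x. w t * f (x + t *\<^sub>R a)) has_derivative blinfun_apply (fx x t)) (at x within UNIV)" for x t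
    proof -
      have "((\<lambda>x. f (x + t *\<^sub>R a)) has_derivative (\<lambda>v. dd v f (x + t *\<^sub>R a))) (at x)"
        using has_derivative_affine[of f "\<lambda>x. x", OF f] by (simp add: linear_id[unfolded id_def])
      from has_derivative_mult_right[OF this, of "w t"] show ?thesis by (simp add: app[abs_def] fun_eq_iff)
    qed
    show "(\<lambda>s. w s * f (x + s *\<^sub>R a)) integrable_on cbox 0 1" for x
      using segint_integrable[OF w f] by simp
  qed (use cont in auto)
  moreover have "blinfun_apply (integral (cbox 0 1) (fx p)) v = segint w a (dd v f) p" for v
  proof -
    have "continuous_on (cbox 0 1) (fx p)"
      using continuous_on_compose2[OF cont, of "cbox 0 1" "\<lambda>t. (p, t)"]
      by (force intro: continuous_intros)
    then have "fx p integrable_on cbox 0 1" by (rule integrable_continuous)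
    from integral_linear[OF this blinfun.bounded_linear_left[of v]] show ?thesis
      by (simp add: segint_def o_def app)
  qed
  moreover have "segint w a f = (\<lambda>x. integral (cbox 0 1) (\<lambda>s. w s * f (x + s *\<^sub>R a)))"
    by (simp add: fun_eq_iff segint_def)
  moreover have "blinfun_apply (integral (cbox 0 1) (fx p)) = (\<lambda>v. segint w a (dd v f) p)"
    using calculation(2) by (simp add: fun_eq_iff)
  ultimately show ?thesis by simp
qed

lemma smooth_segint:
  assumes w: "continuous_on UNIV w" and f: "smooth f"
  shows "smooth (segint w a f)"
proof (rule smooth_coinduct[where P="\<lambda>g. \<exists>f. smooth f \<and> g = segint w a f"])
  show "\<exists>fa. smooth fa \<and> segint w a f = segint w a fa" using f by auto
  fix g assume "\<exists>f. smooth f \<and> g = segint w a f"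
  then obtain f where "smooth f" "g = segint w a f" by blast
  then show "\<exists>f'. (\<forall>p. (g has_derivative (\<lambda>a. f' a p)) (at p)) \<and> (\<forall>b. \<exists>f. smooth f \<and> f' b = segint w a f)"
    by (intro exI[of _ "\<lambda>v. segint w a (dd v f)"])
      (auto intro: segint_has_derivative[OF w] smooth_dd)
qed

lemma dd_segint:
  assumes "continuous_on UNIV w" "smooth f"
  shows "dd v (segint w a f) p = segint w a (dd v f) p"
  by (rule dd_eqI[OF segint_has_derivative[OF assms]])

lemma segint_add:
  assumes "continuous_on UNIV w" "smooth f" "smooth g"
  shows "segint w a (\<lambda>p. f p + g p) p = segint w a f p + segint w a g p"
  unfolding segint_def
  by (subst integral_add[symmetric]) (auto simp: algebra_simps intro!: segint_integrable assms)

lemma segint_cmult: "segint w a (\<lambda>p. c * f p) p = c * segint w a f p"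
  unfolding segint_def by (simp add: mult.left_commute)

lemma segint_zero: "segint w a (\<lambda>p. 0) p = 0"
  by (simp add: segint_def)

lemma segint_sum:
  assumes "continuous_on UNIV w" "\<And>i. i \<in> I \<Longrightarrow> smooth (f i)"
  shows "segint w a (\<lambda>p. \<Sum>i\<in>I. f i p) p = (\<Sum>i\<in>I. segint w a (f i) p)"
  using assms(2) by (induction I rule: infinite_finite_induct)
    (auto simp: segint_add[OF assms(1)] smooth_sum segint_zero)

lemma line_has_vector_derivative:
  assumes "smooth f"
  shows "((\<lambda>s. f (p + s *\<^sub>R a)) has_vector_derivative dd a f (p + s *\<^sub>R a)) (at s within S)"
proof -
  have "((\<lambda>s. f (p + s *\<^sub>R a)) has_derivative (\<lambda>h. dd (h *\<^sub>R a) f (p + s *\<^sub>R a))) (at s)"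
    by (rule has_derivative_compose[OF _ smooth_has_derivative[OF assms]])
      (auto intro!: derivative_eq_intros)
  then show ?thesis
    using linear_scale[OF linear_dd[OF assms]]
    by (auto simp: has_vector_derivative_def intro: has_derivative_at_withinI)
qed

text \<open>
  The fundamental theorem of calculus along the segment.
\<close>

lemma segint_one_dd:
  assumes "smooth f"
  shows "segint (\<lambda>s. 1) a (dd a f) p = f (p + a) - f p"
proof -
  have "((\<lambda>s. dd a f (p + s *\<^sub>R a)) has_integral f (p + 1 *\<^sub>R a) - f (p + 0 *\<^sub>R a)) {0..1}"
    by (rule fundamental_theorem_of_calculus) (auto intro: line_has_vector_derivative assms)
  then show ?thesis unfolding segint_def by (simp add: integral_unique)
qed

text \<open>
  Integration by parts along the segment.  The weight \<open>1 - s\<close> is chosen so that the boundary term at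
  \<open>s = 1\<close> vanishes and the average \<open>segint (\<lambda>s. 1)\<close> appears.
\<close>

lemma segint_ramp_dd:
  assumes "smooth f"
  shows "segint (\<lambda>s. 1 - s) a (dd a f) p = segint (\<lambda>s. 1) a f p - f p"
proof -
  have "((\<lambda>s. (1 - s) * dd a f (p + s *\<^sub>R a) - f (p + s *\<^sub>R a)) has_integral
      (1 - 1) * f (p + 1 *\<^sub>R a) - (1 - 0) * f (p + 0 *\<^sub>R a)) {0..1}"
  proof (rule fundamental_theorem_of_calculus)
    fix s :: real
    show "((\<lambda>s. (1 - s) * f (p + s *\<^sub>R a)) has_vector_derivative
      (1 - s) * dd a f (p + s *\<^sub>R a) - f (p + s *\<^sub>R a)) (at s within {0..1})"
      by (rule has_vector_derivative_eq_rhs[OF has_vector_derivative_mult[OF _ line_has_vector_derivative[OF assms]]])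
        (auto intro!: derivative_eq_intros)
  qed auto
  moreover have "integral {0..1} (\<lambda>s. (1 - s) * dd a f (p + s *\<^sub>R a) - f (p + s *\<^sub>R a)) =
      segint (\<lambda>s. 1 - s) a (dd a f) p - segint (\<lambda>s. 1) a f p"
    unfolding segint_def
    using integral_diff[OF segint_integrable[of "\<lambda>s. 1 - s" "dd a f" p a] segint_integrable[of "\<lambda>s. 1" f p a]]
    by (simp add: assms smooth_dd continuous_intros)
  ultimately show ?thesis by (simp add: integral_unique)
qed

text \<open>
  Integrating both mixed derivatives along a segment in the direction \<open>b\<close> gives the same difference of
  values of \<open>dd a f\<close>, since averages along segments commute with derivatives.  As this holds for
  arbitrarily short segments, the derivatives agree.
\<close>

lemma dd_commute:
  assumes f: "smooth f"
  shows "dd a (dd b f) p = dd b (dd a f) p"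
proof -
  define u where "u p = dd a (dd b f) p - dd b (dd a f) p" for p
  have su: "smooth u" unfolding u_def[abs_def] by (intro smooth_diff smooth_dd f)
  have z: "segint (\<lambda>s. 1) (t *\<^sub>R b) u p = 0" if "t \<noteq> 0" for t
  proof -
    let ?c = "t *\<^sub>R b"
    have sc: "dd ?c g q = t * dd b g q" if "smooth g" for g q
      using linear_scale[OF linear_dd[OF that], of t b] by simp
    have "segint (\<lambda>s. 1) ?c (dd a (dd ?c f)) p = dd a (segint (\<lambda>s. 1) ?c (dd ?c f)) p"
      by (subst dd_segint) (auto intro!: smooth_dd f)
    also have "segint (\<lambda>s. 1) ?c (dd ?c f) = (\<lambda>p. f (p + ?c) - f p)"
      by (simp add: fun_eq_iff segint_one_dd f)
    also have "dd a \<dots> p = dd a f (p + ?c) - dd a f p"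
      by (simp add: dd_diff dd_translate f smooth_translate)
    also have "\<dots> = segint (\<lambda>s. 1) ?c (dd ?c (dd a f)) p"
      by (simp add: segint_one_dd f smooth_dd)
    finally have eq: "segint (\<lambda>s. 1) ?c (dd a (dd ?c f)) p = segint (\<lambda>s. 1) ?c (dd ?c (dd a f)) p" .
    have fdc: "dd ?c f = (\<lambda>q. t * dd b f q)" by (simp add: fun_eq_iff sc f)
    have e1: "dd a (dd ?c f) = (\<lambda>q. t * dd a (dd b f) q)"
      by (simp only: fdc) (simp add: fun_eq_iff dd_cmult smooth_dd f)
    have e2: "dd ?c (dd a f) = (\<lambda>q. t * dd b (dd a f) q)"
      by (simp add: fun_eq_iff sc f smooth_dd)
    have "segint (\<lambda>s. 1) ?c (dd a (dd b f)) p = segint (\<lambda>s. 1) ?c (dd b (dd a f)) p"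
      using eq that by (simp add: e1 e2 segint_cmult)
    moreover have "segint (\<lambda>s. 1) ?c (dd a (dd b f)) p =
        segint (\<lambda>s. 1) ?c (\<lambda>p. u p + dd b (dd a f) p) p"
      by (simp add: u_def[abs_def])
    moreover have "\<dots> = segint (\<lambda>s. 1) ?c u p + segint (\<lambda>s. 1) ?c (dd b (dd a f)) p"
      by (rule segint_add) (auto intro!: su smooth_dd f)
    ultimately show ?thesis by simp
  qed
  \<comment> \<open>segment averages of u vanish for arbitrarily short segments, hence u vanishes\<close>
  have "continuous_on UNIV (\<lambda>t. integral {0..1} (\<lambda>s. u (p + (s * t) *\<^sub>R b)))"
    using integral_continuous_on_param[of UNIV 0 1 "\<lambda>t s. u (p + (s * t) *\<^sub>R b)"]
      continuous_on_compose2[OF smooth_continuous_on[OF su, of UNIV], of "UNIV \<times> {0..1}" "\<lambda>(t, s). p + (s * t) *\<^sub>R b"]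
    by (simp add: split_beta continuous_intros)
  then have "((\<lambda>t. integral {0..1} (\<lambda>s. u (p + (s * t) *\<^sub>R b))) \<longlongrightarrow>
      integral {0..1} (\<lambda>s. u (p + (s * 0) *\<^sub>R b))) (at (0::real))"
    by (meson UNIV_I continuous_on_def)
  moreover have "eventually (\<lambda>t. integral {0..1} (\<lambda>s. u (p + (s * t) *\<^sub>R b)) = 0) (at (0::real))"
    using z by (auto simp: eventually_at_filter segint_def)
  ultimately have "((\<lambda>t::real. 0) \<longlongrightarrow> integral {0..1} (\<lambda>s. u (p + (s * 0) *\<^sub>R b))) (at (0::real))"
    by (rule Lim_transform_eventually)
  then have "integral {0..1} (\<lambda>s. u (p + (s * 0) *\<^sub>R b)) = 0"
    using tendsto_unique[of "at (0::real)" "\<lambda>t. 0::real"] by (metis tendsto_const trivial_limit_at)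
  then show ?thesis by (simp add: u_def)
qed


section \<open>Primitives and cut-off functions on the line\<close>

lemma smooth_primitive:
  fixes G :: "real \<Rightarrow> real"
  assumes "smooth G"
  shows "\<exists>H. smooth H \<and> (\<forall>t a. dd a H t = a * G t)"
proof -
  define H where "H t = (LBINT s=0..ereal t. G s)" for t :: real
  have H: "(H has_derivative (\<lambda>a. a * G t)) (at t)" for t
  proof -
    let ?R = "\<bar>t\<bar> + 1"
    have "(H has_vector_derivative G t) (at t within {-?R..?R})"
      unfolding H_def[abs_def] zero_ereal_def
      by (rule interval_integral_FTC2) (auto intro: smooth_continuous_on assms)
    then have "(H has_vector_derivative G t) (at t)"
      by (subst (asm) at_within_interior) auto
    then show ?thesis by (simp add: has_vector_derivative_def)
  qed
  have "smooth H"
  proof (rule smooth_coinduct[where P="\<lambda>g. g = H \<or> smooth g"])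
    fix g assume "g = H \<or> smooth g"
    then show "\<exists>f'. (\<forall>p. (g has_derivative (\<lambda>a. f' a p)) (at p)) \<and> (\<forall>a. f' a = H \<or> smooth (f' a))"
    proof
      assume "g = H"
      then show ?thesis
        using H assms by (intro exI[of _ "\<lambda>a t. a * G t"]) (auto intro: smooth_cmult)
    next
      assume "smooth g"
      then show ?thesis
        by (intro exI[of _ "\<lambda>a. dd a g"]) (auto intro: smooth_has_derivative smooth_dd)
    qed
  qed auto
  with H show ?thesis using dd_eqI by blast
qed

lemma Ck_on_inverse:
  fixes f :: "'a::euclidean_space \<Rightarrow> real"
  assumes "open S" "\<And>p. p \<in> S \<Longrightarrow> f p \<noteq> 0"
  shows "Ck_on k f S \<Longrightarrow> Ck_on k (\<lambda>p. inverse (f p)) S"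
proof (induction k)
  case 0
  then show ?case using assms by (auto intro!: continuous_intros)
next
  case (Suc k)
  have d: "((\<lambda>p. inverse (f p)) has_derivative
      (\<lambda>v. - (inverse (f x) * frechet_derivative f (at x) v * inverse (f x)))) (at x)" if "x \<in> S" for x
    using Suc.prems that assms by (intro Deriv.has_derivative_inverse) (auto simp: frechet_derivative_works)
  have *: "Ck_on k (\<lambda>x. (- 1) * (inverse (f x) * frechet_derivative f (at x) v * inverse (f x))) S" for v
    by (intro Ck_on_mult assms Suc.IH)
      (use Suc.prems smooth_const in \<open>auto intro: Ck_on_Suc Ck_on_subset[of _ _ UNIV] simp: smooth_on_def\<close>)
  show ?case
    unfolding Ck_on.simps
  proof (intro conjI ballI allI)
    fix x assume "x \<in> S"
    then show "(\<lambda>p. inverse (f p)) differentiable at x" using d differentiableI by blast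
  next
    fix v
    show "Ck_on k (\<lambda>x. frechet_derivative (\<lambda>p. inverse (f p)) (at x) v) S"
      by (rule Ck_on_cong[OF \<open>open S\<close> _ *[of v]]) (simp add: frechet_derivative_at[OF d, symmetric])
  qed
qed

lemma poly_exp_tendsto_0: "((\<lambda>t::real. poly q t / exp t) \<longlongrightarrow> 0) at_top"
proof -
  have "((\<lambda>t::real. \<Sum>i\<le>degree q. coeff q i * (t ^ i / exp t)) \<longlongrightarrow> (\<Sum>i\<le>degree q. coeff q i * 0)) at_top"
    by (intro tendsto_intros tendsto_power_div_exp_0)
  then show ?thesis by (simp add: poly_altdef sum_divide_distrib)
qed

text \<open>
  The functions $q(1/x)\,e^{-1/x}$ on the positive axis, extended by 0, are closed under differentiation;
  so they are smooth, including at the origin.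
\<close>

lemma poly_exp_flat_derivative:
  fixes q :: "real poly"
  defines "g \<equiv> (\<lambda>q x. if 0 < x then poly q (1 / x) * exp (- 1 / x) else 0)"
  shows "(g q has_real_derivative g ([:0, 0, 1:] * (q - pderiv q)) x) (at x)"
proof (cases x "0::real" rule: linorder_cases)
  case less
  have "((\<lambda>x. 0) has_real_derivative 0) (at x)" by simp
  then have "(g q has_real_derivative 0) (at x)"
    by (rule DERIV_cong_ev[THEN iffD1, rotated -1])
      (use less in \<open>auto simp: g_def eventually_at_topological intro!: exI[of _ "{..<0}"] eventually_mono[OF eventually_nhds_in_open[of "{..<0}"]]\<close>)
  then show ?thesis using less by (simp add: g_def)
next
  case equal
  have "((\<lambda>h. g q h / h) \<longlongrightarrow> 0) (at_right 0)"
  proof -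
    have "((\<lambda>h::real. poly ([:0, 1:] * q) (inverse h) / exp (inverse h)) \<longlongrightarrow> 0) (at_right 0)"
      by (rule filterlim_compose[OF poly_exp_tendsto_0 filterlim_inverse_at_top_right])
    then show ?thesis
      by (rule Lim_transform_eventually)
        (auto simp: g_def eventually_at_filter exp_minus divide_simps)
  qed
  moreover have "((\<lambda>h. g q h / h) \<longlongrightarrow> 0) (at_left 0)"
    by (rule Lim_transform_eventually[of "\<lambda>_. 0"]) (auto simp: g_def eventually_at_filter)
  ultimately have "((\<lambda>h. g q h / h) \<longlongrightarrow> 0) (at 0)"
    by (simp add: filterlim_at_split)
  then show ?thesis using equal by (simp add: DERIV_def g_def cong: if_cong)
next
  case greater
  have "((\<lambda>x. poly q (1 / x) * exp (- 1 / x)) has_real_derivative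
      poly ([:0, 0, 1:] * (q - pderiv q)) (1 / x) * exp (- 1 / x)) (at x)"
    using greater by (auto intro!: derivative_eq_intros DERIV_chain2[OF poly_DERIV] 
        simp: field_simps power2_eq_square)
  then have "(g q has_real_derivative poly ([:0, 0, 1:] * (q - pderiv q)) (1 / x) * exp (- 1 / x)) (at x)"
    by (rule DERIV_cong_ev[THEN iffD1, rotated -1])
      (use greater in \<open>auto simp: g_def intro!: eventually_mono[OF eventually_nhds_in_open[of "{0<..}"]]\<close>)
  then show ?thesis using greater by (simp add: g_def)
qed

lemma smooth_poly_exp_flat:
  "smooth (\<lambda>x::real. if 0 < x then poly q (1 / x) * exp (- 1 / x) else 0)"
proof (rule smooth_coinduct[where P="\<lambda>g. \<exists>c q. g =
    (\<lambda>x::real. c * (if 0 < x then poly q (1 / x) * exp (- 1 / x) else 0))"])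
  show "\<exists>c qa. (\<lambda>x::real. if 0 < x then poly q (1 / x) * exp (- 1 / x) else 0) =
      (\<lambda>x. c * (if 0 < x then poly qa (1 / x) * exp (- 1 / x) else 0))"
    by (intro exI[of _ 1] exI[of _ q]) auto
  fix g :: "real \<Rightarrow> real"
  assume "\<exists>c q. g = (\<lambda>x. c * (if 0 < x then poly q (1 / x) * exp (- 1 / x) else 0))"
  then obtain c q where g: "g = (\<lambda>x. c * (if 0 < x then poly q (1 / x) * exp (- 1 / x) else 0))" by blast
  define F where "F x = (if 0 < x then poly ([:0, 0, 1:] * (q - pderiv q)) (1 / x) * exp (- 1 / x) else 0)"
    for x :: real
  have "(g has_real_derivative c * F x) (at x)" for x
    unfolding g F_def by (rule DERIV_cmult[OF poly_exp_flat_derivative])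
  then have "(g has_derivative (\<lambda>a. (a * c) * F x)) (at x)" for x
    by (simp add: has_field_derivative_def mult.assoc mult_commute_abs)
  moreover have "\<exists>c' q. (\<lambda>x. (a * c) * F x) = (\<lambda>x. c' * (if 0 < x then poly q (1 / x) * exp (- 1 / x) else 0))" for a
    unfolding F_def by blast
  ultimately show "\<exists>f'. (\<forall>p. (g has_derivative (\<lambda>a. f' a p)) (at p)) \<and> (\<forall>a. \<exists>c q. f' a =
      (\<lambda>x. c * (if 0 < x then poly q (1 / x) * exp (- 1 / x) else 0)))"
    by (intro exI[of _ "\<lambda>a x. (a * c) * F x"]) auto
qed

text \<open>
  With \<open>b x\<close> the function $e^{-1/x}$ extended by 0, the quotient of \<open>b x\<close> by \<open>b x + b (1 - x)\<close> is such a
  function.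
\<close>

lemma smooth_cutoff:
  "\<exists>h::real \<Rightarrow> real. smooth h \<and> (\<forall>x\<le>0. h x = 0) \<and> (\<forall>x\<ge>1. h x = 1)"
proof -
  define b :: "real \<Rightarrow> real" where "b x = (if 0 < x then exp (- 1 / x) else 0)" for x
  have b: "smooth b"
    using smooth_poly_exp_flat[of 1] unfolding b_def[abs_def] by (simp cong: if_cong)
  have b1: "smooth (\<lambda>x. b (1 - x))"
    using smooth_affine[OF b, of "\<lambda>x. - x" 1] by (simp add: linear_neg linear_id[unfolded id_def] module_hom_uminus)
  have pos: "b x + b (1 - x) \<noteq> 0" for x
  proof -
    have "0 < b x + b (1 - x)"
      by (cases "0 < x") (auto simp: b_def add_pos_pos add_pos_nonneg)
    then show ?thesis by simp
  qed
  have "smooth (\<lambda>x. inverse (b x + b (1 - x)))"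
    using smooth_add[OF b b1] Ck_on_inverse[of UNIV "\<lambda>x. b x + b (1 - x)"] pos unfolding smooth_on_def by blast
  from smooth_mult[OF b this] show ?thesis
    by (intro exI[of _ "\<lambda>x. b x * inverse (b x + b (1 - x))"]) (auto simp: b_def)
qed

section \<open>Alternating forms\<close>

lemma alternating_cong: "alternating k f \<Longrightarrow> (\<And>i. i < k \<Longrightarrow> v i = w i) \<Longrightarrow> f v = f w"
  unfolding alternating_def by blast

lemma alternating_linear: "alternating k f \<Longrightarrow> i < k \<Longrightarrow> linear (\<lambda>a. f (v(i := a)))"
  unfolding alternating_def by blast

lemma alternating_repeat: "alternating k f \<Longrightarrow> i < k \<Longrightarrow> j < k \<Longrightarrow> i \<noteq> j \<Longrightarrow> v i = v j \<Longrightarrow> f v = 0"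
  unfolding alternating_def by (metis linorder_neqE_nat)

lemma alternating_transpose:
  assumes "alternating k f" "i < k" "j < k" "i \<noteq> j"
  shows "f (\<lambda>n. v (Transposition.transpose i j n)) = - f v"
proof -
  let ?g = "\<lambda>a b. f (v(i := a, j := b))"
  have l1: "linear (\<lambda>a. ?g a b)" for b
    using alternating_linear[OF assms(1,2), of "v(j := b)"] assms(4) by (simp add: fun_upd_twist)
  have l2: "linear (\<lambda>b. ?g a b)" for a
    using alternating_linear[OF assms(1,3), of "v(i := a)"] .
  have z: "?g a a = 0" for a
    using assms by (intro alternating_repeat[OF assms(1-4)]) auto
  have "?g (v i + v j) (v i + v j) = ?g (v i) (v i) + ?g (v i) (v j) + (?g (v j) (v i) + ?g (v j) (v j))"
    using linear_add[OF l1] linear_add[OF l2] by simp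
  then have "?g (v j) (v i) = - ?g (v i) (v j)" using z[of "v i"] z[of "v j"] z[of "v i + v j"] by simp
  moreover have "(\<lambda>n. v (Transposition.transpose i j n)) = v(i := v j, j := v i)"
    by (auto simp: Transposition.transpose_def)
  moreover have "v(i := v i, j := v j) = v" by simp
  ultimately show ?thesis by simp
qed

lemma alternating_permute:
  assumes f: "alternating k f" and "p permutes {..<k}"
  shows "f (\<lambda>i. v (p i)) = of_int (sign p) * f v"
proof -
  have "\<forall>v. f (\<lambda>i. v (p i)) = of_int (sign p) * f v"
    using assms(2) finite_lessThan
  proof (induction rule: permutes_induct)
    case id
    then show ?case by simp
  next
    case (swap a b p)
    show ?case
    proof
      fix v
      have "f (\<lambda>i. v ((Transposition.transpose a b \<circ> p) i)) = of_int (sign p) * f (\<lambda>i. v (Transposition.transpose a b i))"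
        using swap.IH[THEN spec, of "\<lambda>i. v (Transposition.transpose a b i)"] by simp
      also have "\<dots> = of_int (sign (Transposition.transpose a b \<circ> p)) * f v"
        using swap permutation_permutes[of p]
        by (subst alternating_transpose[OF f])
          (auto simp: sign_compose permutation_swap_id sign_swap_id)
      finally show "f (\<lambda>i. v ((Transposition.transpose a b \<circ> p) i)) = of_int (sign (Transposition.transpose a b \<circ> p)) * f v" .
    qed
  qed
  then show ?thesis by blast
qed

text \<open>
  A form is checked slot by slot in the inductive proofs below, which see only its first argument: it is
  enough that its contractions are alternating and that equal arguments in the first two slots give 0.
  Other coincidences with the first slot are moved to the second one by a transposition.
\<close>

lemma alternating_SucI:
  assumes "\<And>v w. (\<And>i. i < Suc k \<Longrightarrow> v i = w i) \<Longrightarrow> f v = f w"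
    and "\<And>a. alternating k (\<lambda>v. f (case_nat a v))"
    and "\<And>v. linear (\<lambda>a. f (case_nat a v))"
    and "\<And>a v. 0 < k \<Longrightarrow> f (case_nat a (case_nat a v)) = 0"
  shows "alternating (Suc k) f"
  unfolding alternating_def
proof (intro conjI allI impI)
  fix v w :: "nat \<Rightarrow> 'a" assume "\<forall>i<Suc k. v i = w i"
  then show "f v = f w" using assms(1) by blast
next
  fix v :: "nat \<Rightarrow> 'a" and i assume "i < Suc k"
  show "linear (\<lambda>a. f (v(i := a)))"
  proof (cases i)
    case 0
    have "v(i := a) = case_nat a (\<lambda>i. v (Suc i))" for a using 0 by (auto split: nat.split)
    then show ?thesis using assms(3) by simp
  next
    case (Suc j)
    have "v(i := a) = case_nat (v 0) ((\<lambda>i. v (Suc i))(j := a))" for a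
      using Suc by (auto split: nat.split)
    then show ?thesis
      using alternating_linear[OF assms(2), of j] Suc \<open>i < Suc k\<close> by simp
  qed
next
  fix v :: "nat \<Rightarrow> 'a" and i j assume ij: "i < j \<and> j < Suc k \<and> v i = v j"
  then obtain j' where j: "j = Suc j'" "j' < k" by (cases j) auto
  have v: "v = case_nat (v 0) (\<lambda>n. v (Suc n))" by (auto split: nat.split)
  show "f v = 0"
  proof (cases i)
    case (Suc i')
    show ?thesis
      by (subst v, rule alternating_repeat[OF assms(2), of i' j']) (use ij j Suc in auto)
  next
    case 0
    show ?thesis
    proof (cases "j' = 0")
      case True
      have "v = case_nat (v 0) (case_nat (v 0) (\<lambda>n. v (Suc (Suc n))))"
        using ij j 0 True by (auto split: nat.split)
      then show ?thesis using assms(4)[of "v 0"] j by (metis gr_zeroI less_zeroE)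
    next
      case False
      let ?w = "\<lambda>n. v (Suc (Transposition.transpose 0 j' n))"
      have "?w = case_nat (v 0) (\<lambda>n. ?w (Suc n))"
        using ij j 0 by (auto split: nat.split)
      then have "f (case_nat (v 0) ?w) = 0"
        using assms(4)[of "v 0"] j by (metis gr_zeroI less_zeroE)
      moreover have "f (case_nat (v 0) ?w) = - f (case_nat (v 0) (\<lambda>n. v (Suc n)))"
        by (rule alternating_transpose[OF assms(2), where v="\<lambda>n. v (Suc n)"]) (use j False in auto)
      ultimately show ?thesis using v by simp
    qed
  qed
qed

lemma alternating_0: "alternating 0 f \<longleftrightarrow> (\<forall>v w. f v = f w)"
  unfolding alternating_def by auto

lemma alternating_zero [simp]: "alternating k (\<lambda>v. 0)"
  unfolding alternating_def by (auto intro: linearI)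

lemma alternating_add:
  fixes f g :: "(nat \<Rightarrow> 'a::real_vector) \<Rightarrow> real"
  shows "alternating k f \<Longrightarrow> alternating k g \<Longrightarrow> alternating k (\<lambda>v. f v + g v)"
proof -
  assume f: "alternating k f" and g: "alternating k g"
  show ?thesis
    unfolding alternating_def
  proof (intro conjI allI impI)
    fix v w :: "nat \<Rightarrow> 'a" assume vw: "\<forall>i<k. v i = w i"
    show "f v + g v = f w + g w" using alternating_cong[OF f, of v w] alternating_cong[OF g, of v w] vw by simp
  next
    fix v :: "nat \<Rightarrow> 'a" and i assume "i < k"
    then show "linear (\<lambda>a. f (v(i := a)) + g (v(i := a)))" by (intro linear_compose_add alternating_linear[OF f] alternating_linear[OF g])
  next
    fix v :: "nat \<Rightarrow> 'a" and i j assume "i < j \<and> j < k \<and> v i = v j"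
    then show "f v + g v = 0" using alternating_repeat[OF f, of i j v] alternating_repeat[OF g, of i j v] by simp
  qed
qed

lemma linear_cmult_real: "linear f \<Longrightarrow> linear (\<lambda>x. (c::real) * f x)"
  using linear_compose_scale_right[of f c] by simp

lemma alternating_cmult:
  fixes f :: "(nat \<Rightarrow> 'a::real_vector) \<Rightarrow> real"
  shows "alternating k f \<Longrightarrow> alternating k (\<lambda>v. c * f v)"
proof -
  assume f: "alternating k f" 
  show ?thesis
    unfolding alternating_def
  proof (intro conjI allI impI)
    fix v w :: "nat \<Rightarrow> 'a" assume vw: "\<forall>i<k. v i = w i"
    show "c * f v = c * f w" using alternating_cong[OF f, of v w] vw by simp
  next
    fix v :: "nat \<Rightarrow> 'a" and i assume "i < k"
    then show "linear (\<lambda>a. c * f (v(i := a)))" by (intro linear_cmult_real alternating_linear[OF f])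
  next
    fix v :: "nat \<Rightarrow> 'a" and i j assume "i < j \<and> j < k \<and> v i = v j"
    then show "c * f v = 0" using alternating_repeat[OF f, of i j v] by simp
  qed
qed

lemma alternating_diff: "alternating k f \<Longrightarrow> alternating k g \<Longrightarrow> alternating k (\<lambda>v. f v - g v)"
  using alternating_add[of k f "\<lambda>v. - 1 * g v"] alternating_cmult[of k g "-1"] by simp

lemma alternating_sum: "(\<And>i. i \<in> I \<Longrightarrow> alternating k (f i)) \<Longrightarrow> alternating k (\<lambda>v. \<Sum>i\<in>I. f i v)"
  by (induction I rule: infinite_finite_induct) (auto intro: alternating_add)

lemma alternating_pull:
  assumes "alternating k f" "linear L"
  shows "alternating k (\<lambda>v. f (\<lambda>i. L (v i :: 'a::real_vector)))"
  unfolding alternating_def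
proof (intro conjI allI impI)
  fix v i assume "i < k"
  have "(\<lambda>j. L ((v(i := a)) j)) = (\<lambda>j. L (v j))(i := L a)" for a by auto
  then show "linear (\<lambda>a. f (\<lambda>j. L ((v(i := a)) j)))"
    using linear_compose[OF assms(2) alternating_linear[OF assms(1) \<open>i < k\<close>, of "\<lambda>j. L (v j)"]]
    by (simp add: o_def)
next
  fix v :: "nat \<Rightarrow> 'a" and i j assume "i < j \<and> j < k \<and> v i = v j"
  then show "f (\<lambda>i. L (v i)) = 0" by (intro alternating_repeat[OF assms(1), of i j]) auto
next
  fix v w :: "nat \<Rightarrow> 'a" assume "\<forall>i<k. v i = w i"
  then show "f (\<lambda>i. L (v i)) = f (\<lambda>i. L (w i))" by (intro alternating_cong[OF assms(1)]) auto
qed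

section \<open>Contraction\<close>

text \<open>
  The interior product.  The degree is an argument because the contraction of a 0-form is 0.
\<close>

definition contr :: "nat \<Rightarrow> 'e \<Rightarrow> 'e multiform \<Rightarrow> 'e multiform" where
  "contr k a f = (\<lambda>v. if k = 0 then 0 else f (case_nat a v))"

lemma contr_0 [simp]: "contr 0 a f = (\<lambda>v. 0)"
  and contr_Suc [simp]: "contr (Suc k) a f = (\<lambda>v. f (case_nat a v))"
  by (auto simp: contr_def)

text \<open>
  The principle behind the inductive proofs about the wedge product: forms of positive degree are equal
  as soon as their contractions are, which lowers the degree by one.
\<close>

lemma contr_ext:
  assumes "0 < k" "\<And>a v. contr k a f v = contr k a g v"
  shows "f = g"
proof
  fix v :: "nat \<Rightarrow> 'a"
  have "v = case_nat (v 0) (\<lambda>n. v (Suc n))" by (auto split: nat.split)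
  then show "f v = g v"
    using assms by (auto simp: contr_def) metis
qed

lemma case_nat_upd: "case_nat a (v(i := b)) = (case_nat a v)(Suc i := b)"
  by (auto split: nat.split)

lemma alternating_contr: "alternating k f \<Longrightarrow> alternating (k - 1) (contr k a f)"
proof (cases k)
  case (Suc n)
  assume f: "alternating k f"
  show ?thesis
    unfolding alternating_def
  proof (intro conjI allI impI)
    fix v w assume "\<forall>i<k - 1. v i = (w i :: 'a)"
    then show "contr k a f v = contr k a f w"
      using Suc by (auto intro!: alternating_cong[OF f] split: nat.split)
  next
    fix v i assume "i < k - 1"
    then show "linear (\<lambda>b. contr k a f (v(i := b)))"
      using Suc alternating_linear[OF f, of "Suc i"] by (simp add: case_nat_upd)
  next
    fix v :: "nat \<Rightarrow> 'a" and i j assume "i < j \<and> j < k - 1 \<and> v i = v j"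
    then show "contr k a f v = 0"
      using Suc alternating_repeat[OF f, of "Suc i" "Suc j" "case_nat a v"] by simp
  qed
qed simp

lemma alternating_contr_Suc: "alternating (Suc k) f \<Longrightarrow> alternating k (\<lambda>v. f (case_nat a v))"
  using alternating_contr[of "Suc k" f a] by simp

lemma linear_contr: "alternating (Suc k) f \<Longrightarrow> linear (\<lambda>a. f (case_nat a v))"
proof -
  assume f: "alternating (Suc k) f"
  have "(case_nat undefined v)(0 := a) = case_nat a v" for a by (auto split: nat.split)
  then show ?thesis using alternating_linear[OF f, of 0 "case_nat undefined v"] by simp
qed

lemma contr_contr_same: "alternating k f \<Longrightarrow> contr (k - 1) a (contr k a f) v = 0"
  by (cases "k - 1"; cases k) (auto intro: alternating_repeat[where i=0 and j=1])

lemma contr_contr_swap: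
  assumes "alternating k f"
  shows "contr (k - 1) a (contr k b f) v = - contr (k - 1) b (contr k a f) v"
proof (cases "k - 1")
  case (Suc n)
  then have k: "k = Suc (Suc n)" by simp
  have "(\<lambda>n. case_nat b (case_nat a v) (Transposition.transpose 0 1 n)) = case_nat a (case_nat b v)"
    by (auto split: nat.split simp: Transposition.transpose_def fun_eq_iff)
  then show ?thesis
    using alternating_transpose[OF assms, of 0 1 "case_nat b (case_nat a v)"] k by simp
qed (cases k, auto)

lemma sign_transpose_comp: "permutation p \<Longrightarrow> a \<noteq> b \<Longrightarrow> sign (Transposition.transpose a b \<circ> p) = - sign p"
  and sign_comp_transpose: "permutation p \<Longrightarrow> a \<noteq> b \<Longrightarrow> sign (p \<circ> Transposition.transpose a b) = - sign p"
  by (subst sign_compose; simp add: permutation_swap_id sign_swap_id)+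

section \<open>The wedge product\<close>

lemma alt_wedge_zero [simp]: "alt_wedge k l (\<lambda>v. 0) g = (\<lambda>v. 0)" "alt_wedge k l f (\<lambda>v. 0) = (\<lambda>v. 0)"
  unfolding alt_wedge_def by auto

lemma alt_wedge_add_left: "alt_wedge k l (\<lambda>v. f v + f' v) g v = alt_wedge k l f g v + alt_wedge k l f' g v"
  unfolding alt_wedge_def by (simp add: algebra_simps sum.distrib add_divide_distrib)

lemma alt_wedge_add_right: "alt_wedge k l f (\<lambda>v. g v + g' v) v = alt_wedge k l f g v + alt_wedge k l f g' v"
  unfolding alt_wedge_def by (simp add: algebra_simps sum.distrib add_divide_distrib)

lemma alt_wedge_cmult_left: "alt_wedge k l (\<lambda>v. c * f v) g v = c * alt_wedge k l f g v"
  unfolding alt_wedge_def by (simp add: sum_distrib_left mult_ac)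

lemma alt_wedge_cmult_right: "alt_wedge k l f (\<lambda>v. c * g v) v = c * alt_wedge k l f g v"
  unfolding alt_wedge_def by (simp add: sum_distrib_left mult_ac)

lemma alt_wedge_diff_left: "alt_wedge k l (\<lambda>v. f v - f' v) g v = alt_wedge k l f g v - alt_wedge k l f' g v"
  unfolding alt_wedge_def by (simp add: algebra_simps sum_subtractf diff_divide_distrib)

lemma alt_wedge_diff_right: "alt_wedge k l f (\<lambda>v. g v - g' v) v = alt_wedge k l f g v - alt_wedge k l f g' v"
  unfolding alt_wedge_def by (simp add: algebra_simps sum_subtractf diff_divide_distrib)

lemma alt_wedge_sum_right: "alt_wedge k l f (\<lambda>v. \<Sum>i\<in>I. g i v) v = (\<Sum>i\<in>I. alt_wedge k l f (g i) v)"
  by (induction I rule: infinite_finite_induct) (auto simp: alt_wedge_add_right)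

lemma alt_wedge_pull:
  "alt_wedge k l (\<lambda>v. f (\<lambda>i. L (v i))) (\<lambda>v. g (\<lambda>i. L (v i))) v = alt_wedge k l f g (\<lambda>i. L (v i))"
  unfolding alt_wedge_def ..

lemma alternating_wedge:
  assumes f: "alternating k f" and g: "alternating l g"
  shows "alternating (k + l) (alt_wedge k l f g)"
proof -
  define F where "F u = f u * g (\<lambda>i. u (k + i))" for u
  have w: "alt_wedge k l f g v =
      1 / (fact k * fact l) * (\<Sum>p | p permutes {..<k + l}. of_int (sign p) * F (\<lambda>i. v (p i)))" for v
    unfolding alt_wedge_def F_def by (simp add: mult.assoc)
  have lin: "linear (\<lambda>a. F (u(i := a)))" if "i < k + l" for u i
  proof (cases "i < k")
    case True
    have "g (\<lambda>n. (u(i := a)) (k + n)) = g (\<lambda>n. u (k + n))" for a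
      using True by (intro alternating_cong[OF g]) auto
    then show ?thesis
      unfolding F_def using linear_cmult_real[OF alternating_linear[OF f True, of u], of "g (\<lambda>n. u (k + n))"]
      by (simp add: mult.commute)
  next
    case False
    then have "i - k < l" using that by auto
    have "f (u(i := a)) = f u" for a
      using False by (intro alternating_cong[OF f]) auto
    moreover have "(\<lambda>n. (u(i := a)) (k + n)) = (\<lambda>n. u (k + n))(i - k := a)" for a
      using False by (auto simp: fun_eq_iff)
    ultimately show ?thesis
      unfolding F_def using linear_cmult_real[OF alternating_linear[OF g \<open>i - k < l\<close>, of "\<lambda>n. u (k + n)"], of "f u"]
      by simp
  qed
  have "alternating (k + l) (\<lambda>v. \<Sum>p | p permutes {..<k + l}. of_int (sign p) * F (\<lambda>i. v (p i)))"
    unfolding alternating_def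
  proof (intro conjI allI impI)
    fix v w :: "nat \<Rightarrow> 'a" assume vw: "\<forall>i<k + l. v i = w i"
    have "F (\<lambda>i. v (p i)) = F (\<lambda>i. w (p i))" if p: "p permutes {..<k + l}" for p
    proof -
      have "p i < k + l" if "i < k + l" for i using permutes_in_image[OF p, of i] that by auto
      then have "f (\<lambda>i. v (p i)) = f (\<lambda>i. w (p i))" "g (\<lambda>i. v (p (k + i))) = g (\<lambda>i. w (p (k + i)))"
        using vw by (auto intro!: alternating_cong[OF f] alternating_cong[OF g])
      then show ?thesis by (simp add: F_def)
    qed
    then show "(\<Sum>p | p permutes {..<k + l}. of_int (sign p) * F (\<lambda>i. v (p i))) =
        (\<Sum>p | p permutes {..<k + l}. of_int (sign p) * F (\<lambda>i. w (p i)))" by (intro sum.cong) auto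
  next
    fix v :: "nat \<Rightarrow> 'a" and j assume j: "j < k + l"
    have "linear (\<lambda>a. F (\<lambda>i. (v(j := a)) (p i)))" if p: "p permutes {..<k + l}" for p
    proof -
      have "(\<lambda>i. (v(j := a)) (p i)) = (\<lambda>i. v (p i))(inv_into UNIV p j := a)" for a
        using permutes_inverses[OF p] by (auto simp: fun_eq_iff)
      moreover have "inv_into UNIV p j < k + l"
        using permutes_in_image[OF permutes_inv[OF p], of j] j by auto
      ultimately show ?thesis using lin by simp
    qed
    then show "linear (\<lambda>a. \<Sum>p | p permutes {..<k + l}. of_int (sign p) * F (\<lambda>i. (v(j := a)) (p i)))"
      by (intro linear_compose_sum ballI linear_cmult_real) auto
  next
    fix v :: "nat \<Rightarrow> 'a" and i j assume ij: "i < j \<and> j < k + l \<and> v i = v j"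
    let ?S = "\<Sum>p | p permutes {..<k + l}. of_int (sign p) * F (\<lambda>i. v (p i))"
    have t: "Transposition.transpose i j permutes {..<k + l}" using ij by (intro permutes_swap_id) auto
    have vt: "v (Transposition.transpose i j n) = v n" for n using ij by (auto simp: Transposition.transpose_def)
    have "?S = (\<Sum>p | p permutes {..<k + l}.
        of_int (sign (Transposition.transpose i j \<circ> p)) * F (\<lambda>n. v ((Transposition.transpose i j \<circ> p) n)))"
      by (rule setum_permutations_compose_left[OF t])
    also have "\<dots> = (\<Sum>p | p permutes {..<k + l}. - (of_int (sign p) * F (\<lambda>i. v (p i))))"
    proof (intro sum.cong refl)
      fix p assume "p \<in> {p. p permutes {..<k + l}}"
      then have "permutation p" using permutation_permutes by blast
      then show "of_int (sign (Transposition.transpose i j \<circ> p)) * F (\<lambda>n. v ((Transposition.transpose i j \<circ> p) n)) =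
          - (of_int (sign p) * F (\<lambda>i. v (p i)))"
        using ij by (simp add: vt sign_compose permutation_swap_id sign_swap_id)
    qed
    also have "\<dots> = - ?S" by (simp add: sum_negf)
    finally show "?S = 0" by simp
  qed
  from alternating_cmult[OF this, of "1 / (fact k * fact l)"] show ?thesis unfolding w[abs_def] .
qed


text \<open>
  The permutations of \<open>{..<Suc n}\<close> that fix 0 are the permutations of \<open>{..<n}\<close>, shifted by one.
\<close>

definition perm_ext0 :: "(nat \<Rightarrow> nat) \<Rightarrow> nat \<Rightarrow> nat" where
  "perm_ext0 p = case_nat 0 (\<lambda>i. Suc (p i))"

lemma perm_ext0_simps [simp]: "perm_ext0 p 0 = 0" "perm_ext0 p (Suc i) = Suc (p i)"
  by (auto simp: perm_ext0_def)

lemma perm_ext0: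
  assumes "p permutes {..<n}"
  shows "perm_ext0 p permutes {..<Suc n} \<and> sign (perm_ext0 p) = sign p"
  using assms finite_lessThan
proof (induction rule: permutes_induct)
  case id
  have "perm_ext0 id = id" by (auto simp: perm_ext0_def fun_eq_iff split: nat.split)
  then show ?case by (metis permutes_id)
next
  case (swap a b p)
  have eq: "perm_ext0 (Transposition.transpose a b \<circ> p) = Transposition.transpose (Suc a) (Suc b) \<circ> perm_ext0 p"
    by (auto simp: perm_ext0_def fun_eq_iff Transposition.transpose_def split: nat.split)
  have t: "Transposition.transpose (Suc a) (Suc b) permutes {..<Suc n}" using swap by (intro permutes_swap_id) auto
  have pp: "permutation p" "permutation (perm_ext0 p)" using swap permutation_permutes by blast+
  show ?case
    unfolding eq
    using permutes_compose[OF _ t] swap.IH sign_transpose_comp[OF pp(1) swap(3)]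
      sign_transpose_comp[OF pp(2), of "Suc a" "Suc b"] swap(3) by (metis Suc_inject)
qed

lemma perm_ext0_surj:
  assumes s: "s permutes {..<Suc n}" and "s 0 = 0"
  shows "\<exists>p. p permutes {..<n} \<and> s = perm_ext0 p"
proof -
  define p where "p i = s (Suc i) - 1" for i
  have inj: "s i = s j \<longleftrightarrow> i = j" for i j using permutes_inj[OF s] by (auto dest: injD)
  have nz: "s (Suc i) \<noteq> 0" for i using inj[of "Suc i" 0] assms(2) by simp
  then have Sp: "Suc (p i) = s (Suc i)" for i by (simp add: p_def)
  have "inj p" by (rule injI) (metis Sp inj Suc_inject)
  moreover have "p ` {..<n} \<subseteq> {..<n}"
  proof safe
    fix i assume "i < n"
    then show "p i < n" using permutes_in_image[OF s, of "Suc i"] Sp[of i] by auto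
  qed
  ultimately have "bij_betw p {..<n} {..<n}"
    by (metis bij_betw_def endo_inj_surj finite_lessThan inj_on_subset subset_UNIV)
  moreover have "p i = i" if "i \<notin> {..<n}" for i
    using permutes_not_in[OF s, of "Suc i"] that Sp[of i] by simp
  ultimately have "p permutes {..<n}" by (rule bij_imp_permutes)
  moreover have "s = perm_ext0 p"
    using Sp assms(2) by (auto simp: perm_ext0_def fun_eq_iff split: nat.split)
  ultimately show ?thesis by blast
qed

lemma sum_perm_ext0:
  "(\<Sum>s | s permutes {..<Suc n} \<and> s 0 = 0. h s) = (\<Sum>p | p permutes {..<n}. h (perm_ext0 p))"
proof -
  have "inj perm_ext0"
    by (rule injI) (metis Suc_inject ext perm_ext0_simps(2))
  moreover have "{s. s permutes {..<Suc n} \<and> s 0 = 0} = perm_ext0 ` {p. p permutes {..<n}}"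
    using perm_ext0 perm_ext0_surj by (fastforce simp: image_iff)
  ultimately show ?thesis
    by (simp add: sum.reindex inj_on_subset)
qed

text \<open>
  The cycle that moves \<open>k\<close> to the front; it reduces the permutations sending \<open>k\<close> to 0 to those that
  fix 0, at the cost of the sign $(-1)^k$.
\<close>

definition perm_cycle :: "nat \<Rightarrow> nat \<Rightarrow> nat" where
  "perm_cycle k i = (if i < k then Suc i else if i = k then 0 else i)"

lemma perm_cycle:
  "k \<le> n \<Longrightarrow> perm_cycle k permutes {..<Suc n} \<and> sign (perm_cycle k) = (- 1) ^ k"
proof (induction k)
  case 0
  have "perm_cycle 0 = id" by (auto simp: perm_cycle_def fun_eq_iff)
  then show ?case by (metis permutes_id sign_id power_0)
next
  case (Suc k)
  have eq: "perm_cycle (Suc k) = perm_cycle k \<circ> Transposition.transpose k (Suc k)"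
    by (auto simp: perm_cycle_def fun_eq_iff Transposition.transpose_def)
  have t: "Transposition.transpose k (Suc k) permutes {..<Suc n}" using Suc by (intro permutes_swap_id) auto
  have pp: "permutation (perm_cycle k)" using Suc permutation_permutes[of "perm_cycle k"] by fastforce
  show ?case
    unfolding eq using permutes_compose[OF t] Suc sign_comp_transpose[OF pp, of k "Suc k"]
    by (metis Suc_leD n_not_Suc_n power_Suc mult_minus1)
qed

text \<open>
  The interior product is an antiderivation.  The sum over all permutations \<open>p\<close> that defines the wedge
  product is grouped by the slot \<open>p\<close> sends to the first argument \<open>a\<close>.  If that slot belongs to \<open>f\<close>, it
  may be taken to be the first slot of \<open>f\<close>, as \<open>f\<close> is alternating; the \<open>k\<close> equal groups cancel
  \<open>k\<close> from the factor \<open>fact k\<close>.  The slots of \<open>g\<close> are treated in the same way.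
\<close>

lemma contr_wedge:
  assumes f: "alternating k f" and g: "alternating l g"
  shows "contr (k + l) a (alt_wedge k l f g) v =
    alt_wedge (k - 1) l (contr k a f) g v + (- 1) ^ k * alt_wedge k (l - 1) f (contr l a g) v"
proof (cases "k + l")
  case 0
  then show ?thesis by simp
next
  case (Suc n)
  define u where "u = case_nat a v"
  define F where "F u = f u * g (\<lambda>i. u (k + i))" for u
  define h where "h p = of_int (sign p) * F (\<lambda>i. u (p i))" for p
  define S where "S i = (\<Sum>p | p permutes {..<Suc n} \<and> p i = 0. h p)" for i
  let ?P = "{p. p permutes {..<Suc n}}"
  have fin: "finite ?P" by (rule finite_permutations) simp
  have "sum h ?P = (\<Sum>i<Suc n. \<Sum>p | p \<in> ?P \<and> inv_into UNIV p 0 = i. h p)"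
    by (rule sum.group[symmetric]) (use fin in \<open>auto simp: permutes_in_image[OF permutes_inv, of _ "{..<Suc n}" 0, simplified]\<close>)
  also have "\<dots> = (\<Sum>i<Suc n. S i)"
    unfolding S_def by (intro sum.cong refl) (auto simp: permutes_inv_eq permutes_inverses)
  also have "\<dots> = (\<Sum>i<k. S i) + (\<Sum>i=k..<k+l. S i)"
    by (simp add: Suc[symmetric] lessThan_atLeast0 sum.atLeastLessThan_concat)
  finally have total: "sum h ?P = (\<Sum>i<k. S i) + (\<Sum>i=k..<k+l. S i)" .
  have same: "S i = S j" if "i < k + l" "j < k + l" and
    anti: "i \<noteq> j \<Longrightarrow> (\<And>u. F (\<lambda>n. u (Transposition.transpose i j n)) = - F u)" for i j
  proof (cases "i = j")
    case False
    let ?t = "Transposition.transpose i j"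
    have t: "?t permutes {..<Suc n}" using that Suc by (intro permutes_swap_id) auto
    show ?thesis
      unfolding S_def
    proof (rule sum.reindex_bij_witness[where i="\<lambda>p. p \<circ> ?t" and j="\<lambda>p. p \<circ> ?t"])
      fix p assume "p \<in> {p. p permutes {..<Suc n} \<and> p i = 0}"
      then have p: "p permutes {..<Suc n}" "p i = 0" "permutation p"
        using permutation_permutes by blast+
      show "p \<circ> ?t \<circ> ?t = p" by (simp add: comp_assoc)
      show "p \<circ> ?t \<in> {p. p permutes {..<Suc n} \<and> p j = 0}"
        using p permutes_compose[OF t] by simp
      show "h (p \<circ> ?t) = h p"
        using p False anti[OF False, of "\<lambda>i. u (p i)"]
        by (simp add: h_def sign_compose permutation_swap_id sign_swap_id)
    next
      fix p assume "p \<in> {p. p permutes {..<Suc n} \<and> p j = 0}"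
      then have p: "p permutes {..<Suc n}" "p j = 0" by auto
      show "p \<circ> ?t \<circ> ?t = p" by (simp add: comp_assoc)
      show "p \<circ> ?t \<in> {p. p permutes {..<Suc n} \<and> p i = 0}"
        using p permutes_compose[OF t] by simp
    qed
  qed simp
  have anti1: "F (\<lambda>n. u (Transposition.transpose i j n)) = - F u" if "i < k" "j < k" "i \<noteq> j" for i j u
  proof -
    have "g (\<lambda>n. u (Transposition.transpose i j (k + n))) = g (\<lambda>n. u (k + n))"
      using that by (intro alternating_cong[OF g]) (auto simp: Transposition.transpose_def)
    then show ?thesis using alternating_transpose[OF f that] by (simp add: F_def)
  qed
  have anti2: "F (\<lambda>n. u (Transposition.transpose i j n)) = - F u" if "k \<le> i" "k \<le> j" "i < k + l" "j < k + l" "i \<noteq> j" for i j u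
  proof -
    have "f (\<lambda>n. u (Transposition.transpose i j n)) = f u"
      using that by (intro alternating_cong[OF f]) (auto simp: Transposition.transpose_def)
    moreover have "(\<lambda>n. u (Transposition.transpose i j (k + n))) = (\<lambda>n. u (k + Transposition.transpose (i - k) (j - k) n))"
      using that by (auto simp: fun_eq_iff Transposition.transpose_def)
    then have "g (\<lambda>n. u (Transposition.transpose i j (k + n))) = - g (\<lambda>n. u (k + n))"
      using alternating_transpose[OF g, of "i - k" "j - k" "\<lambda>n. u (k + n)"] that by simp
    ultimately show ?thesis by (simp add: F_def)
  qed
  \<comment> \<open>the groups in which the vector a is inserted into f\<close>
  have T0: "(\<Sum>i<k. S i) / (fact k * fact l) = alt_wedge (k - 1) l (contr k a f) g v"
  proof (cases k)
    case (Suc k')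
    have "S i = S 0" if "i < k" for i using that Suc anti1 by (intro same) auto
    then have "(\<Sum>i<k. S i) = (\<Sum>i<k. S 0)" by (intro sum.cong refl) (metis lessThan_iff)
    then have "(\<Sum>i<k. S i) = k * S 0" by simp
    moreover have "S 0 = (\<Sum>p | p permutes {..<k' + l}. of_int (sign p) *
       contr k a f (\<lambda>i. v (p i)) * g (\<lambda>i. v (p (k' + i))))"
    proof -
      have n: "n = k' + l" using Suc \<open>k + l = Suc n\<close> by simp
      have "f (\<lambda>i. u (perm_ext0 p i)) = contr k a f (\<lambda>i. v (p i))" for p
        using Suc by (auto simp: u_def perm_ext0_def intro!: alternating_cong[OF f] split: nat.split)
      then show ?thesis
        unfolding S_def sum_perm_ext0 n using perm_ext0
        by (intro sum.cong refl) (auto simp: h_def F_def Suc u_def mult.assoc)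
    qed
    moreover have "real k * x / (fact k * fact l) = x / (fact k' * fact l)" for x
      using Suc by (simp add: mult.assoc del: of_nat_Suc)
    ultimately show ?thesis unfolding alt_wedge_def using Suc by simp
  qed simp
  \<comment> \<open>the groups in which the vector a is inserted into g\<close>
  have T1: "(\<Sum>i=k..<k+l. S i) / (fact k * fact l) = (- 1) ^ k * alt_wedge k (l - 1) f (contr l a g) v"
  proof (cases l)
    case (Suc l')
    have n: "n = k + l'" using Suc \<open>k + l = Suc n\<close> by simp
    have c: "perm_cycle k permutes {..<Suc n}" "sign (perm_cycle k) = (- 1) ^ k" "permutation (perm_cycle k)"
      using perm_cycle[of k n] n permutation_permutes[of "perm_cycle k"] by auto
    have "S i = S k" if "k \<le> i" "i < k + l" for i using that Suc anti2 by (intro same) auto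
    then have "(\<Sum>i=k..<k+l. S i) = (\<Sum>i=k..<k+l. S k)" by (intro sum.cong refl) (metis atLeastLessThan_iff)
    then have "(\<Sum>i=k..<k+l. S i) = l * S k" by simp
    moreover have "S k = (\<Sum>p | p permutes {..<Suc n} \<and> p 0 = 0. h (p \<circ> perm_cycle k))"
      unfolding S_def
    proof (rule sum.reindex_bij_witness[where i="\<lambda>p. p \<circ> perm_cycle k" and j="\<lambda>p. p \<circ> inv_into UNIV (perm_cycle k)"])
      have ck: "perm_cycle k k = 0" by (simp add: perm_cycle_def)
      then have ck': "inv_into UNIV (perm_cycle k) 0 = k" using c(1) by (simp add: permutes_inv_eq)
      fix p assume "p \<in> {p. p permutes {..<Suc n} \<and> p k = 0}"
      then have p: "p permutes {..<Suc n}" "p k = 0" by auto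
      show "p \<circ> inv_into UNIV (perm_cycle k) \<circ> perm_cycle k = p"
        using permutes_inv_o(2)[OF c(1)] by (simp add: comp_assoc)
      then show "h (p \<circ> inv_into UNIV (perm_cycle k) \<circ> perm_cycle k) = h p" by simp
      show "p \<circ> inv_into UNIV (perm_cycle k) \<in> {p. p permutes {..<Suc n} \<and> p 0 = 0}"
        using p permutes_compose[OF permutes_inv[OF c(1)]] ck' by simp
    next
      fix p assume "p \<in> {p. p permutes {..<Suc n} \<and> p 0 = 0}"
      then have p: "p permutes {..<Suc n}" "p 0 = 0" by auto
      show "p \<circ> perm_cycle k \<circ> inv_into UNIV (perm_cycle k) = p"
        using permutes_inv_o(1)[OF c(1)] by (simp add: comp_assoc)
      show "p \<circ> perm_cycle k \<in> {p. p permutes {..<Suc n} \<and> p k = 0}"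
        using p permutes_compose[OF c(1)] by (simp add: perm_cycle_def)
    qed
    moreover have "\<dots> = (\<Sum>p | p permutes {..<k + l'}. (- 1) ^ k * (of_int (sign p) *
       f (\<lambda>i. v (p i)) * contr l a g (\<lambda>i. v (p (k + i)))))"
    proof -
      have f': "f (\<lambda>i. u (perm_ext0 p (perm_cycle k i))) = f (\<lambda>i. v (p i))" for p
        by (auto simp: u_def perm_cycle_def intro!: alternating_cong[OF f])
      have g': "g (\<lambda>i. u (perm_ext0 p (perm_cycle k (k + i)))) = contr l a g (\<lambda>i. v (p (k + i)))" for p
        using Suc by (auto simp: u_def perm_cycle_def intro!: alternating_cong[OF g] split: nat.split)
      have "h (perm_ext0 p \<circ> perm_cycle k) = (- 1) ^ k * (of_int (sign p) *
       f (\<lambda>i. v (p i)) * contr l a g (\<lambda>i. v (p (k + i))))" if p: "p permutes {..<n}" for p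
      proof -
        have "permutation (perm_ext0 p)" using perm_ext0[OF p] permutation_permutes by blast
        then show ?thesis
          using perm_ext0[OF p] c by (simp add: h_def F_def sign_compose f' g')
      qed
      then show ?thesis
        unfolding sum_perm_ext0 using n by (intro sum.cong refl) auto
    qed
    moreover have "real l * x / (fact k * fact l) = x / (fact k * fact l')" for x
      using Suc by (simp add: mult.left_commute del: of_nat_Suc)
    ultimately show ?thesis
      unfolding alt_wedge_def using Suc by (simp add: sum_distrib_left[symmetric])
  qed simp
  have "contr (k + l) a (alt_wedge k l f g) v = sum h ?P / (fact k * fact l)"
    unfolding Suc contr_Suc by (simp add: alt_wedge_def h_def F_def u_def Suc mult.assoc)
  also have "\<dots> = (\<Sum>i<k. S i) / (fact k * fact l) + (\<Sum>i=k..<k+l. S i) / (fact k * fact l)"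
    by (simp add: total add_divide_distrib)
  finally show ?thesis by (simp add: T0 T1)
qed

section \<open>Associativity and graded commutativity\<close>

lemma alt_wedge_0_left:
  assumes f: "alternating 0 f" and g: "alternating l g"
  shows "alt_wedge 0 l f g v = f v * g v"
proof -
  have "of_int (sign p) * f (\<lambda>i. v (p i)) * g (\<lambda>i. v (p (0 + i))) = f v * g v" if "p permutes {..<l}" for p
  proof -
    have "f (\<lambda>i. v (p i)) = f v" using f by (auto simp: alternating_0)
    moreover have "of_int (sign p) * of_int (sign p) = (1::real)" by (simp add: sign_def)
    ultimately show ?thesis
      using alternating_permute[OF g that, of v] by (simp add: algebra_simps)
  qed
  then have "alt_wedge 0 l f g v = (\<Sum>p | p permutes {..<l}. f v * g v) / fact l"
    unfolding alt_wedge_def by simp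
  also have "\<dots> = f v * g v"
    by (simp add: card_permutations[of "{..<l}" l])
  finally show ?thesis .
qed

lemma contr_wedge_fun:
  assumes "alternating k f" "alternating l g"
  shows "contr (k + l) a (alt_wedge k l f g) =
    (\<lambda>v. alt_wedge (k - 1) l (contr k a f) g v + (- 1) ^ k * alt_wedge k (l - 1) f (contr l a g) v)"
  using contr_wedge[OF assms] by (rule ext)

text \<open>
  By \<open>contr_wedge\<close> both sides have the same contractions, namely sums of products of lower total degree,
  so induction applies and no sum over permutations is touched.
\<close>

lemma alt_wedge_assoc:
  assumes "alternating k f" "alternating l g" "alternating m h"
  shows "alt_wedge (k + l) m (alt_wedge k l f g) h = alt_wedge k (l + m) f (alt_wedge l m g h)"
  using assms
proof (induction "k + l + m" arbitrary: k l m f g h)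
  case 0
  then have z: "k = 0" "l = 0" "m = 0" by auto
  have f: "alternating 0 f" and g: "alternating 0 g" and h: "alternating 0 h" using 0 z by auto
  have e: "alternating 0 f \<Longrightarrow> alternating 0 g \<Longrightarrow> alt_wedge 0 0 f g = (\<lambda>v. f v * g v)" for f g :: "'a multiform"
    by (simp add: fun_eq_iff alt_wedge_0_left)
  have p: "alternating 0 f \<Longrightarrow> alternating 0 g \<Longrightarrow> alternating 0 (\<lambda>v. f v * g v)" for f g :: "'a multiform"
    unfolding alternating_0 by metis
  show ?case by (simp add: z e p f g h mult.assoc)
next
  case (Suc n)
  note f = Suc.prems(1) and g = Suc.prems(2) and h = Suc.prems(3)
  show ?case
  proof (rule contr_ext[of "k + l + m"])
    show "0 < k + l + m" using Suc.hyps(2) by linarith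
    fix a v
    let ?f = "contr k a f" and ?g = "contr l a g" and ?h = "contr m a h"
    note f' = alternating_contr[OF f, of a] and g' = alternating_contr[OF g, of a]
      and h' = alternating_contr[OF h, of a]
    have A1: "alt_wedge (k + l - 1) m (alt_wedge (k - 1) l ?f g) h = alt_wedge (k - 1) (l + m) ?f (alt_wedge l m g h)"
    proof (cases k)
      case (Suc k')
      then show ?thesis using Suc.hyps(1)[of "k - 1" l m ?f g h] Suc.hyps(2) f' g h by simp
    qed simp
    have A2: "alt_wedge (k + l - 1) m (alt_wedge k (l - 1) f ?g) h = alt_wedge k (l + m - 1) f (alt_wedge (l - 1) m ?g h)"
    proof (cases l)
      case (Suc l')
      then show ?thesis using Suc.hyps(1)[of k "l - 1" m f ?g h] Suc.hyps(2) f g' h by simp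
    qed simp
    have A3: "alt_wedge (k + l) (m - 1) (alt_wedge k l f g) ?h = alt_wedge k (l + m - 1) f (alt_wedge l (m - 1) g ?h)"
    proof (cases m)
      case (Suc m')
      then show ?thesis using Suc.hyps(1)[of k l "m - 1" f g ?h] Suc.hyps(2) f g h' by simp
    qed simp
    show "contr (k + l + m) a (alt_wedge (k + l) m (alt_wedge k l f g) h) v =
        contr (k + l + m) a (alt_wedge k (l + m) f (alt_wedge l m g h)) v"
      using contr_wedge[OF alternating_wedge[OF f g] h, of a v]
        contr_wedge[OF f alternating_wedge[OF g h], of a v]
      by (simp add: contr_wedge_fun f g h alt_wedge_add_left alt_wedge_add_right alt_wedge_cmult_left
          alt_wedge_cmult_right A1[unfolded One_nat_def] A2[unfolded One_nat_def] A3[unfolded One_nat_def] add.assoc power_add algebra_simps)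
  qed
qed

text \<open>
  Again by induction on the total degree, comparing contractions.
\<close>

lemma alt_wedge_commute:
  assumes "alternating k f" "alternating l g"
  shows "alt_wedge k l f g = (\<lambda>v. (- 1) ^ (k * l) * alt_wedge l k g f v)"
  using assms
proof (induction "k + l" arbitrary: k l f g)
  case 0
  then show ?case by (simp add: fun_eq_iff alt_wedge_0_left)
next
  case (Suc n)
  note f = Suc.prems(1) and g = Suc.prems(2)
  show ?case
  proof (rule contr_ext[of "k + l"])
    show "0 < k + l" using Suc.hyps(2) by linarith
    fix a v
    let ?f = "contr k a f" and ?g = "contr l a g"
    note f' = alternating_contr[OF f, of a] and g' = alternating_contr[OF g, of a]
    have A1: "alt_wedge (k - 1) l ?f g v = (- 1) ^ (k * l) * ((- 1) ^ l * alt_wedge l (k - 1) g ?f v)"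
    proof (cases k)
      case (Suc k')
      have "((- 1::real) ^ l * (- 1) ^ l) = 1" by (simp flip: power_mult_distrib)
      then show ?thesis
        using Suc.hyps(1)[of "k - 1" l ?f g] Suc.hyps(2) f' g Suc by (simp add: power_add mult.assoc mult.left_commute)
    qed simp
    have A2: "(- 1) ^ k * alt_wedge k (l - 1) f ?g v = (- 1) ^ (k * l) * alt_wedge (l - 1) k ?g f v"
    proof (cases l)
      case (Suc l')
      then show ?thesis using Suc.hyps(1)[of k "l - 1" f ?g] Suc.hyps(2) f g' by (simp add: power_add mult.assoc)
    qed simp
    have "contr (k + l) a (\<lambda>v. (- 1) ^ (k * l) * alt_wedge l k g f v) v =
        (- 1) ^ (k * l) * contr (l + k) a (alt_wedge l k g f) v"
      by (simp add: contr_def add.commute)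
    then show "contr (k + l) a (alt_wedge k l f g) v = contr (k + l) a (\<lambda>v. (- 1) ^ (k * l) * alt_wedge l k g f v) v"
      using contr_wedge[OF f g, of a v] contr_wedge[OF g f, of a v] A1 A2 by (simp add: distrib_left)
  qed
qed

lemma alt_wedge_0_right:
  assumes f: "alternating k f" and g: "alternating 0 g"
  shows "alt_wedge k 0 f g v = f v * g v"
  using alt_wedge_commute[OF f g] alt_wedge_0_left[OF g f] by simp

section \<open>Covectors and the Euler identities\<close>

definition covec :: "'e::euclidean_space \<Rightarrow> 'e multiform" where
  "covec b v = v 0 \<bullet> b"

lemma alternating_covec [simp]: "alternating (Suc 0) (covec b)"
  unfolding alternating_def covec_def by (auto intro!: linearI simp: inner_left_distrib)

lemma covec_case_nat [simp]: "covec b (case_nat a v) = a \<bullet> b"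
  by (simp add: covec_def)

lemma alternating_0_const [simp]: "alternating 0 (\<lambda>v. c)"
  by (simp add: alternating_0)

lemma linear_Basis_sum:
  fixes h :: "'e::euclidean_space \<Rightarrow> real"
  shows "linear h \<Longrightarrow> (\<Sum>b\<in>Basis. (a \<bullet> b) * h b) = h a"
  using linear_sum[of h "\<lambda>b. (a \<bullet> b) *\<^sub>R b" Basis] linear_scale[of h]
  by (simp add: euclidean_representation)

lemma contr_covec_wedge:
  assumes "alternating q f"
  shows "contr (Suc q) a (alt_wedge (Suc 0) q (covec b) f) v =
    (a \<bullet> b) * f v - alt_wedge (Suc 0) (q - 1) (covec b) (contr q a f) v"
  using contr_wedge[of "Suc 0" "covec b" q f a v] assms by (simp add: alt_wedge_0_left)

text \<open>
  Euler's identity for alternating forms: \<open>contr\<close> and the wedge products with the dual basis are the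
  derivations and multiplications by the coordinates of the exterior algebra, and a form of degree \<open>q\<close>
  is homogeneous of degree \<open>q\<close>.
\<close>

lemma sum_covec_wedge_contr:
  fixes f :: "'e::euclidean_space multiform"
  assumes "alternating q f"
  shows "(\<Sum>b\<in>Basis. alt_wedge (Suc 0) (q - 1) (covec b) (contr q b f) v) = q * f v"
  using assms
proof (induction q arbitrary: f v)
  case 0
  then show ?case by simp
next
  case (Suc n)
  let ?E = "\<lambda>v. \<Sum>b\<in>Basis. alt_wedge (Suc 0) n (covec b) (contr (Suc n) b f) v"
  have "?E = (\<lambda>v. Suc n * f v)"
  proof (rule contr_ext[of "Suc n"])
    fix a v
    have fa: "alternating n (contr (Suc n) a f)" for a
      using alternating_contr[OF Suc.prems] by simp
    have "contr (Suc n) a ?E v = (\<Sum>b\<in>Basis. contr (Suc n) a (alt_wedge (Suc 0) n (covec b) (contr (Suc n) b f)) v)"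
      by simp
    also have "\<dots> = (\<Sum>b\<in>Basis. (a \<bullet> b) * contr (Suc n) b f v +
        alt_wedge (Suc 0) (n - 1) (covec b) (contr n b (contr (Suc n) a f)) v)"
    proof (rule sum.cong[OF refl])
      fix b :: 'e
      have "contr n a (contr (Suc n) b f) = (\<lambda>v. - 1 * contr n b (contr (Suc n) a f) v)"
        using contr_contr_swap[OF Suc.prems, of a b] by (simp only: fun_eq_iff) simp
      then show "contr (Suc n) a (alt_wedge (Suc 0) n (covec b) (contr (Suc n) b f)) v =
        (a \<bullet> b) * contr (Suc n) b f v + alt_wedge (Suc 0) (n - 1) (covec b) (contr n b (contr (Suc n) a f)) v"
        using contr_covec_wedge[OF fa, of a b b v] alt_wedge_cmult_right[of "Suc 0" "n - 1" "covec b" "-1"]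
        by (simp only:)
    qed
    also have "\<dots> = contr (Suc n) a f v + n * contr (Suc n) a f v"
      using Suc.IH[OF fa, of a v] linear_Basis_sum[OF linear_contr[OF Suc.prems], of a v]
      by (simp add: sum.distrib)
    finally show "contr (Suc n) a ?E v = contr (Suc n) a (\<lambda>v. Suc n * f v) v"
      by (simp add: algebra_simps)
  qed simp
  then show ?case by (simp add: fun_eq_iff)
qed

text \<open>
  The companion of Euler's identity, from the anticommutation relation \<open>contr_covec_wedge\<close>.  It shows
  that a form below top degree is determined by its wedge products with covectors.
\<close>

lemma sum_contr_covec_wedge:
  fixes f :: "'e::euclidean_space multiform"
  assumes "alternating q f"
  shows "(\<Sum>b\<in>Basis. contr (Suc q) b (alt_wedge (Suc 0) q (covec b) f) v) = (real DIM('e) - q) * f v"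
  using sum_covec_wedge_contr[OF assms, of v]
  by (simp add: contr_covec_wedge[OF assms] sum_subtractf algebra_simps del: contr_Suc)

lemma covec_wedges_zero:
  fixes f :: "'e::euclidean_space multiform"
  assumes "alternating q f" "q < DIM('e)" "\<And>b v. alt_wedge (Suc 0) q (covec b) f v = 0"
  shows "f v = 0"
proof -
  have "alt_wedge (Suc 0) q (covec b) f = (\<lambda>v. 0)" for b using assms(3) by (rule ext)
  then show ?thesis using sum_contr_covec_wedge[OF assms(1), of v] assms(2) by simp
qed

section \<open>Alternating forms are determined by their values on basis vectors\<close>

lemma alternating_eq_on_Basis:
  fixes f g :: "'e::euclidean_space multiform"
  assumes f: "alternating k f" and g: "alternating k g"
    and eq: "\<And>t. (\<And>i. i < k \<Longrightarrow> t i \<in> Basis) \<Longrightarrow> f t = g t"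
  shows "f = g"
proof -
  have "f v = g v" if "j \<le> k" "\<And>i. j \<le> i \<Longrightarrow> i < k \<Longrightarrow> v i \<in> Basis" for j v
    using that
  proof (induction j arbitrary: v)
    case 0
    then show ?case using eq by simp
  next
    case (Suc j)
    then have j: "j < k" by simp
    have "f (v(j := b)) = g (v(j := b))" if "b \<in> Basis" for b
      using Suc.prems that by (intro Suc.IH) auto
    then have "(\<Sum>b\<in>Basis. (v j \<bullet> b) * f (v(j := b))) = (\<Sum>b\<in>Basis. (v j \<bullet> b) * g (v(j := b)))"
      by simp
    then show ?case
      using linear_Basis_sum[OF alternating_linear[OF f j, of v], of "v j"]
        linear_Basis_sum[OF alternating_linear[OF g j, of v], of "v j"] by simp
  qed
  from this[of k] show ?thesis by auto
qed

lemma alternating_on_injective_Basis: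
  fixes f g :: "'e::euclidean_space multiform"
  assumes f: "alternating k f" and g: "alternating k g"
    and eq: "\<And>t. (\<And>i. i < k \<Longrightarrow> t i \<in> Basis) \<Longrightarrow> inj_on t {..<k} \<Longrightarrow> f t = g t"
  shows "f = g"
proof (rule alternating_eq_on_Basis[OF f g])
  fix t :: "nat \<Rightarrow> 'e" assume t: "\<And>i. i < k \<Longrightarrow> t i \<in> Basis"
  show "f t = g t"
  proof (cases "inj_on t {..<k}")
    case False
    then obtain i j where "i < k" "j < k" "i \<noteq> j" "t i = t j" unfolding inj_on_def by auto
    then show ?thesis using alternating_repeat[OF f, of i j t] alternating_repeat[OF g, of i j t] by simp
  qed (use t eq in blast)
qed

text \<open>
  An injective tuple of basis vectors of full length is a permutation of a fixed enumeration of the basis,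
  so the values of a top form on all such tuples are fixed multiples of its value on the enumeration.
\<close>

lemma ex_Basis_enumeration:
  "\<exists>E :: nat \<Rightarrow> 'e::euclidean_space. \<forall>t. (\<forall>i<DIM('e). t i \<in> Basis) \<longrightarrow> inj_on t {..<DIM('e)} \<longrightarrow>
     (\<exists>s::real. \<forall>f. alternating DIM('e) f \<longrightarrow> f t = s * f E)"
proof -
  let ?N = "DIM('e)"
  obtain E :: "nat \<Rightarrow> 'e" where E: "bij_betw E {..<?N} Basis"
    using ex_bij_betw_nat_finite[OF finite_Basis] by (metis atLeast0LessThan)
  have "\<exists>s::real. \<forall>f. alternating ?N f \<longrightarrow> f t = s * f E"
    if t: "\<forall>i<?N. t i \<in> Basis" "inj_on t {..<?N}" for t :: "nat \<Rightarrow> 'e"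
  proof -
    define p where "p i = (if i < ?N then inv_into {..<?N} E (t i) else i)" for i
    have tE: "E (inv_into {..<?N} E (t i)) = t i" if "i < ?N" for i
      using E t(1) that by (simp add: bij_betw_def f_inv_into_f)
    have "inj_on p {..<?N}"
      using t(2) tE unfolding p_def inj_on_def by (metis lessThan_iff)
    moreover have "p ` {..<?N} \<subseteq> {..<?N}"
    proof
      fix x assume "x \<in> p ` {..<?N}"
      then obtain i where "i < ?N" "x = inv_into {..<?N} E (t i)" by (auto simp: p_def)
      then show "x \<in> {..<?N}" using E t(1) inv_into_into[of "t i" E "{..<?N}"] by (auto simp: bij_betw_def)
    qed
    ultimately have "bij_betw p {..<?N} {..<?N}" by (simp add: bij_betw_def endo_inj_surj)
    then have p: "p permutes {..<?N}" by (rule bij_imp_permutes) (simp add: p_def)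
    have "f t = of_int (sign p) * f E" if f: "alternating ?N f" for f
    proof -
      have "f t = f (\<lambda>i. E (p i))"
        using tE by (intro alternating_cong[OF f]) (simp add: p_def)
      then show ?thesis using alternating_permute[OF f p] by simp
    qed
    then show ?thesis by blast
  qed
  then show ?thesis by (intro exI[of _ E]) blast
qed

lemma top_forms_proportional:
  fixes f g :: "'e::euclidean_space multiform"
  assumes f: "alternating DIM('e) f" and g: "alternating DIM('e) g" and g0: "g u \<noteq> 0"
  shows "\<exists>c. f = (\<lambda>v. c * g v)"
proof -
  let ?N = "DIM('e)"
  obtain E :: "nat \<Rightarrow> 'e" where E: "\<And>t. (\<forall>i<?N. t i \<in> Basis) \<Longrightarrow> inj_on t {..<?N} \<Longrightarrow>
      \<exists>s::real. \<forall>f. alternating ?N f \<longrightarrow> f t = s * f E"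
    using ex_Basis_enumeration[where 'e='e] by blast
  have zero: "h = (\<lambda>v. 0)" if h: "alternating ?N h" "h E = 0" for h :: "'e multiform"
  proof (rule alternating_on_injective_Basis[OF h(1) alternating_zero])
    fix t :: "nat \<Rightarrow> 'e" assume "\<And>i. i < ?N \<Longrightarrow> t i \<in> Basis" "inj_on t {..<?N}"
    then show "h t = 0" using E[of t] h by auto
  qed
  have gE: "g E \<noteq> 0" using zero[OF g] g0 by auto
  have "(\<lambda>v. f v - f E / g E * g v) = (\<lambda>v. 0)"
    using gE by (intro zero alternating_diff alternating_cmult f g) simp
  then have "f v - f E / g E * g v = 0" for v by (rule fun_cong)
  then have "f v = f E / g E * g v" for v by (metis right_minus_eq)
  then show ?thesis by blast
qed

lemma alternating_scale_all:
  assumes "alternating k f"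
  shows "f (\<lambda>i. s i *\<^sub>R v i) = (\<Prod>i<k. s i) * f v"
proof -
  have "f (\<lambda>i. if i < j then s i *\<^sub>R v i else v i) = (\<Prod>i<j. s i) * f v" if "j \<le> k" for j
    using that
  proof (induction j)
    case 0
    then show ?case by simp
  next
    case (Suc j)
    let ?v = "\<lambda>i. if i < j then s i *\<^sub>R v i else v i"
    have "(\<lambda>i. if i < Suc j then s i *\<^sub>R v i else v i) = ?v(j := s j *\<^sub>R v j)"
      by (auto simp: fun_eq_iff less_Suc_eq)
    moreover have "?v(j := v j) = ?v" by auto
    ultimately show ?case
      using linear_scale[OF alternating_linear[OF assms, of j ?v], of "s j" "v j"] Suc by simp
  qed
  moreover have "f (\<lambda>i. s i *\<^sub>R v i) = f (\<lambda>i. if i < k then s i *\<^sub>R v i else v i)"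
    by (rule alternating_cong[OF assms]) simp
  ultimately show ?thesis by simp
qed

text \<open>
  On an enumeration of the basis the diagonal map multiplies a top form by the product of the
  eigenvalues.
\<close>

lemma top_form_diagonal:
  fixes f :: "'e::euclidean_space multiform"
  assumes f: "alternating DIM('e) f" and L: "linear L" "\<And>b. b \<in> Basis \<Longrightarrow> L b = s b *\<^sub>R b"
    and s: "(\<Prod>b\<in>Basis. s b) = 1"
  shows "f (\<lambda>i. L (v i)) = f v"
proof -
  have "(\<lambda>v. f (\<lambda>i. L (v i))) = f"
  proof (rule alternating_on_injective_Basis[OF alternating_pull[OF f L(1)] f])
    fix t :: "nat \<Rightarrow> 'e" assume t: "\<And>i. i < DIM('e) \<Longrightarrow> t i \<in> Basis" "inj_on t {..<DIM('e)}"
    have "f (\<lambda>i. L (t i)) = f (\<lambda>i. s (t i) *\<^sub>R t i)"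
      using L(2) t by (intro alternating_cong[OF f]) auto
    also have "\<dots> = (\<Prod>i<DIM('e). s (t i)) * f t" by (rule alternating_scale_all[OF f])
    also have "t ` {..<DIM('e)} = Basis"
      using t by (intro card_subset_eq) (auto simp: card_image)
    then have "(\<Prod>i<DIM('e). s (t i)) = 1"
      using prod.reindex[OF t(2), of s] s by simp
    finally show "f (\<lambda>i. L (t i)) = f t" by simp
  qed
  then show ?thesis by (rule fun_cong)
qed

section \<open>The Lefschetz operator of an alternating 2-form\<close>

primrec alt_power :: "'e::real_vector multiform \<Rightarrow> nat \<Rightarrow> 'e multiform" where
  "alt_power w 0 = (\<lambda>v. 1)"
| "alt_power w (Suc r) = alt_wedge 2 (2 * r) w (alt_power w r)"

definition lef :: "'e::real_vector multiform \<Rightarrow> nat \<Rightarrow> nat \<Rightarrow> 'e multiform \<Rightarrow> 'e multiform" where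
  "lef w r k f = alt_wedge (2 * r) k (alt_power w r) f"

lemma alternating_power: "alternating 2 w \<Longrightarrow> alternating (2 * r) (alt_power w r)"
  by (induction r) (use alternating_wedge in \<open>fastforce+\<close>)

lemma alternating_lef: "alternating 2 w \<Longrightarrow> alternating k f \<Longrightarrow> alternating (2 * r + k) (lef w r k f)"
  unfolding lef_def by (intro alternating_wedge alternating_power)

lemma lef_0: "alternating k f \<Longrightarrow> lef w 0 k f = f"
  by (simp add: lef_def fun_eq_iff alt_wedge_0_left)

lemma lef_Suc:
  assumes "alternating 2 w" "alternating k f"
  shows "lef w (Suc r) k f = alt_wedge 2 (2 * r + k) w (lef w r k f)"
  using alt_wedge_assoc[OF assms(1) alternating_power[OF assms(1), of r] assms(2)] by (simp add: lef_def)

lemma lef_one: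
  assumes "alternating 2 w"
  shows "lef w r 0 (\<lambda>v. 1) = alt_power w r"
  by (simp add: lef_def fun_eq_iff alt_wedge_0_right[OF alternating_power[OF assms]])

lemma lef_zero [simp]: "lef w r k (\<lambda>v. 0) = (\<lambda>v. 0)"
  by (simp add: lef_def)

lemma wedge_2_1_left_commute:
  assumes w: "alternating 2 w" and t: "alternating (Suc 0) t" and g: "alternating m g"
  shows "alt_wedge 2 (Suc m) w (alt_wedge (Suc 0) m t g) = alt_wedge (Suc 0) (2 + m) t (alt_wedge 2 m w g)"
proof -
  have "alt_wedge 2 (Suc m) w (alt_wedge (Suc 0) m t g) = alt_wedge (2 + Suc 0) m (alt_wedge 2 (Suc 0) w t) g"
    using alt_wedge_assoc[OF w t g] by simp
  also have "alt_wedge 2 (Suc 0) w t = alt_wedge (Suc 0) 2 t w"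
    using alt_wedge_commute[OF w t] by (simp add: fun_eq_iff)
  also have "alt_wedge (2 + Suc 0) m (alt_wedge (Suc 0) 2 t w) g = alt_wedge (Suc 0) (2 + m) t (alt_wedge 2 m w g)"
    using alt_wedge_assoc[OF t w g] by (simp add: numeral_eq_Suc)
  finally show ?thesis .
qed

text \<open>
  The contraction of $w^r \wedge f$: since \<open>w\<close> has even degree, its power behaves like a power of a
  commuting variable under the antiderivation, which gives $r\,(\iota_u w) \wedge w^{r-1} \wedge f$.
  Truncated subtraction in \<open>r - 1\<close> is harmless because of the factor \<open>r\<close>.
\<close>

lemma contr_lef:
  assumes w: "alternating 2 w" and f: "alternating k f"
  shows "contr (2 * r + k) u (lef w r k f) =
    (\<lambda>v. r * alt_wedge (Suc 0) (2 * (r - 1) + k) (contr 2 u w) (lef w (r - 1) k f) v + lef w r (k - 1) (contr k u f) v)"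
proof (induction r)
  case 0
  then show ?case using alternating_contr[OF f, of u] by (simp add: lef_0 f)
next
  case (Suc r)
  let ?t = "contr 2 u w"
  have t: "alternating (Suc 0) ?t" using alternating_contr[OF w, of u] by simp
  note L = alternating_lef[OF w f] and fu = alternating_contr[OF f, of u]
  have S2: "Suc (Suc 0) = 2" by simp
  have "contr (2 * Suc r + k) u (lef w (Suc r) k f) = contr (2 + (2 * r + k)) u (alt_wedge 2 (2 * r + k) w (lef w r k f))"
    by (simp add: lef_Suc[OF w f])
  also have "\<dots> = (\<lambda>v. alt_wedge (2 - 1) (2 * r + k) ?t (lef w r k f) v +
      (- 1) ^ 2 * alt_wedge 2 (2 * r + k - 1) w (contr (2 * r + k) u (lef w r k f)) v)"
    by (rule contr_wedge_fun[OF w L])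
  also have "\<dots> = (\<lambda>v. alt_wedge (Suc 0) (2 * r + k) ?t (lef w r k f) v +
      (r * alt_wedge 2 (2 * r + k - 1) w (alt_wedge (Suc 0) (2 * (r - 1) + k) ?t (lef w (r - 1) k f)) v +
       alt_wedge 2 (2 * r + k - 1) w (lef w r (k - 1) (contr k u f)) v))"
    unfolding Suc.IH by (simp add: alt_wedge_add_right alt_wedge_cmult_right)
  also have "\<dots> = (\<lambda>v. Suc r * alt_wedge (Suc 0) (2 * r + k) ?t (lef w r k f) v + lef w (Suc r) (k - 1) (contr k u f) v)"
  proof -
    have e1: "r * alt_wedge 2 (2 * r + k - 1) w (alt_wedge (Suc 0) (2 * (r - 1) + k) ?t (lef w (r - 1) k f)) v =
        r * alt_wedge (Suc 0) (2 * r + k) ?t (lef w r k f) v" for v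
    proof (cases r)
      case (Suc r')
      then have "2 * r + k - 1 = Suc (2 * r' + k)" "2 * (r - 1) + k = 2 * r' + k" "r - 1 = r'" "2 * r + k = 2 + (2 * r' + k)"
        by auto
      then show ?thesis
        using wedge_2_1_left_commute[OF w t L[of r']] lef_Suc[OF w f, of r'] Suc by simp
    qed simp
    have e2: "alt_wedge 2 (2 * r + k - 1) w (lef w r (k - 1) (contr k u f)) = lef w (Suc r) (k - 1) (contr k u f)"
    proof (cases k)
      case (Suc k')
      then show ?thesis using lef_Suc[OF w fu, of r] by simp
    qed simp
    show ?thesis unfolding e1 e2 by (simp add: algebra_simps)
  qed
  finally show ?case by simp
qed

definition nondegenerate :: "'e::real_vector multiform \<Rightarrow> bool" where
  "nondegenerate w \<longleftrightarrow> (\<forall>u. (\<forall>v. contr 2 u w v = 0) \<longrightarrow> u = 0)"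

lemma contr_2: "contr 2 u w = (\<lambda>v. w (case_nat u v))"
  by (simp add: contr_def)

text \<open>
  The map \<open>u \<mapsto> contr 2 u w\<close> into the dual space is injective, hence surjective.
\<close>

lemma nondegenerate_ex_covec:
  fixes w :: "'e::euclidean_space multiform"
  assumes w: "alternating 2 w" and nd: "nondegenerate w"
  shows "\<exists>u. contr 2 u w = covec b"
proof -
  define F where "F u = (\<Sum>c\<in>Basis. w (case_nat u (\<lambda>_. c)) *\<^sub>R c)" for u
  have w': "alternating (Suc (Suc 0)) w" using w by (simp add: numeral_2_eq_2)
  have lin2: "linear (\<lambda>x. w (case_nat u (\<lambda>_. x)))" for u
  proof -
    have "w (case_nat u (\<lambda>_. x)) = w (case_nat u (case_nat x (\<lambda>_. 0)))" for x
      by (rule alternating_cong[OF w']) (auto split: nat.split simp: less_Suc_eq)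
    then show ?thesis using linear_contr[OF alternating_contr_Suc[OF w'], of u "\<lambda>_. 0"] by simp
  qed
  have lin: "linear F"
    unfolding F_def using linear_add[OF linear_contr[OF w']] linear_scale[OF linear_contr[OF w']]
    by (intro linear_compose_sum ballI linearI) (auto simp: scaleR_add_left)
  have Fin: "F u \<bullet> c = w (case_nat u (\<lambda>_. c))" if "c \<in> Basis" for u c
    using that by (simp add: F_def inner_sum_left inner_Basis if_distrib sum.delta cong: if_cong)
  have "F u \<bullet> x = w (case_nat u (\<lambda>_. x))" for u x
  proof -
    have "F u \<bullet> x = (\<Sum>c\<in>Basis. (x \<bullet> c) * (F u \<bullet> c))"
      using euclidean_inner[of "F u" x] by (simp add: mult.commute)
    also have "\<dots> = (\<Sum>c\<in>Basis. (x \<bullet> c) * w (case_nat u (\<lambda>_. c)))" using Fin by simp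
    also have "\<dots> = w (case_nat u (\<lambda>_. x))" using linear_Basis_sum[OF lin2] .
    finally show ?thesis .
  qed
  moreover have wv: "w (case_nat u v) = w (case_nat u (\<lambda>_. v 0))" for u v
    by (rule alternating_cong[OF w']) (auto split: nat.split simp: less_Suc_eq)
  ultimately have wF: "w (case_nat u v) = F u \<bullet> v 0" for u v by metis
  have "inj F"
    unfolding linear_injective_0[OF lin]
    using nd by (auto simp: nondegenerate_def contr_2 wF)
  then have "surj F" using linear_injective_imp_surjective[OF lin] by simp
  then obtain u where "F u = b" by (metis surj_def)
  then show ?thesis
    by (intro exI[of _ u]) (auto simp: contr_2 wF covec_def fun_eq_iff inner_commute)
qed

text \<open>
  If $w^{r+1} = 0$, then contracting with all vectors shows $\beta \wedge w^r = 0$ for all covectors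
  $\beta$, since these are the contractions of \<open>w\<close>; below top degree this forces $w^r = 0$.
\<close>

lemma alt_power_nonzero:
  fixes w :: "'e::euclidean_space multiform"
  assumes w: "alternating 2 w" and nd: "nondegenerate w"
  shows "2 * r \<le> DIM('e) \<Longrightarrow> \<exists>v. alt_power w r v \<noteq> 0"
proof (induction r)
  case 0
  then show ?case by simp
next
  case (Suc r)
  show ?case
  proof (rule ccontr)
    assume "\<nexists>v. alt_power w (Suc r) v \<noteq> 0"
    then have z: "alt_power w (Suc r) = (\<lambda>v. 0)" by auto
    have "alt_wedge (Suc 0) (2 * r) (covec b) (alt_power w r) v = 0" for b v
    proof -
      obtain u where u: "contr 2 u w = covec b" using nondegenerate_ex_covec[OF w nd] by blast
      have "contr (2 * Suc r + 0) u (lef w (Suc r) 0 (\<lambda>v. 1)) v = 0"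
        unfolding lef_one[OF w] z by (simp add: contr_def)
      then have "Suc r * alt_wedge (Suc 0) (2 * r) (covec b) (alt_power w r) v = 0"
        unfolding contr_lef[OF w alternating_0_const] by (simp add: u lef_one[OF w] del: of_nat_Suc)
      then show ?thesis by (simp del: of_nat_Suc)
    qed
    then have "alt_power w r v = 0" for v
      using covec_wedges_zero[OF alternating_power[OF w, of r]] Suc.prems by simp
    then show False using Suc by simp
  qed
qed

text \<open>
  A vector in the kernel of \<open>w\<close> is in the kernel of its top power; but the top power is then 0, as it
  vanishes on a basis that contains this vector.
\<close>

lemma power_nonzero_imp_nondegenerate:
  fixes w :: "'e::euclidean_space multiform"
  assumes w: "alternating 2 w" and d: "DIM('e) = 2 * Suc r" and nz: "alt_power w (Suc r) v \<noteq> 0"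
  shows "nondegenerate w"
  unfolding nondegenerate_def
proof (intro allI impI, rule ccontr)
  fix u assume z: "\<forall>v. contr 2 u w v = 0" and "u \<noteq> 0"
  then have z': "contr 2 u w = (\<lambda>v. 0)" by auto
  let ?f = "alt_power w (Suc r)"
  have f: "alternating DIM('e) ?f" using alternating_power[OF w, of "Suc r"] d by simp
  have cz: "contr (2 * Suc r) u ?f v = 0" for v
    using contr_lef[OF w alternating_0_const[of 1], of "Suc r" u] lef_one[OF w, of "Suc r"] by (simp add: z')
  obtain B where B: "u \<in> B" "independent B" "span B = UNIV"
  proof (rule maximal_independent_subset_extend[of "{u}" UNIV])
    fix B assume "{u} \<subseteq> B" "independent B" "UNIV \<subseteq> span B"
    then show thesis by (intro that[of B]) auto
  qed (use \<open>u \<noteq> 0\<close> in auto)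
  have card: "card B = DIM('e)" "finite B"
    using dim_span_eq_card_independent[OF B(2)] B(3) independent_imp_finite[OF B(2)] by simp_all
  \<comment> \<open>a linear automorphism that maps a vector of the standard basis to u\<close>
  obtain h where h: "bij_betw h (Basis :: 'e set) B"
    using card by (metis finite_Basis finite_same_card_bij)
  define b1 where "b1 = inv_into Basis h u"
  have b1: "b1 \<in> Basis" "h b1 = u"
    using h B(1) unfolding b1_def bij_betw_def by (metis inv_into_into f_inv_into_f)+
  define L where "L x = (\<Sum>b\<in>Basis. (x \<bullet> b) *\<^sub>R h b)" for x
  have L: "linear L" unfolding L_def
    by (intro linear_compose_sum ballI) (auto intro!: linearI simp: inner_left_distrib algebra_simps)
  have Lb: "L b = h b" if "b \<in> Basis" for b
    using that by (simp add: L_def inner_Basis if_distrib if_distribR sum.delta cong: if_cong)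
  have "span (L ` Basis) = UNIV" using Lb h B(3) by (simp add: bij_betw_def cong: image_cong)
  then have "surj L" using linear_span_image[OF L, of Basis] by simp
  then obtain L' where L': "linear L'" "L \<circ> L' = id" using linear_surjective_right_inverse[OF L] by blast
  have "(\<lambda>v. ?f (\<lambda>i. L (v i))) = (\<lambda>v. 0)"
  proof (rule alternating_on_injective_Basis[OF alternating_pull[OF f L] alternating_zero])
    fix t :: "nat \<Rightarrow> 'e" assume t: "\<And>i. i < DIM('e) \<Longrightarrow> t i \<in> Basis" "inj_on t {..<DIM('e)}"
    have "t ` {..<DIM('e)} = Basis"
      using t by (intro card_subset_eq) (auto simp: card_image)
    then obtain i where i: "i < DIM('e)" "t i = b1" using b1(1) by (metis image_iff lessThan_iff)
    let ?v = "\<lambda>i. L (t i)"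
    show "?f ?v = 0"
    proof (cases "i = 0")
      case True
      then have "?v = case_nat u (\<lambda>i. ?v (Suc i))" using i b1 Lb by (auto split: nat.split simp: fun_eq_iff)
      then show ?thesis using cz[of "\<lambda>i. ?v (Suc i)"] by (simp del: alt_power.simps)
    next
      case False
      have "(\<lambda>n. ?v (Transposition.transpose 0 i n)) = case_nat u (\<lambda>n. ?v (Transposition.transpose 0 i (Suc n)))"
        using i b1 Lb by (auto split: nat.split simp: fun_eq_iff)
      then have "?f (\<lambda>n. ?v (Transposition.transpose 0 i n)) = 0"
        using cz by (simp del: alt_power.simps)
      then show ?thesis
        using alternating_transpose[OF f _ i(1), of 0 ?v] False by (simp del: alt_power.simps)
    qed
  qed
  then have "?f (\<lambda>i. L (L' (v i))) = 0" by (rule fun_cong)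
  then show False using nz L'(2) by (simp add: fun_eq_iff del: alt_power.simps)
qed

text \<open>
  Induction on \<open>k\<close>, using only contractions instead of representations of the Lie algebra of
  $\mathrm{SL}_2$.  If $w^r \wedge f = 0$ for \<open>r = d - Suc k\<close>, then contracting with \<open>u\<close> and multiplying by \<open>w\<close> gives
  $w^{r+1} \wedge \iota_u f = - r\,(\iota_u w) \wedge w^r \wedge f = 0$, so the induction hypothesis
  applies to $\iota_u f$, whose exponent is exactly \<open>d - k = r + 1\<close>.
\<close>

lemma lef_injective:
  fixes w :: "'e::euclidean_space multiform"
  assumes w: "alternating 2 w" and nd: "nondegenerate w" and d: "DIM('e) = 2 * d"
  shows "k \<le> d \<Longrightarrow> alternating k f \<Longrightarrow> lef w (d - k) k f = (\<lambda>v. 0) \<Longrightarrow> f = (\<lambda>v. 0)"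
proof (induction k arbitrary: f)
  case 0
  obtain u where u: "alt_power w d u \<noteq> 0" using alt_power_nonzero[OF w nd, of d] d by auto
  have "alt_power w d v * f v = 0" for v
    using fun_cong[OF 0(3)] alt_wedge_0_right[OF alternating_power[OF w] 0(2)] by (simp add: lef_def)
  then have "f u = 0" using u by (metis mult_eq_0_iff)
  then show ?case using 0(2) unfolding alternating_0 by (intro ext) metis
next
  case (Suc k)
  define r where "r = d - Suc k"
  have r: "d - k = Suc r" using Suc.prems(1) by (simp add: r_def)
  note f = Suc.prems(2)
  have z: "lef w r (Suc k) f = (\<lambda>v. 0)" using Suc.prems(3) by (simp add: r_def)
  show ?case
  proof (rule contr_ext[of "Suc k"])
    fix u v
    let ?fu = "contr (Suc k) u f" and ?t = "contr 2 u w"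
    have fu: "alternating k ?fu" using alternating_contr[OF f, of u] by simp
    have t: "alternating (Suc 0) ?t" using alternating_contr[OF w, of u] by simp
    have "(\<lambda>v. r * alt_wedge (Suc 0) (2 * (r - 1) + Suc k) ?t (lef w (r - 1) (Suc k) f) v + lef w r k ?fu v) = (\<lambda>v. 0)"
      using contr_lef[OF w f, of r u] unfolding z by (simp add: contr_def)
    then have e: "lef w r k ?fu = (\<lambda>v. - real r * alt_wedge (Suc 0) (2 * (r - 1) + Suc k) ?t (lef w (r - 1) (Suc k) f) v)"
      by (simp add: fun_eq_iff add_eq_0_iff)
    have "lef w (Suc r) k ?fu = (\<lambda>v. 0)"
    proof (cases r)
      case 0
      have z0: "lef w r k ?fu = (\<lambda>v. 0)" unfolding e by (simp add: 0)
      show ?thesis unfolding lef_Suc[OF w fu] z0 by simp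
    next
      case (Suc r')
      have "2 * r + k = Suc (2 * r' + Suc k)" using Suc by simp
      then have "lef w (Suc r) k ?fu = alt_wedge 2 (Suc (2 * r' + Suc k)) w (lef w r k ?fu)"
        using lef_Suc[OF w fu, of r] by simp
      also have "\<dots> = (\<lambda>v. - real r * alt_wedge 2 (Suc (2 * r' + Suc k)) w
          (alt_wedge (Suc 0) (2 * r' + Suc k) ?t (lef w r' (Suc k) f)) v)"
        by (rule ext) (simp only: e alt_wedge_cmult_right, simp add: Suc)
      also have "alt_wedge 2 (Suc (2 * r' + Suc k)) w (alt_wedge (Suc 0) (2 * r' + Suc k) ?t (lef w r' (Suc k) f)) =
          alt_wedge (Suc 0) (2 + (2 * r' + Suc k)) ?t (lef w r (Suc k) f)"
        using wedge_2_1_left_commute[OF w t alternating_lef[OF w f, of r']] lef_Suc[OF w f, of r'] Suc by simp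
      finally show ?thesis by (simp add: z)
    qed
    then have "?fu = (\<lambda>v. 0)" using Suc.IH[OF _ fu] Suc.prems(1) r by simp
    then show "contr (Suc k) u f v = contr (Suc k) u (\<lambda>v. 0) v" by (simp add: fun_eq_iff)
  qed simp
qed

text \<open>
  Induction on \<open>k\<close> again.  For a covector $\beta_b$ of the dual basis the form $\beta_b \wedge g$ has the
  shape $w^{r+1} \wedge h_b$ by the induction hypothesis.  Its contraction with \<open>b\<close> is divisible by $w^r$,
  by the formula for contractions, and the sum of these contractions is a nonzero multiple of \<open>g\<close> by
  Euler's identity.
\<close>

lemma lef_surjective:
  fixes w :: "'e::euclidean_space multiform"
  assumes w: "alternating 2 w" and nd: "nondegenerate w" and d: "DIM('e) = 2 * d"
  shows "k \<le> d \<Longrightarrow> alternating (2 * d - k) g \<Longrightarrow> \<exists>f. alternating k f \<and> lef w (d - k) k f = g"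
proof (induction k arbitrary: g)
  case 0
  obtain u where u: "alt_power w d u \<noteq> 0" using alt_power_nonzero[OF w nd, of d] d by auto
  obtain c where c: "g = (\<lambda>v. c * alt_power w d v)"
    using top_forms_proportional[of g "alt_power w d" u] 0 u alternating_power[OF w, of d] d by auto
  have "lef w d 0 (\<lambda>v. c) = g"
    using alt_wedge_0_right[OF alternating_power[OF w] alternating_0_const]
    by (simp add: lef_def c fun_eq_iff)
  then show ?case by (intro exI[of _ "\<lambda>v. c"]) simp
next
  case (Suc k)
  define r where "r = d - Suc k"
  have r: "d - k = Suc r" using Suc.prems(1) by (simp add: r_def)
  let ?q = "2 * d - Suc k"
  have q: "Suc ?q = 2 * d - k" "?q = 2 * r + Suc k" "Suc ?q = 2 * Suc r + k"
    using Suc.prems(1) by (auto simp: r_def)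
  have "\<forall>b. \<exists>h. alternating k h \<and> lef w (Suc r) k h = alt_wedge (Suc 0) ?q (covec b) g"
  proof
    fix b
    have "alternating (2 * d - k) (alt_wedge (Suc 0) ?q (covec b) g)"
      using alternating_wedge[OF alternating_covec Suc.prems(2), of b] q(1) by simp
    then show "\<exists>h. alternating k h \<and> lef w (Suc r) k h = alt_wedge (Suc 0) ?q (covec b) g"
      using Suc.IH Suc.prems(1) r by (metis Suc_leD)
  qed
  then obtain h where h: "\<And>b. alternating k (h b)" "\<And>b. lef w (Suc r) k (h b) = alt_wedge (Suc 0) ?q (covec b) g"
    by metis
  \<comment> \<open>the quotient of the contraction of w^(r + 1) \<and> h b with b by w^r\<close>
  define F where "F b = (\<lambda>v. Suc r * alt_wedge (Suc 0) k (contr 2 b w) (h b) v + alt_wedge 2 (k - 1) w (contr k b (h b)) v)" for b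
  have t: "alternating (Suc 0) (contr 2 b w)" for b using alternating_contr[OF w, of b] by simp
  have F: "alternating (Suc k) (F b)" for b
  proof -
    have "alternating (Suc k) (alt_wedge (Suc 0) k (contr 2 b w) (h b))"
      using alternating_wedge[OF t h(1)] by simp
    moreover have "alternating (Suc k) (alt_wedge 2 (k - 1) w (contr k b (h b)))"
    proof (cases k)
      case (Suc k')
      then show ?thesis using alternating_wedge[OF w alternating_contr[OF h(1)], of b b] by simp
    qed simp
    ultimately show ?thesis unfolding F_def by (intro alternating_add alternating_cmult)
  qed
  have P: "alternating (2 * r) (alt_power w r)" by (rule alternating_power[OF w])
  have LF: "lef w r (Suc k) (F b) v = contr (Suc ?q) b (alt_wedge (Suc 0) ?q (covec b) g) v" for b v
  proof -
    have 1: "lef w r (Suc k) (alt_wedge (Suc 0) k (contr 2 b w) (h b)) =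
        alt_wedge (Suc 0) (2 * r + k) (contr 2 b w) (lef w r k (h b))"
    proof -
      have "lef w r (Suc k) (alt_wedge (Suc 0) k (contr 2 b w) (h b)) =
         alt_wedge (2 * r + Suc 0) k (alt_wedge (2 * r) (Suc 0) (alt_power w r) (contr 2 b w)) (h b)"
        using alt_wedge_assoc[OF P t h(1)] by (simp add: lef_def)
      also have "alt_wedge (2 * r) (Suc 0) (alt_power w r) (contr 2 b w) = alt_wedge (Suc 0) (2 * r) (contr 2 b w) (alt_power w r)"
        using alt_wedge_commute[OF P t] by (simp add: power_mult)
      also have "alt_wedge (2 * r + Suc 0) k \<dots> (h b) = alt_wedge (Suc 0) (2 * r + k) (contr 2 b w) (lef w r k (h b))"
        using alt_wedge_assoc[OF t P h(1)] by (simp add: lef_def)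
      finally show ?thesis .
    qed
    have 2: "lef w r (Suc k) (alt_wedge 2 (k - 1) w (contr k b (h b))) = lef w (Suc r) (k - 1) (contr k b (h b))"
    proof (cases k)
      case (Suc k')
      have hb: "alternating k' (contr k b (h b))" using alternating_contr[OF h(1), of b b] Suc by simp
      have "lef w r (Suc k) (alt_wedge 2 k' w (contr k b (h b))) =
          alt_wedge (2 * r + 2) k' (alt_wedge (2 * r) 2 (alt_power w r) w) (contr k b (h b))"
        using alt_wedge_assoc[OF P w hb] Suc by (simp add: lef_def)
      also have "alt_wedge (2 * r) 2 (alt_power w r) w = alt_power w (Suc r)"
        using alt_wedge_commute[OF P w] by (simp add: power_mult)
      finally show ?thesis using Suc by (simp add: lef_def)
    qed simp
    have "lef w r (Suc k) (F b) v = Suc r * alt_wedge (Suc 0) (2 * r + k) (contr 2 b w) (lef w r k (h b)) v +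
        lef w (Suc r) (k - 1) (contr k b (h b)) v"
      unfolding F_def 1[symmetric] 2[symmetric] unfolding lef_def
      by (simp only: alt_wedge_add_right alt_wedge_cmult_right)
    also have "\<dots> = contr (2 * Suc r + k) b (lef w (Suc r) k (h b)) v"
      by (subst contr_lef[OF w h(1)]) simp
    finally show ?thesis unfolding h(2) q(3)[symmetric] .
  qed
  have "(\<Sum>b\<in>Basis. lef w r (Suc k) (F b) v) = Suc k * g v" for v
  proof -
    have "(\<Sum>b\<in>Basis. lef w r (Suc k) (F b) v) = (real DIM('e) - ?q) * g v"
      unfolding LF by (rule sum_contr_covec_wedge[OF Suc.prems(2)])
    also have "real DIM('e) - ?q = Suc k" unfolding d using Suc.prems(1) by (simp add: of_nat_diff)
    finally show ?thesis .
  qed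
  then have "lef w r (Suc k) (\<lambda>v. (1 / Suc k) * (\<Sum>b\<in>Basis. F b v)) = g"
    unfolding lef_def fun_eq_iff alt_wedge_cmult_right alt_wedge_sum_right by (simp add: field_simps del: of_nat_Suc)
  moreover have "alternating (Suc k) (\<lambda>v. (1 / Suc k) * (\<Sum>b\<in>Basis. F b v))"
    by (intro alternating_cmult alternating_sum F)
  ultimately show ?case unfolding r_def by blast
qed

section \<open>Weight decomposition under a diagonal map\<close>

text \<open>
  For a diagonal map the space of \<open>k\<close>-forms is the sum of the kernel and the image of the operator
  \<open>L\<^sup>* - c\<close>: the products of dual basis vectors are eigenvectors.  The induction on \<open>k\<close> writes
  \<open>f\<close> as a combination of $\beta_b \wedge \iota_b f$ by Euler's identity; as $\beta_b$ has eigenvalue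
  \<open>s b\<close>, the contraction is split for the number \<open>c / s b\<close>, which is why \<open>c\<close> is arbitrary.
\<close>

lemma diagonal_weight_split:
  fixes f :: "'e::euclidean_space multiform"
  assumes L: "linear L" "\<And>b. b \<in> Basis \<Longrightarrow> L b = s b *\<^sub>R b" "\<And>b. b \<in> Basis \<Longrightarrow> s b \<noteq> 0"
    and f: "alternating k f"
  shows "\<exists>g h. alternating k g \<and> alternating k h \<and> (\<forall>v. g (\<lambda>i. L (v i)) = c * g v) \<and>
    (\<forall>v. f v = g v + (h (\<lambda>i. L (v i)) - c * h v))"
  using f
proof (induction k arbitrary: f c)
  case 0
  have inv: "f (\<lambda>i. L (v i)) = f v" for v using 0 by (simp add: alternating_0)
  show ?case
  proof (cases "c = 1")
    case True
    then show ?thesis using 0 inv by (intro exI[of _ f] exI[of _ "\<lambda>v. 0"]) auto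
  next
    case False
    have "t * y - c * (t * y) = ((1 - c) * t) * y" for t y :: real
      by (simp add: algebra_simps)
    from this[of "1 / (1 - c)"] have "f v = 0 + (1 / (1 - c) * f (\<lambda>i. L (v i)) - c * (1 / (1 - c) * f v))" for v
      using False by (simp add: inv)
    then show ?thesis
      using alternating_cmult[OF 0, of "1 / (1 - c)"] by (intro exI[of _ "\<lambda>v. 0"] exI) auto
  qed
next
  case (Suc k)
  have "\<forall>b. \<exists>g h. alternating k g \<and> alternating k h \<and> (\<forall>v. g (\<lambda>i. L (v i)) = c / s b * g v) \<and>
      (\<forall>v. contr (Suc k) b f v = g v + (h (\<lambda>i. L (v i)) - c / s b * h v))"
  proof
    fix b
    show "\<exists>g h. alternating k g \<and> alternating k h \<and> (\<forall>v. g (\<lambda>i. L (v i)) = c / s b * g v) \<and>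
      (\<forall>v. contr (Suc k) b f v = g v + (h (\<lambda>i. L (v i)) - c / s b * h v))"
      by (rule Suc.IH) (use alternating_contr[OF Suc.prems, of b] in simp)
  qed
  then obtain G H where GH: "\<And>b. alternating k (G b)" "\<And>b. alternating k (H b)"
    "\<And>b v. G b (\<lambda>i. L (v i)) = c / s b * G b v"
    "\<And>b v. contr (Suc k) b f v = G b v + (H b (\<lambda>i. L (v i)) - c / s b * H b v)"
    by metis
  let ?W = "\<lambda>b. alt_wedge (Suc 0) k (covec b)"
  have cov: "covec b (\<lambda>i. L (v i)) = s b * covec b v" if "b \<in> Basis" for b v
  proof -
    have "L x \<bullet> b = s b * (x \<bullet> b)" for x
    proof -
      have "L x \<bullet> b = (\<Sum>c\<in>Basis. (x \<bullet> c) * (L c \<bullet> b))"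
        using linear_Basis_sum[of "\<lambda>x. L x \<bullet> b" x] L(1)
        by (simp add: linear_iff inner_left_distrib)
      also have "\<dots> = (\<Sum>c\<in>Basis. if c = b then (x \<bullet> b) * s b else 0)"
        using that L(2) by (intro sum.cong) (auto simp: inner_Basis)
      also have "\<dots> = s b * (x \<bullet> b)" using that by (simp add: sum.delta mult.commute)
      finally show ?thesis .
    qed
    then show ?thesis by (simp add: covec_def)
  qed
  have pull: "?W b F (\<lambda>i. L (v i)) = s b * ?W b (\<lambda>v. F (\<lambda>i. L (v i))) v" if "b \<in> Basis" for b F v
  proof -
    have "?W b F (\<lambda>i. L (v i)) = alt_wedge (Suc 0) k (\<lambda>v. covec b (\<lambda>i. L (v i))) (\<lambda>v. F (\<lambda>i. L (v i))) v"
      by (simp add: alt_wedge_pull)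
    also have "(\<lambda>v. covec b (\<lambda>i. L (v i))) = (\<lambda>v. s b * covec b v)" using cov[OF that] by auto
    finally show ?thesis by (simp add: alt_wedge_cmult_left)
  qed
  define g where "g v = (1 / Suc k) * (\<Sum>b\<in>Basis. ?W b (G b) v)" for v
  define h where "h v = (1 / Suc k) * (\<Sum>b\<in>Basis. 1 / s b * ?W b (H b) v)" for v
  have W: "alternating (Suc k) (?W b F)" if "alternating k F" for b F
    using alternating_wedge[OF alternating_covec that] by simp
  have "alternating (Suc k) g" "alternating (Suc k) h"
    unfolding g_def[abs_def] h_def[abs_def]
    by (intro alternating_cmult alternating_sum W GH)+
  moreover have "g (\<lambda>i. L (v i)) = c * g v" for v
  proof -
    have "?W b (G b) (\<lambda>i. L (v i)) = c * ?W b (G b) v" if "b \<in> Basis" for b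
      using L(3)[OF that] by (simp only: pull[OF that] GH(3) alt_wedge_cmult_right) simp
    then show ?thesis by (simp add: g_def sum_distrib_left[symmetric])
  qed
  moreover have "f v = g v + (h (\<lambda>i. L (v i)) - c * h v)" for v
  proof -
    have "Suc k * f v = (\<Sum>b\<in>Basis. ?W b (contr (Suc k) b f) v)"
      using sum_covec_wedge_contr[OF Suc.prems, of v] by (simp del: contr_Suc)
    also have "\<dots> = (\<Sum>b\<in>Basis. ?W b (G b) v + (1 / s b * ?W b (H b) (\<lambda>i. L (v i)) - c * (1 / s b * ?W b (H b) v)))"
    proof (rule sum.cong[OF refl])
      fix b :: 'e assume b: "b \<in> Basis"
      have "contr (Suc k) b f = (\<lambda>v. G b v + (H b (\<lambda>i. L (v i)) - c / s b * H b v))"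
        using GH(4) by (rule ext)
      then show "?W b (contr (Suc k) b f) v =
          ?W b (G b) v + (1 / s b * ?W b (H b) (\<lambda>i. L (v i)) - c * (1 / s b * ?W b (H b) v))"
        using L(3)[OF b] by (simp only: alt_wedge_add_right alt_wedge_diff_right alt_wedge_cmult_right pull[OF b]) simp
    qed
    also have "\<dots> = Suc k * g v + (Suc k * h (\<lambda>i. L (v i)) - c * (Suc k * h v))"
    proof -
      have "Suc k * g v = (\<Sum>b\<in>Basis. ?W b (G b) v)" for v
        by (simp add: g_def del: of_nat_Suc)
      moreover have "Suc k * h v = (\<Sum>b\<in>Basis. 1 / s b * ?W b (H b) v)" for v
        by (simp add: h_def del: of_nat_Suc)
      ultimately show ?thesis by (simp only: sum.distrib sum_subtractf sum_distrib_left)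
    qed
    also have "\<dots> = Suc k * (g v + (h (\<lambda>i. L (v i)) - c * h v))" by (simp only: algebra_simps)
    finally show ?thesis by (simp del: of_nat_Suc)
  qed
  ultimately show ?case by blast
qed

section \<open>Differential forms on a Euclidean space\<close>

definition smooth_form :: "nat \<Rightarrow> ('e::euclidean_space \<Rightarrow> 'e multiform) \<Rightarrow> bool" where
  "smooth_form k \<alpha> \<longleftrightarrow> (\<forall>x. alternating k (\<alpha> x)) \<and> (\<forall>v. smooth (\<lambda>x. \<alpha> x v))"

text \<open>
  The exterior derivative, with the formula for constant vector fields.
\<close>

definition dext :: "nat \<Rightarrow> ('e::euclidean_space \<Rightarrow> 'e multiform) \<Rightarrow> 'e \<Rightarrow> 'e multiform" where
  "dext k \<alpha> x v = (\<Sum>i\<le>k. (- 1) ^ i * dd (v i) (\<lambda>y. \<alpha> y (\<lambda>j. if j < i then v j else v (Suc j))) x)"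

text \<open>
  The derivative of the coefficients, that is, the Lie derivative along the constant vector field \<open>a\<close>.
\<close>

definition fdd :: "'e::euclidean_space \<Rightarrow> ('e \<Rightarrow> 'e multiform) \<Rightarrow> 'e \<Rightarrow> 'e multiform" where
  "fdd a \<alpha> x v = dd a (\<lambda>y. \<alpha> y v) x"

lemma smooth_formD: "smooth_form k \<alpha> \<Longrightarrow> alternating k (\<alpha> x)" "smooth_form k \<alpha> \<Longrightarrow> smooth (\<lambda>x. \<alpha> x v)"
  unfolding smooth_form_def by blast+

lemma smooth_form_add: "smooth_form k \<alpha> \<Longrightarrow> smooth_form k \<beta> \<Longrightarrow> smooth_form k (\<lambda>x v. \<alpha> x v + \<beta> x v)"
  unfolding smooth_form_def by (simp add: alternating_add smooth_add)

lemma smooth_form_diff: "smooth_form k \<alpha> \<Longrightarrow> smooth_form k \<beta> \<Longrightarrow> smooth_form k (\<lambda>x v. \<alpha> x v - \<beta> x v)"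
  unfolding smooth_form_def by (simp add: alternating_diff smooth_diff)

lemma smooth_form_mult: "smooth f \<Longrightarrow> smooth_form k \<alpha> \<Longrightarrow> smooth_form k (\<lambda>x v. f x * \<alpha> x v)"
  unfolding smooth_form_def by (simp add: alternating_cmult smooth_mult)

lemma smooth_form_cmult: "smooth_form k \<alpha> \<Longrightarrow> smooth_form k (\<lambda>x v. c * \<alpha> x v)"
  by (rule smooth_form_mult) auto

lemma smooth_form_const: "alternating k c \<Longrightarrow> smooth_form k (\<lambda>x. c)"
  unfolding smooth_form_def by simp

lemma smooth_form_zero [simp]: "smooth_form k (\<lambda>x v. 0)"
  by (simp add: smooth_form_const)

lemma smooth_form_contr: "smooth_form k \<alpha> \<Longrightarrow> smooth_form (k - 1) (\<lambda>x. contr k a (\<alpha> x))"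
  by (cases k) (auto simp: smooth_form_def intro: alternating_contr_Suc)

lemma smooth_form_wedge:
  assumes "smooth_form k \<alpha>" "smooth_form l \<beta>"
  shows "smooth_form (k + l) (\<lambda>x. alt_wedge k l (\<alpha> x) (\<beta> x))"
proof -
  have "smooth (\<lambda>x. alt_wedge k l (\<alpha> x) (\<beta> x) v)" for v
    unfolding alt_wedge_def divide_inverse
    using assms by (intro smooth_mult smooth_sum smooth_const) (auto simp: smooth_form_def)
  then show ?thesis using assms by (auto simp: smooth_form_def intro: alternating_wedge)
qed

lemma fdd_wedge:
  assumes "smooth_form k \<alpha>" "smooth_form l \<beta>"
  shows "fdd a (\<lambda>x. alt_wedge k l (\<alpha> x) (\<beta> x)) x v =
    alt_wedge k l (fdd a \<alpha> x) (\<beta> x) v + alt_wedge k l (\<alpha> x) (fdd a \<beta> x) v"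
proof -
  note s = smooth_formD(2)[OF assms(1)] smooth_formD(2)[OF assms(2)]
  have "fdd a (\<lambda>x. alt_wedge k l (\<alpha> x) (\<beta> x)) x v =
      dd a (\<lambda>x. (1 / (fact k * fact l)) * (\<Sum>p | p permutes {..<k + l}.
        (of_int (sign p) * \<alpha> x (\<lambda>i. v (p i))) * \<beta> x (\<lambda>i. v (p (k + i))))) x"
    unfolding fdd_def alt_wedge_def by simp
  also have "\<dots> = (1 / (fact k * fact l)) * (\<Sum>p | p permutes {..<k + l}.
       of_int (sign p) * fdd a \<alpha> x (\<lambda>i. v (p i)) * \<beta> x (\<lambda>i. v (p (k + i))) +
       of_int (sign p) * \<alpha> x (\<lambda>i. v (p i)) * fdd a \<beta> x (\<lambda>i. v (p (k + i))))"
    by (subst dd_cmult, intro smooth_sum smooth_mult smooth_const s, subst dd_sum,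
        intro smooth_mult smooth_const s)
      (simp add: dd_mult dd_cmult smooth_cmult s fdd_def)
  also have "\<dots> = alt_wedge k l (fdd a \<alpha> x) (\<beta> x) v + alt_wedge k l (\<alpha> x) (fdd a \<beta> x) v"
    unfolding alt_wedge_def by (simp add: sum.distrib add_divide_distrib)
  finally show ?thesis .
qed

lemma alternating_fdd:
  assumes "smooth_form k \<alpha>"
  shows "alternating k (fdd a \<alpha> x)"
  unfolding alternating_def
proof (intro conjI allI impI)
  note alt = smooth_formD(1)[OF assms] and sm = smooth_formD(2)[OF assms]
  fix v w :: "nat \<Rightarrow> 'a" assume "\<forall>i<k. v i = w i"
  then have "\<alpha> y v = \<alpha> y w" for y using alternating_cong[OF alt] by blast
  then show "fdd a \<alpha> x v = fdd a \<alpha> x w" by (simp add: fdd_def)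
next
  note alt = smooth_formD(1)[OF assms] and sm = smooth_formD(2)[OF assms]
  fix v i assume "i < k"
  show "linear (\<lambda>b. fdd a \<alpha> x (v(i := b)))"
  proof (rule linearI)
    fix b c
    have "\<alpha> y (v(i := b + c)) = \<alpha> y (v(i := b)) + \<alpha> y (v(i := c))" for y
      using linear_add[OF alternating_linear[OF alt \<open>i < k\<close>]] by blast
    then show "fdd a \<alpha> x (v(i := b + c)) = fdd a \<alpha> x (v(i := b)) + fdd a \<alpha> x (v(i := c))"
      by (simp add: fdd_def dd_add sm)
  next
    fix r b
    have "\<alpha> y (v(i := r *\<^sub>R b)) = r * \<alpha> y (v(i := b))" for y
      using linear_scale[OF alternating_linear[OF alt \<open>i < k\<close>, of y v], of r b] by simp
    then show "fdd a \<alpha> x (v(i := r *\<^sub>R b)) = r *\<^sub>R fdd a \<alpha> x (v(i := b))"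
      by (simp add: fdd_def dd_cmult sm)
  qed
next
  note alt = smooth_formD(1)[OF assms]
  fix v :: "nat \<Rightarrow> 'a" and i j assume "i < j \<and> j < k \<and> v i = v j"
  then have "\<alpha> y v = 0" for y using alternating_repeat[OF alt, of i j v] by auto
  then show "fdd a \<alpha> x v = 0" by (simp add: fdd_def)
qed

lemma smooth_form_fdd: "smooth_form k \<alpha> \<Longrightarrow> smooth_form k (fdd a \<alpha>)"
  using alternating_fdd[of k \<alpha> a] by (auto simp: fdd_def smooth_form_def intro: smooth_dd)

section \<open>The exterior derivative\<close>

text \<open>
  Cartan's formula, for constant vector fields.  It allows the properties of \<open>dext\<close> to be proved by
  induction on the degree, as for the wedge product.
\<close>

lemma contr_dext:
  "contr (Suc k) a (dext k \<alpha> x) v = fdd a \<alpha> x v - dext (k - 1) (\<lambda>y. contr k a (\<alpha> y)) x v"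
proof (cases k)
  case 0
  then show ?thesis by (simp add: dext_def fdd_def)
next
  case (Suc n)
  have shift: "(\<lambda>j. if j < Suc i then case_nat a v j else case_nat a v (Suc j)) =
      case_nat a (\<lambda>j. if j < i then v j else v (Suc j))" for i
    by (auto simp: fun_eq_iff split: nat.split)
  show ?thesis
    unfolding Suc by (simp add: shift dext_def fdd_def sum.atMost_Suc_shift sum_negf del: sum.atMost_Suc)
qed

lemma dext_zero [simp]: "dext k (\<lambda>x v. 0) = (\<lambda>x v. 0)"
  by (simp add: dext_def fun_eq_iff)

lemma dext_const [simp]: "dext k (\<lambda>x. c) = (\<lambda>x v. 0)"
  by (simp add: dext_def fun_eq_iff)

lemma dext_add:
  "smooth_form k \<alpha> \<Longrightarrow> smooth_form k \<beta> \<Longrightarrow> dext l (\<lambda>x v. \<alpha> x v + \<beta> x v) x v = dext l \<alpha> x v + dext l \<beta> x v"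
  by (simp add: dext_def dd_add smooth_formD sum.distrib distrib_left)

lemma dext_cmult: "smooth_form k \<alpha> \<Longrightarrow> dext l (\<lambda>x v. c * \<alpha> x v) x v = c * dext l \<alpha> x v"
  by (simp add: dext_def dd_cmult smooth_formD sum_distrib_left mult.left_commute)

lemma dext_diff:
  "smooth_form k \<alpha> \<Longrightarrow> smooth_form k \<beta> \<Longrightarrow> dext l (\<lambda>x v. \<alpha> x v - \<beta> x v) x v = dext l \<alpha> x v - dext l \<beta> x v"
  by (simp add: dext_def dd_diff smooth_formD sum_subtractf right_diff_distrib)

text \<open>
  By Cartan's formula the contractions of \<open>dext k \<alpha>\<close> are alternating by induction, and contracting twice
  with the same vector gives \<open>fdd a\<close> of a contraction minus itself.
\<close>

lemma alternating_dext: "smooth_form k \<alpha> \<Longrightarrow> alternating (Suc k) (dext k \<alpha> x)"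
proof (induction k arbitrary: \<alpha> rule: less_induct)
  case (less k)
  note sf = less.prems
  have contr_eq: "dext k \<alpha> x (case_nat a v) = fdd a \<alpha> x v - dext (k - 1) (\<lambda>y. contr k a (\<alpha> y)) x v" for a v
    using contr_dext[of k a \<alpha> x v] by simp
  show ?case
  proof (rule alternating_SucI)
    fix v w :: "nat \<Rightarrow> 'a" assume vw: "\<And>i. i < Suc k \<Longrightarrow> v i = w i"
    have "\<alpha> y (\<lambda>j. if j < i then v j else v (Suc j)) = \<alpha> y (\<lambda>j. if j < i then w j else w (Suc j))" if "i \<le> k" for i y
      using that vw by (intro alternating_cong[OF smooth_formD(1)[OF sf]]) auto
    then show "dext k \<alpha> x v = dext k \<alpha> x w"
      unfolding dext_def using vw by (intro sum.cong refl) (simp add: le_imp_less_Suc)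
  next
    fix a
    have "alternating k (dext (k - 1) (\<lambda>y. contr k a (\<alpha> y)) x)"
    proof (cases k)
      case (Suc n)
      then show ?thesis using less.IH[of n] smooth_form_contr[OF sf, of a] by simp
    qed simp
    then show "alternating k (\<lambda>v. dext k \<alpha> x (case_nat a v))"
      unfolding contr_eq using alternating_fdd[OF sf] by (intro alternating_diff)
  next
    fix v
    have "linear (\<lambda>a. dext (k - 1) (\<lambda>y. contr k a (\<alpha> y)) x v)"
    proof (cases k)
      case 0
      then show ?thesis by (simp add: module_hom_zero)
    next
      case (Suc n)
      note lin = linear_contr[OF smooth_formD(1)[OF sf, unfolded Suc]]
      note sc = smooth_form_contr[OF sf, unfolded Suc, simplified]
      show ?thesis
        unfolding Suc by (rule linearI) (simp_all add: linear_add[OF lin] linear_scale[OF lin] dext_add[OF sc sc] dext_cmult[OF sc])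
    qed
    then show "linear (\<lambda>a. dext k \<alpha> x (case_nat a v))"
      unfolding contr_eq fdd_def using linear_dd[OF smooth_formD(2)[OF sf]] by (intro linear_compose_sub)
  next
    fix a and v :: "nat \<Rightarrow> 'a" assume "0 < k"
    then obtain n where k: "k = Suc n" by (cases k) auto
    have "dext n (\<lambda>y. contr k a (\<alpha> y)) x (case_nat a v) = fdd a \<alpha> x (case_nat a v)"
    proof -
      have "(\<lambda>y. contr n a (contr k a (\<alpha> y))) = (\<lambda>y v. 0)"
        using contr_contr_same[OF smooth_formD(1)[OF sf], of a] by (simp add: k fun_eq_iff)
      then show ?thesis
        using contr_dext[of n a "\<lambda>y. contr k a (\<alpha> y)" x v] by (simp add: fdd_def k)
    qed
    then show "dext k \<alpha> x (case_nat a (case_nat a v)) = 0"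
      unfolding contr_eq by (simp add: k)
  qed
qed

lemma smooth_form_dext: 
  assumes "smooth_form k \<alpha>"
  shows "smooth_form (Suc k) (dext k \<alpha>)"
proof -
  have "smooth (\<lambda>x. dext k \<alpha> x v)" for v
    unfolding dext_def by (intro smooth_sum smooth_cmult smooth_dd smooth_formD[OF assms])
  then show ?thesis using alternating_dext[OF assms] by (simp add: smooth_form_def)
qed

lemma fdd_dext:
  assumes "smooth_form k \<alpha>"
  shows "fdd a (dext k \<alpha>) = dext k (fdd a \<alpha>)"
proof (intro ext)
  note sm = smooth_formD(2)[OF assms]
  fix x v
  have "fdd a (dext k \<alpha>) x v =
     (\<Sum>i\<le>k. dd a (\<lambda>x. (- 1) ^ i * dd (v i) (\<lambda>y. \<alpha> y (\<lambda>j. if j < i then v j else v (Suc j))) x) x)"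
    unfolding fdd_def dext_def by (intro dd_sum smooth_cmult smooth_dd sm)
  also have "\<dots> = dext k (fdd a \<alpha>) x v"
    unfolding dext_def fdd_def
    by (intro sum.cong refl) (simp add: dd_cmult smooth_dd sm dd_commute[OF sm, of a])
  finally show "fdd a (dext k \<alpha>) x v = dext k (fdd a \<alpha>) x v" .
qed

lemma contr_dext_fun:
  "(\<lambda>y. contr (Suc k) a (dext k \<alpha> y)) = (\<lambda>y v. fdd a \<alpha> y v - dext (k - 1) (\<lambda>y. contr k a (\<alpha> y)) y v)"
  by (intro ext) (rule contr_dext)

lemma dext_dext: "smooth_form k \<alpha> \<Longrightarrow> dext (Suc k) (dext k \<alpha>) = (\<lambda>x v. 0)"
proof (induction k arbitrary: \<alpha> rule: less_induct)
  case (less k)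
  note sf = less.prems
  show ?case
  proof (rule ext, rule contr_ext[of "Suc (Suc k)"])
    fix x a v
    let ?a = "\<lambda>y. contr k a (\<alpha> y)"
    have z: "dext k (dext (k - 1) ?a) = (\<lambda>x v. 0)"
    proof (cases k)
      case (Suc n)
      then show ?thesis using less.IH[of n ?a] smooth_form_contr[OF sf, of a] by simp
    qed simp
    have sd: "smooth_form k (dext (k - 1) ?a)"
    proof (cases k)
      case (Suc n)
      then show ?thesis using smooth_form_dext[OF smooth_form_contr[OF sf, of a]] by simp
    qed simp
    have "contr (Suc (Suc k)) a (dext (Suc k) (dext k \<alpha>) x) v =
        fdd a (dext k \<alpha>) x v - dext k (\<lambda>y. contr (Suc k) a (dext k \<alpha> y)) x v"
      by (subst contr_dext) simp
    also have "dext k (\<lambda>y. contr (Suc k) a (dext k \<alpha> y)) x v = dext k (fdd a \<alpha>) x v - dext k (dext (k - 1) ?a) x v"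
      unfolding contr_dext_fun by (rule dext_diff[OF smooth_form_fdd[OF sf] sd])
    finally show "contr (Suc (Suc k)) a (dext (Suc k) (dext k \<alpha>) x) v = contr (Suc (Suc k)) a (\<lambda>v. 0) v"
      by (simp add: fdd_dext[OF sf] z[unfolded One_nat_def])
  qed simp
qed

text \<open>
  The Leibniz rule, by induction on the total degree: both sides have the same contractions by
  Cartan's formula, as contraction is an antiderivation and \<open>fdd a\<close> a derivation.
\<close>

lemma dext_wedge:
  "smooth_form k \<alpha> \<Longrightarrow> smooth_form l \<beta> \<Longrightarrow>
   dext (k + l) (\<lambda>x. alt_wedge k l (\<alpha> x) (\<beta> x)) x =
     (\<lambda>v. alt_wedge (Suc k) l (dext k \<alpha> x) (\<beta> x) v + (- 1) ^ k * alt_wedge k (Suc l) (\<alpha> x) (dext l \<beta> x) v)"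
proof (induction "k + l" arbitrary: k l \<alpha> \<beta> x rule: less_induct)
  case less
  note sa = less.prems(1) and sb = less.prems(2)
  show ?case
  proof (rule contr_ext[of "Suc (k + l)"])
    fix a v
    let ?a = "\<lambda>y. contr k a (\<alpha> y)" and ?b = "\<lambda>y. contr l a (\<beta> y)"
    note sa' = smooth_form_contr[OF sa, of a] and sb' = smooth_form_contr[OF sb, of a]
    have W1: "smooth_form (k + l - 1) (\<lambda>x. alt_wedge (k - 1) l (?a x) (\<beta> x))"
      using smooth_form_wedge[OF sa' sb] by (cases k) auto
    have W2: "smooth_form (k + l - 1) (\<lambda>x. alt_wedge k (l - 1) (\<alpha> x) (?b x))"
      using smooth_form_wedge[OF sa sb'] by (cases l) auto
    have D1: "dext (k + l - 1) (\<lambda>x. alt_wedge (k - 1) l (?a x) (\<beta> x)) x v =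
        alt_wedge k l (dext (k - 1) ?a x) (\<beta> x) v - (- 1) ^ k * alt_wedge (k - 1) (Suc l) (?a x) (dext l \<beta> x) v"
    proof (cases k)
      case (Suc n)
      then show ?thesis using less.hyps[of "k - 1" l ?a \<beta> x] sa' sb by simp
    qed simp
    have D2: "dext (k + l - 1) (\<lambda>x. alt_wedge k (l - 1) (\<alpha> x) (?b x)) x v =
        alt_wedge (Suc k) (l - 1) (dext k \<alpha> x) (?b x) v + (- 1) ^ k * alt_wedge k l (\<alpha> x) (dext (l - 1) ?b x) v"
    proof (cases l)
      case (Suc n)
      then show ?thesis using less.hyps[of k "l - 1" \<alpha> ?b x] sa sb' by simp
    qed simp
    have "contr (Suc (k + l)) a (dext (k + l) (\<lambda>x. alt_wedge k l (\<alpha> x) (\<beta> x)) x) v =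
        fdd a (\<lambda>x. alt_wedge k l (\<alpha> x) (\<beta> x)) x v -
        dext (k + l - 1) (\<lambda>y. contr (k + l) a (alt_wedge k l (\<alpha> y) (\<beta> y))) x v"
      by (rule contr_dext)
    also have "(\<lambda>y. contr (k + l) a (alt_wedge k l (\<alpha> y) (\<beta> y))) =
        (\<lambda>y v. alt_wedge (k - 1) l (?a y) (\<beta> y) v + (- 1) ^ k * alt_wedge k (l - 1) (\<alpha> y) (?b y) v)"
      using smooth_formD(1)[OF sa] smooth_formD(1)[OF sb] by (intro ext contr_wedge) 
    also have "dext (k + l - 1) \<dots> x v = dext (k + l - 1) (\<lambda>x. alt_wedge (k - 1) l (?a x) (\<beta> x)) x v +
        (- 1) ^ k * dext (k + l - 1) (\<lambda>x. alt_wedge k (l - 1) (\<alpha> x) (?b x)) x v"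
      by (subst dext_add[OF W1 smooth_form_cmult[OF W2]]) (simp only: dext_cmult[OF W2])
    finally have L: "contr (Suc (k + l)) a (dext (k + l) (\<lambda>x. alt_wedge k l (\<alpha> x) (\<beta> x)) x) v =
        alt_wedge k l (fdd a \<alpha> x) (\<beta> x) v + alt_wedge k l (\<alpha> x) (fdd a \<beta> x) v -
        (alt_wedge k l (dext (k - 1) ?a x) (\<beta> x) v - (- 1) ^ k * alt_wedge (k - 1) (Suc l) (?a x) (dext l \<beta> x) v +
         (- 1) ^ k * (alt_wedge (Suc k) (l - 1) (dext k \<alpha> x) (?b x) v + (- 1) ^ k * alt_wedge k l (\<alpha> x) (dext (l - 1) ?b x) v))"
      unfolding D1 D2 fdd_wedge[OF sa sb] .
    have ca: "contr (Suc k) a (dext k \<alpha> x) = (\<lambda>v. fdd a \<alpha> x v - dext (k - 1) ?a x v)"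
      and cb: "contr (Suc l) a (dext l \<beta> x) = (\<lambda>v. fdd a \<beta> x v - dext (l - 1) ?b x v)"
      by (intro ext contr_dext)+
    have R1: "contr (Suc (k + l)) a (alt_wedge (Suc k) l (dext k \<alpha> x) (\<beta> x)) v =
        alt_wedge k l (fdd a \<alpha> x) (\<beta> x) v - alt_wedge k l (dext (k - 1) ?a x) (\<beta> x) v -
        (- 1) ^ k * alt_wedge (Suc k) (l - 1) (dext k \<alpha> x) (?b x) v"
      using contr_wedge[OF alternating_dext[OF sa, of x] smooth_formD(1)[OF sb, of x], of a v]
      unfolding ca alt_wedge_diff_left diff_Suc_1 by (simp del: contr_Suc)
    have R2: "contr (Suc (k + l)) a (alt_wedge k (Suc l) (\<alpha> x) (dext l \<beta> x)) v =
        alt_wedge (k - 1) (Suc l) (?a x) (dext l \<beta> x) v +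
        (- 1) ^ k * (alt_wedge k l (\<alpha> x) (fdd a \<beta> x) v - alt_wedge k l (\<alpha> x) (dext (l - 1) ?b x) v)"
      using contr_wedge[OF smooth_formD(1)[OF sa, of x] alternating_dext[OF sb, of x], of a v]
      unfolding cb alt_wedge_diff_right diff_Suc_1 by (simp del: contr_Suc)
    have sgn: "(- 1) ^ k * ((- 1) ^ k * y) = y" for y :: real
      by (simp add: mult.assoc[symmetric] power_mult_distrib[symmetric])
    have "contr (Suc (k + l)) a (\<lambda>v. alt_wedge (Suc k) l (dext k \<alpha> x) (\<beta> x) v +
          (- 1) ^ k * alt_wedge k (Suc l) (\<alpha> x) (dext l \<beta> x) v) v =
        contr (Suc (k + l)) a (alt_wedge (Suc k) l (dext k \<alpha> x) (\<beta> x)) v +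
        (- 1) ^ k * contr (Suc (k + l)) a (alt_wedge k (Suc l) (\<alpha> x) (dext l \<beta> x)) v"
      by simp
    also have "\<dots> = contr (Suc (k + l)) a (dext (k + l) (\<lambda>x. alt_wedge k l (\<alpha> x) (\<beta> x)) x) v"
      unfolding R1 R2 L by (simp add: sgn algebra_simps)
    finally show "contr (Suc (k + l)) a (dext (k + l) (\<lambda>x. alt_wedge k l (\<alpha> x) (\<beta> x)) x) v =
      contr (Suc (k + l)) a (\<lambda>v. alt_wedge (Suc k) l (dext k \<alpha> x) (\<beta> x) v +
          (- 1) ^ k * alt_wedge k (Suc l) (\<alpha> x) (dext l \<beta> x) v) v" by simp
  qed simp
qed

section \<open>Affine pullbacks and averages of forms\<close>

definition affine_pull :: "('e \<Rightarrow> 'e) \<Rightarrow> 'e \<Rightarrow> ('e::euclidean_space \<Rightarrow> 'e multiform) \<Rightarrow> 'e \<Rightarrow> 'e multiform" where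
  "affine_pull L c \<alpha> x v = \<alpha> (L x + c) (\<lambda>i. L (v i))"

lemma smooth_form_affine_pull: "linear L \<Longrightarrow> smooth_form k \<alpha> \<Longrightarrow> smooth_form k (affine_pull L c \<alpha>)"
proof -
  assume L: "linear L" and sf: "smooth_form k \<alpha>"
  have "alternating k (affine_pull L c \<alpha> x)" for x
    unfolding affine_pull_def[abs_def] by (rule alternating_pull[OF smooth_formD(1)[OF sf] L])
  moreover have "smooth (\<lambda>x. affine_pull L c \<alpha> x v)" for v
    unfolding affine_pull_def by (rule smooth_affine[OF smooth_formD(2)[OF sf] L])
  ultimately show ?thesis by (simp add: smooth_form_def)
qed

lemma dext_affine_pull:
  assumes "linear L" "smooth_form k \<alpha>"
  shows "dext k (affine_pull L c \<alpha>) = affine_pull L c (dext k \<alpha>)"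
proof (intro ext)
  fix x v
  have "dd (v i) (\<lambda>y. \<alpha> (L y + c) (\<lambda>j. L (if j < i then v j else v (Suc j)))) x =
      dd (L (v i)) (\<lambda>y. \<alpha> y (\<lambda>j. if j < i then L (v j) else L (v (Suc j)))) (L x + c)" for i
    using dd_affine[OF smooth_formD(2)[OF assms(2)] assms(1)] by (simp add: if_distrib cong: if_cong)
  then show "dext k (affine_pull L c \<alpha>) x v = affine_pull L c (dext k \<alpha>) x v"
    by (simp add: dext_def affine_pull_def)
qed

lemma affine_pull_wedge:
  "affine_pull L c (\<lambda>x. alt_wedge k l (\<alpha> x) (\<beta> x)) = (\<lambda>x. alt_wedge k l (affine_pull L c \<alpha> x) (affine_pull L c \<beta> x))"
  by (auto simp: affine_pull_def alt_wedge_def fun_eq_iff)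

definition fseg :: "(real \<Rightarrow> real) \<Rightarrow> 'e::euclidean_space \<Rightarrow> ('e \<Rightarrow> 'e multiform) \<Rightarrow> 'e \<Rightarrow> 'e multiform" where
  "fseg w a \<alpha> x v = segint w a (\<lambda>y. \<alpha> y v) x"

lemma smooth_form_fseg:
  assumes w: "continuous_on UNIV w" and sf: "smooth_form k \<alpha>"
  shows "smooth_form k (fseg w a \<alpha>)"
  unfolding smooth_form_def
proof (intro conjI allI)
  note alt = smooth_formD(1)[OF sf] and sm = smooth_formD(2)[OF sf]
  show "smooth (\<lambda>x. fseg w a \<alpha> x v)" for v
    unfolding fseg_def using smooth_segint[OF w sm] .
  fix x
  show "alternating k (fseg w a \<alpha> x)"
    unfolding alternating_def
  proof (intro conjI allI impI)
    fix v u :: "nat \<Rightarrow> 'a" assume "\<forall>i<k. v i = u i"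
    then have "\<alpha> y v = \<alpha> y u" for y using alternating_cong[OF alt] by blast
    then show "fseg w a \<alpha> x v = fseg w a \<alpha> x u" by (simp add: fseg_def)
  next
    fix v i assume "i < k"
    note lin = alternating_linear[OF alt \<open>i < k\<close>]
    show "linear (\<lambda>b. fseg w a \<alpha> x (v(i := b)))"
      by (rule linearI) (simp_all add: fseg_def linear_add[OF lin] linear_scale[OF lin] segint_add[OF w sm sm] segint_cmult)
  next
    fix v :: "nat \<Rightarrow> 'a" and i j assume "i < j \<and> j < k \<and> v i = v j"
    then have "\<alpha> y v = 0" for y using alternating_repeat[OF alt, of i j v] by auto
    then show "fseg w a \<alpha> x v = 0" by (simp add: fseg_def segint_zero)
  qed
qed

lemma dext_fseg:
  assumes w: "continuous_on UNIV w" and sf: "smooth_form k \<alpha>"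
  shows "dext l (fseg w a \<alpha>) = fseg w a (dext l \<alpha>)"
proof (intro ext)
  note sm = smooth_formD(2)[OF sf]
  fix x v
  show "dext l (fseg w a \<alpha>) x v = fseg w a (dext l \<alpha>) x v"
    unfolding dext_def fseg_def
    by (subst segint_sum[OF w])
      (auto simp: segint_cmult dd_segint[OF w sm] intro!: smooth_cmult smooth_dd sm)
qed

lemma fdd_fseg:
  assumes w: "continuous_on UNIV w" and sf: "smooth_form k \<alpha>"
  shows "fdd b (fseg w a \<alpha>) = fseg w a (fdd b \<alpha>)"
  using dd_segint[OF w smooth_formD(2)[OF sf]] by (simp add: fdd_def fseg_def fun_eq_iff)

lemma fdd_add: "smooth_form k \<alpha> \<Longrightarrow> smooth_form k \<beta> \<Longrightarrow> fdd a (\<lambda>x v. \<alpha> x v + \<beta> x v) x v = fdd a \<alpha> x v + fdd a \<beta> x v"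
  by (simp add: fdd_def dd_add smooth_formD)

lemma fdd_diff: "smooth_form k \<alpha> \<Longrightarrow> smooth_form k \<beta> \<Longrightarrow> fdd a (\<lambda>x v. \<alpha> x v - \<beta> x v) x v = fdd a \<alpha> x v - fdd a \<beta> x v"
  by (simp add: fdd_def dd_diff smooth_formD)

section \<open>Periodic forms\<close>

definition periodic :: "'e::euclidean_space set \<Rightarrow> ('e \<Rightarrow> 'e multiform) \<Rightarrow> bool" where
  "periodic \<Lambda> \<alpha> \<longleftrightarrow> (\<forall>a\<in>\<Lambda>. \<forall>x. \<alpha> (x + a) = \<alpha> x)"

lemma periodicD: "periodic \<Lambda> \<alpha> \<Longrightarrow> a \<in> \<Lambda> \<Longrightarrow> \<alpha> (x + a) = \<alpha> x"
  unfolding periodic_def by blast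

lemma fdd_translation_invariant: "(\<And>y. \<alpha> (y + b) = \<alpha> y) \<Longrightarrow> smooth_form k \<alpha> \<Longrightarrow> fdd a \<alpha> (x + b) = fdd a \<alpha> x"
proof
  fix v assume inv: "\<And>y. \<alpha> (y + b) = \<alpha> y" and sf: "smooth_form k \<alpha>"
  have "dd a (\<lambda>y. \<alpha> (y + b) v) x = fdd a \<alpha> (x + b) v"
    using dd_translate[OF smooth_formD(2)[OF sf]] by (simp add: fdd_def)
  then show "fdd a \<alpha> (x + b) v = fdd a \<alpha> x v" by (simp add: inv fdd_def)
qed

lemma periodic_dext:
  assumes "periodic \<Lambda> \<alpha>" "smooth_form k \<alpha>"
  shows "periodic \<Lambda> (dext k \<alpha>)"
  unfolding periodic_def
proof (intro ballI allI ext)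
  fix a x v assume a: "a \<in> \<Lambda>"
  have "dd b (\<lambda>y. \<alpha> y w) (x + a) = dd b (\<lambda>y. \<alpha> y w) x" for b w
    using fdd_translation_invariant[of \<alpha> a k b x] periodicD[OF assms(1) a] assms(2)
    by (simp add: fdd_def fun_eq_iff)
  then show "dext k \<alpha> (x + a) v = dext k \<alpha> x v" by (simp add: dext_def)
qed

lemma periodic_const [simp]: "periodic \<Lambda> (\<lambda>x. c)"
  by (simp add: periodic_def)

lemma periodic_add: "periodic \<Lambda> \<alpha> \<Longrightarrow> periodic \<Lambda> \<beta> \<Longrightarrow> periodic \<Lambda> (\<lambda>x v. \<alpha> x v + \<beta> x v)"
  and periodic_diff: "periodic \<Lambda> \<alpha> \<Longrightarrow> periodic \<Lambda> \<beta> \<Longrightarrow> periodic \<Lambda> (\<lambda>x v. \<alpha> x v - \<beta> x v)"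
  and periodic_contr: "periodic \<Lambda> \<alpha> \<Longrightarrow> periodic \<Lambda> (\<lambda>x. contr k b (\<alpha> x))"
  by (simp_all add: periodic_def contr_def fun_eq_iff)

lemma periodic_fseg: "periodic \<Lambda> \<alpha> \<Longrightarrow> periodic \<Lambda> (fseg w b \<alpha>)"
proof -
  assume p: "periodic \<Lambda> \<alpha>"
  have "\<alpha> (x + a + s *\<^sub>R b) = \<alpha> (x + s *\<^sub>R b)" if "a \<in> \<Lambda>" for a x s
    using periodicD[OF p that, of "x + s *\<^sub>R b"] by (simp add: add_ac)
  then show ?thesis by (simp add: periodic_def fseg_def segint_def fun_eq_iff)
qed

lemma periodic_affine_pull:
  assumes "periodic \<Lambda> \<alpha>" "linear M" "\<And>a. a \<in> \<Lambda> \<Longrightarrow> M a \<in> \<Lambda>"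
  shows "periodic \<Lambda> (affine_pull M c \<alpha>)"
proof -
  have "\<alpha> (M (x + a) + c) = \<alpha> (M x + c)" if "a \<in> \<Lambda>" for x a
    using periodicD[OF assms(1) assms(3)[OF that], of "M x + c"] by (simp add: linear_add[OF assms(2)] add_ac)
  then show ?thesis by (simp add: periodic_def affine_pull_def fun_eq_iff)
qed

lemma linear_fdd: "smooth_form k \<alpha> \<Longrightarrow> linear (\<lambda>a. fdd a \<alpha> x v)"
  unfolding fdd_def by (intro linear_dd smooth_formD)

lemma fdd_zero_span:
  assumes sf: "smooth_form k \<alpha>" and z: "\<And>b. b \<in> B \<Longrightarrow> fdd b \<alpha> = (\<lambda>x v. 0)" and a: "a \<in> span B"
  shows "fdd a \<alpha> = (\<lambda>x v. 0)"
proof (intro ext)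
  fix x v
  show "fdd a \<alpha> x v = 0"
    using linear_eq_0_on_span[OF linear_fdd[OF sf, of x v], of B a] z a by simp
qed

text \<open>
  Zero derivative in the direction \<open>a\<close> means invariance under the translation by \<open>a\<close>.
\<close>

lemma fdd_zero_translate:
  assumes sf: "smooth_form k \<alpha>" and z: "fdd a \<alpha> = (\<lambda>x v. 0)"
  shows "\<alpha> (x + a) = \<alpha> x"
proof
  fix v
  have "dd a (\<lambda>y. \<alpha> y v) = (\<lambda>x. 0)" using z by (simp add: fdd_def[abs_def] fun_eq_iff)
  then show "\<alpha> (x + a) v = \<alpha> x v"
    using segint_one_dd[OF smooth_formD(2)[OF sf], of a v x] by (simp add: segint_def)
qed

text \<open>
  Cartan's formula for a closed form: the contraction is a primitive of the derivative.
\<close>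

lemma closed_fdd_contr:
  assumes "dext k \<alpha> = (\<lambda>x v. 0)"
  shows "dext (k - 1) (\<lambda>y. contr k a (\<alpha> y)) = fdd a \<alpha>"
  using contr_dext[of k a \<alpha>] assms by (simp add: fun_eq_iff)

text \<open>
  The average $\int_0^1 \alpha(x + s a)\,ds$ has zero derivative in the direction of the period \<open>a\<close>, and it
  differs from \<open>\<alpha>\<close> by the differential of \<open>\<beta>\<close>, the average of \<open>contr a \<alpha>\<close> with weight \<open>1 - s\<close>, by
  Cartan's formula and integration by parts.  Directions in \<open>B\<close> treated before are not disturbed,
  because \<open>fdd b\<close> commutes with averages.
\<close>

lemma kill_periodic_direction:
  assumes sf: "smooth_form (Suc k) \<alpha>" and cl: "dext (Suc k) \<alpha> = (\<lambda>x v. 0)" and p: "periodic \<Lambda> \<alpha>" and a: "a \<in> \<Lambda>"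
    and B: "\<And>b. b \<in> B \<Longrightarrow> fdd b \<alpha> = (\<lambda>x v. 0)"
  shows "\<exists>\<beta>. smooth_form k \<beta> \<and> periodic \<Lambda> \<beta> \<and>
    (\<forall>b\<in>insert a B. fdd b (\<lambda>x v. \<alpha> x v + dext k \<beta> x v) = (\<lambda>x v. 0))"
proof -
  let ?i = "\<lambda>x. contr (Suc k) a (\<alpha> x)"
  define \<beta> where "\<beta> = fseg (\<lambda>s. 1 - s) a ?i"
  have si: "smooth_form k ?i" using smooth_form_contr[OF sf, of a] by simp
  have w: "continuous_on UNIV (\<lambda>s::real. 1 - s)" "continuous_on UNIV (\<lambda>s::real. 1 :: real)"
    by (intro continuous_intros)+
  have sb: "smooth_form k \<beta>" unfolding \<beta>_def by (rule smooth_form_fseg[OF w(1) si])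
  have pb: "periodic \<Lambda> \<beta>" unfolding \<beta>_def by (intro periodic_fseg periodic_contr p)
  have fd: "fdd b (\<lambda>x v. \<alpha> x v + dext k \<beta> x v) x v = fdd b \<alpha> x v + dext k (fseg (\<lambda>s. 1 - s) a (fdd b ?i)) x v" for b x v
    by (simp only: fdd_add[OF sf smooth_form_dext[OF sb]] fdd_dext[OF sb])
      (simp only: \<beta>_def fdd_fseg[OF w(1) si])
  have di: "dext k ?i = fdd a \<alpha>" using closed_fdd_contr[OF cl, of a] by simp
  have "fdd a (\<lambda>x v. \<alpha> x v + dext k \<beta> x v) x v = 0" for x v
  proof -
    have "fseg (\<lambda>s. 1 - s) a (fdd a ?i) = (\<lambda>x v. fseg (\<lambda>s. 1) a ?i x v - ?i x v)"
      using segint_ramp_dd[OF smooth_formD(2)[OF si]] by (simp add: fun_eq_iff fseg_def fdd_def[abs_def])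
    then have "dext k (fseg (\<lambda>s. 1 - s) a (fdd a ?i)) x v = fseg (\<lambda>s. 1) a (fdd a \<alpha>) x v - fdd a \<alpha> x v"
      by (simp only: dext_diff[OF smooth_form_fseg[OF w(2) si] si] dext_fseg[OF w(2) si] di)
    also have "fseg (\<lambda>s. 1) a (fdd a \<alpha>) x v = \<alpha> (x + a) v - \<alpha> x v"
      using segint_one_dd[OF smooth_formD(2)[OF sf], of a v x] by (simp add: fseg_def fdd_def[abs_def])
    finally show ?thesis unfolding fd using periodicD[OF p a] by simp
  qed
  moreover have "fdd b (\<lambda>x v. \<alpha> x v + dext k \<beta> x v) x v = 0" if "b \<in> B" for b x v
  proof -
    have "fdd b ?i = (\<lambda>x v. 0)"
      using B[OF that] by (simp add: fdd_def fun_eq_iff)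
    moreover have "fseg (\<lambda>s. 1 - s) a (\<lambda>x v. 0) = (\<lambda>x v. 0)" by (simp add: fseg_def segint_zero fun_eq_iff)
    ultimately show ?thesis unfolding fd using B[OF that] by simp
  qed
  ultimately show ?thesis using sb pb by (intro exI[of _ \<beta>]) (auto simp: fun_eq_iff)
qed

lemma kill_periodic_directions:
  assumes sf: "smooth_form (Suc k) \<alpha>" and cl: "dext (Suc k) \<alpha> = (\<lambda>x v. 0)" and p: "periodic \<Lambda> \<alpha>"
  shows "finite B \<Longrightarrow> B \<subseteq> \<Lambda> \<Longrightarrow> \<exists>\<beta>. smooth_form k \<beta> \<and> periodic \<Lambda> \<beta> \<and>
    (\<forall>b\<in>B. fdd b (\<lambda>x v. \<alpha> x v + dext k \<beta> x v) = (\<lambda>x v. 0))"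
proof (induction B rule: finite_induct)
  case empty
  show ?case by (intro exI[of _ "\<lambda>x v. 0"]) simp
next
  case (insert a B)
  then obtain \<beta> where b: "smooth_form k \<beta>" "periodic \<Lambda> \<beta>"
    "\<forall>b\<in>B. fdd b (\<lambda>x v. \<alpha> x v + dext k \<beta> x v) = (\<lambda>x v. 0)" by auto
  let ?g = "\<lambda>x v. \<alpha> x v + dext k \<beta> x v"
  have sg: "smooth_form (Suc k) ?g" by (intro smooth_form_add sf smooth_form_dext b)
  have cg: "dext (Suc k) ?g = (\<lambda>x v. 0)"
    using dext_add[OF sf smooth_form_dext[OF b(1)], of "Suc k"] dext_dext[OF b(1)] cl by (simp add: fun_eq_iff)
  have pg: "periodic \<Lambda> ?g" by (intro periodic_add p periodic_dext b)
  obtain \<beta>' where b': "smooth_form k \<beta>'" "periodic \<Lambda> \<beta>'"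
    "\<forall>b\<in>insert a B. fdd b (\<lambda>x v. ?g x v + dext k \<beta>' x v) = (\<lambda>x v. 0)"
    using kill_periodic_direction[OF sg cg pg, of a B] insert.prems b(3) by blast
  have "(\<lambda>x v. \<alpha> x v + dext k (\<lambda>x v. \<beta> x v + \<beta>' x v) x v) = (\<lambda>x v. ?g x v + dext k \<beta>' x v)"
    by (simp add: dext_add[OF b(1) b'(1)] add.assoc)
  then show ?case
    using b b' by (intro exI[of _ "\<lambda>x v. \<beta> x v + \<beta>' x v"]) (auto intro: smooth_form_add periodic_add)
qed

text \<open>
  A primitive of a constant form may be averaged along the periods, since averaging fixes the constant
  form and commutes with \<open>dext\<close>.
\<close>

lemma average_primitive:
  assumes sf: "smooth_form k \<beta>" and d: "dext k \<beta> = (\<lambda>x. c)" and p: "periodic \<Lambda> \<beta>"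
  shows "finite B \<Longrightarrow> B \<subseteq> \<Lambda> \<Longrightarrow> \<exists>\<gamma>. smooth_form k \<gamma> \<and> periodic \<Lambda> \<gamma> \<and> dext k \<gamma> = (\<lambda>x. c) \<and>
    (\<forall>b\<in>B. fdd b \<gamma> = (\<lambda>x v. 0))"
proof (induction B rule: finite_induct)
  case empty
  then show ?case using assms by auto
next
  case (insert a B)
  then obtain \<gamma> where g: "smooth_form k \<gamma>" "periodic \<Lambda> \<gamma>" "dext k \<gamma> = (\<lambda>x. c)" "\<forall>b\<in>B. fdd b \<gamma> = (\<lambda>x v. 0)"
    by auto
  have w: "continuous_on UNIV (\<lambda>s::real. 1 :: real)" by simp
  let ?g = "fseg (\<lambda>s. 1) a \<gamma>"
  have "dext k ?g = (\<lambda>x. c)"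
    unfolding dext_fseg[OF w g(1)] g(3) by (simp add: fseg_def segint_def fun_eq_iff)
  moreover have "fdd a ?g x v = 0" for x v
  proof -
    have "fdd a ?g x v = segint (\<lambda>s. 1) a (dd a (\<lambda>y. \<gamma> y v)) x"
      unfolding fdd_fseg[OF w g(1)] by (simp add: fseg_def fdd_def[abs_def])
    also have "\<dots> = \<gamma> (x + a) v - \<gamma> x v" by (rule segint_one_dd[OF smooth_formD(2)[OF g(1)]])
    also have "\<dots> = 0" using periodicD[OF g(2), of a x] insert.prems by simp
    finally show ?thesis .
  qed
  moreover have "fdd b ?g x v = 0" if "b \<in> B" for b x v
    unfolding fdd_fseg[OF w g(1)] using g(4) that by (simp add: fseg_def segint_zero)
  ultimately show ?case
    using g smooth_form_fseg[OF w g(1), of a] periodic_fseg[OF g(2)]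
    by (intro exI[of _ ?g]) (auto simp: fun_eq_iff)
qed

section \<open>Solving the cohomological equation on the cylinder\<close>

text \<open>
  The solution is the series of the iterated pullbacks of \<open>\<delta>\<close>.  Each step shifts the height \<open>u\<close> by one
  and \<open>\<delta>\<close> vanishes at low heights, so only finitely many terms are nonzero near each point.
\<close>

lemma one_sided_cohomological_equation:
  fixes \<delta> :: "'e::euclidean_space \<Rightarrow> 'e multiform"
  assumes M: "linear M" "\<And>a. a \<in> \<Lambda> \<Longrightarrow> M a \<in> \<Lambda>"
    and u: "linear u" "\<And>x. u (M x + c) = u x - (1::real)" "\<And>a. a \<in> \<Lambda> \<Longrightarrow> u a = 0"
    and d: "smooth_form k \<delta>" "periodic \<Lambda> \<delta>" "\<And>x v. u x \<le> - 1 \<Longrightarrow> \<delta> x v = 0"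
  shows "\<exists>\<epsilon>. smooth_form k \<epsilon> \<and> periodic \<Lambda> \<epsilon> \<and> (\<forall>x v. \<delta> x v = \<epsilon> x v - affine_pull M c \<epsilon> x v)"
proof -
  \<comment> \<open>iterated pullbacks; D j vanishes where u x is at most j - 1\<close>
  define D where "D j = (affine_pull M c ^^ j) \<delta>" for j
  have DS: "D (Suc j) = affine_pull M c (D j)" for j by (simp add: D_def)
  have D: "smooth_form k (D j) \<and> periodic \<Lambda> (D j)" for j
  proof (induction j)
    case 0
    then show ?case by (simp add: D_def d)
  next
    case (Suc j)
    then show ?case
      unfolding DS using smooth_form_affine_pull[OF M(1)] periodic_affine_pull[OF _ M] by blast
  qed
  have D0: "D j x v = 0" if "u x \<le> real j - 1" for j x v
    using that
  proof (induction j arbitrary: x v)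
    case 0
    then show ?case using d(3) by (simp add: D_def)
  next
    case (Suc j)
    then show ?case unfolding DS by (simp add: affine_pull_def u(2))
  qed
  define \<epsilon> where "\<epsilon> x v = (\<Sum>j<nat \<lceil>u x + 1\<rceil>. D j x v)" for x v
  have eps: "\<epsilon> x v = (\<Sum>j<N. D j x v)" if "u x + 1 \<le> real N" for x v N
    unfolding \<epsilon>_def
  proof (rule sum.mono_neutral_left)
    have "nat \<lceil>u x + 1\<rceil> \<le> N" using that by linarith
    then show "{..<nat \<lceil>u x + 1\<rceil>} \<subseteq> {..<N}" by simp
    show "\<forall>i\<in>{..<N} - {..<nat \<lceil>u x + 1\<rceil>}. D i x v = 0"
    proof
      fix i assume "i \<in> {..<N} - {..<nat \<lceil>u x + 1\<rceil>}"
      then have "nat \<lceil>u x + 1\<rceil> \<le> i" by simp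
      then have "u x \<le> real i - 1" by linarith
      then show "D i x v = 0" by (rule D0)
    qed
  qed simp
  have "smooth (\<lambda>x. \<epsilon> x v)" for v
  proof (rule smooth_on_local)
    fix x
    obtain N :: nat where N: "u x + 1 < real N" using reals_Archimedean2 by blast
    let ?T = "{y. u y + 1 < real N}"
    have "continuous_on UNIV u" using u(1) by (simp add: linear_continuous_on linear_conv_bounded_linear)
    then have "open ?T" by (intro open_Collect_less continuous_intros)
    moreover have "smooth_on (\<lambda>x. \<epsilon> x v) ?T"
    proof (rule smooth_on_cong[OF \<open>open ?T\<close>])
      have "smooth (\<lambda>x. \<Sum>j<N. D j x v)" using D by (intro smooth_sum smooth_formD) blast
      then show "smooth_on (\<lambda>x. \<Sum>j<N. D j x v) ?T" by (rule smooth_on_subset) simp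
      show "(\<Sum>j<N. D j y v) = \<epsilon> y v" if "y \<in> ?T" for y using eps[of y N v] that by simp
    qed
    ultimately show "\<exists>T. open T \<and> x \<in> T \<and> smooth_on (\<lambda>x. \<epsilon> x v) T" using N by blast
  qed
  moreover have "alternating k (\<epsilon> x)" for x
    unfolding \<epsilon>_def[abs_def] using D by (intro alternating_sum smooth_formD) blast
  ultimately have "smooth_form k \<epsilon>" by (simp add: smooth_form_def)
  moreover have "periodic \<Lambda> \<epsilon>"
    unfolding periodic_def
  proof (intro ballI allI ext)
    fix a x v assume a: "a \<in> \<Lambda>"
    have "u (x + a) = u x" using u(3)[OF a] by (simp add: linear_add[OF u(1)])
    moreover have "D j (x + a) = D j x" for j using D a by (simp add: periodic_def)
    ultimately show "\<epsilon> (x + a) v = \<epsilon> x v" by (simp add: \<epsilon>_def)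
  qed
  moreover have "\<delta> x v = \<epsilon> x v - affine_pull M c \<epsilon> x v" for x v
  proof -
    obtain N :: nat where N: "u x + 1 < real N" using reals_Archimedean2 by blast
    have "\<epsilon> x v = (\<Sum>j<Suc N. D j x v)" using N by (intro eps) simp
    also have "\<dots> = \<delta> x v + (\<Sum>j<N. D (Suc j) x v)"
      unfolding sum.lessThan_Suc_shift by (simp add: D_def)
    also have "(\<Sum>j<N. D (Suc j) x v) = affine_pull M c \<epsilon> x v"
      unfolding DS affine_pull_def using N by (subst eps[of _ N]) (simp_all add: u(2))
    finally show ?thesis by simp
  qed
  ultimately show ?thesis by blast
qed

section \<open>Mapping tori of diagonalizable maps\<close>

text \<open>
  The data of a mapping torus, on the universal cover: the group generated by the translations by the
  periods \<open>\<Lambda>\<close> and by the map \<open>x \<mapsto> L x + e\<close>.  The height \<open>ht\<close> is the coordinate in the direction of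
  the base circle; the fibres lie over its level sets, and by \<open>span_periods\<close> the periods span the
  directions of the fibre.  The monodromy \<open>L\<close> is diagonal in the standard basis, with eigenvalues \<open>s\<close>, and
  \<open>L'\<close> is its inverse.
\<close>

locale mapping_torus =
  fixes L L' :: "'e::euclidean_space \<Rightarrow> 'e" and s :: "'e \<Rightarrow> real"
    and e :: 'e and ht :: "'e \<Rightarrow> real" and \<Lambda> :: "'e set"
  assumes linL: "linear L" and linL': "linear L'"
    and LL': "\<And>x. L (L' x) = x" and L'L: "\<And>x. L' (L x) = x"
    and L_Basis: "\<And>b. b \<in> Basis \<Longrightarrow> L b = s b *\<^sub>R b" and s_nz: "\<And>b. b \<in> Basis \<Longrightarrow> s b \<noteq> 0"
    and Le: "L e = e" and lin_ht: "linear ht" and ht_e: "ht e = 1" and ht_L: "\<And>x. ht (L x) = ht x"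
    and ht_periods: "\<And>a. a \<in> \<Lambda> \<Longrightarrow> ht a = 0"
    and L_periods: "\<And>a. a \<in> \<Lambda> \<Longrightarrow> L a \<in> \<Lambda>" and L'_periods: "\<And>a. a \<in> \<Lambda> \<Longrightarrow> L' a \<in> \<Lambda>"
    and span_periods: "span (insert e \<Lambda>) = UNIV"
begin

abbreviation pull :: "('e \<Rightarrow> 'e multiform) \<Rightarrow> 'e \<Rightarrow> 'e multiform" where
  "pull \<equiv> affine_pull L e"

abbreviation ipull :: "('e \<Rightarrow> 'e multiform) \<Rightarrow> 'e \<Rightarrow> 'e multiform" where
  "ipull \<equiv> affine_pull L' (- e)"

lemma L'e: "L' e = e"
  using L'L[of e] Le by simp

lemma pull_ipull: "pull (ipull \<alpha>) = \<alpha>"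
  by (simp add: affine_pull_def[abs_def] linear_add[OF linL'] L'L L'e)

lemma ht_L': "ht (L' x) = ht x"
  using ht_L[of "L' x"] LL' by simp

lemma pull_diff: "pull (\<lambda>x v. \<alpha> x v - \<beta> x v) = (\<lambda>x v. pull \<alpha> x v - pull \<beta> x v)"
  and pull_add: "pull (\<lambda>x v. \<alpha> x v + \<beta> x v) = (\<lambda>x v. pull \<alpha> x v + pull \<beta> x v)"
  by (simp_all add: affine_pull_def[abs_def])

lemma smooth_ht: "smooth ht" by (rule smooth_linear[OF lin_ht])

text \<open>
  A cut-off function of the height splits \<open>\<delta>\<close> into a part supported where the height is positive and a part
  supported where it is less than 1.  The first part is solved by summing inverse pullbacks, the second
  one by summing pullbacks; both sums are locally finite.
\<close>

lemma cohomological_equation: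
  assumes d: "smooth_form k \<delta>" "periodic \<Lambda> \<delta>"
  shows "\<exists>\<epsilon>. smooth_form k \<epsilon> \<and> periodic \<Lambda> \<epsilon> \<and> \<delta> = (\<lambda>x v. pull \<epsilon> x v - \<epsilon> x v)"
proof -
  obtain h :: "real \<Rightarrow> real" where h: "smooth h" "\<And>x. x \<le> 0 \<Longrightarrow> h x = 0" "\<And>x. 1 \<le> x \<Longrightarrow> h x = 1"
    using smooth_cutoff by blast
  have sh: "smooth (\<lambda>x. h (ht x))" using smooth_affine[OF h(1) lin_ht, of 0] by simp
  have ph: "h (ht (x + a)) = h (ht x)" if "a \<in> \<Lambda>" for x a
    using ht_periods[OF that] by (simp add: linear_add[OF lin_ht])
  have "\<exists>\<epsilon>. smooth_form k \<epsilon> \<and> periodic \<Lambda> \<epsilon> \<and> (\<forall>x v. h (ht x) * \<delta> x v = \<epsilon> x v - ipull \<epsilon> x v)"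
  proof (rule one_sided_cohomological_equation[OF linL' L'_periods lin_ht _ ht_periods])
    show "ht (L' x + - e) = ht x - 1" for x
      by (simp add: linear_diff[OF lin_ht] ht_L' ht_e)
    show "smooth_form k (\<lambda>x v. h (ht x) * \<delta> x v)" by (rule smooth_form_mult[OF sh d(1)])
    show "periodic \<Lambda> (\<lambda>x v. h (ht x) * \<delta> x v)"
      using d(2) ph by (simp add: periodic_def)
    show "h (ht x) * \<delta> x v = 0" if "ht x \<le> - 1" for x v using h(2)[of "ht x"] that by simp
  qed
  then obtain \<epsilon>1 where e1: "smooth_form k \<epsilon>1" "periodic \<Lambda> \<epsilon>1" "\<And>x v. h (ht x) * \<delta> x v = \<epsilon>1 x v - ipull \<epsilon>1 x v"
    by blast
  have "\<exists>\<epsilon>. smooth_form k \<epsilon> \<and> periodic \<Lambda> \<epsilon> \<and> (\<forall>x v. (1 - h (ht x)) * \<delta> x v = \<epsilon> x v - pull \<epsilon> x v)"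
  proof (rule one_sided_cohomological_equation[OF linL L_periods])
    show "linear (\<lambda>x. - ht x)" using lin_ht by (rule linear_compose_neg)
    show "- ht (L x + e) = - ht x - 1" for x
      by (simp add: linear_add[OF lin_ht] ht_L ht_e)
    show "- ht a = 0" if "a \<in> \<Lambda>" for a using ht_periods[OF that] by simp
    show "smooth_form k (\<lambda>x v. (1 - h (ht x)) * \<delta> x v)"
      by (intro smooth_form_mult smooth_diff smooth_const sh d)
    show "periodic \<Lambda> (\<lambda>x v. (1 - h (ht x)) * \<delta> x v)"
      using d(2) ph by (simp add: periodic_def)
    show "(1 - h (ht x)) * \<delta> x v = 0" if "- ht x \<le> - 1" for x v using h(3)[of "ht x"] that by simp
  qed
  then obtain \<epsilon>2 where e2: "smooth_form k \<epsilon>2" "periodic \<Lambda> \<epsilon>2"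
    "\<And>x v. (1 - h (ht x)) * \<delta> x v = \<epsilon>2 x v - pull \<epsilon>2 x v" by blast
  let ?e = "\<lambda>x v. ipull \<epsilon>1 x v - \<epsilon>2 x v"
  have "\<delta> x v = pull ?e x v - ?e x v" for x v
  proof -
    have "\<delta> x v = h (ht x) * \<delta> x v + (1 - h (ht x)) * \<delta> x v" by (simp add: algebra_simps)
    also have "\<dots> = \<epsilon>1 x v - ipull \<epsilon>1 x v + (\<epsilon>2 x v - pull \<epsilon>2 x v)" by (simp only: e1(3) e2(3))
    also have "\<dots> = pull ?e x v - ?e x v" by (simp add: pull_diff pull_ipull)
    finally show ?thesis .
  qed
  moreover have "smooth_form k ?e" "periodic \<Lambda> ?e"
    using e1 e2 by (auto intro!: smooth_form_diff periodic_diff smooth_form_affine_pull linL' periodic_affine_pull L'_periods)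
  ultimately show ?thesis by (intro exI[of _ ?e]) (auto simp: fun_eq_iff)
qed

end

section \<open>Primitives vanishing at the origin\<close>

text \<open>
  The indefinite integral from 0.  Fixing the value at 0 makes it unique and hence linear in \<open>G\<close>, so that
  applying it to the coefficients of an alternating form gives an alternating form.
\<close>

definition prim :: "(real \<Rightarrow> real) \<Rightarrow> real \<Rightarrow> real" where
  "prim G = (SOME H. smooth H \<and> (\<forall>t a. dd a H t = a * G t) \<and> H 0 = 0)"

lemma prim:
  assumes "smooth G"
  shows "smooth (prim G)" "dd a (prim G) t = a * G t" "prim G 0 = 0"
proof -
  obtain H where H: "smooth H" "\<And>t a. dd a H t = a * G t" using smooth_primitive[OF assms] by blast
  have "\<exists>H. smooth H \<and> (\<forall>t a. dd a H t = a * G t) \<and> H 0 = 0"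
    using H by (intro exI[of _ "\<lambda>t. H t - H 0"]) (simp add: smooth_diff dd_diff)
  from someI_ex[OF this, folded prim_def]
  show "smooth (prim G)" "dd a (prim G) t = a * G t" "prim G 0 = 0" by blast+
qed

lemma prim_unique:
  assumes G: "smooth G" and H: "smooth H" "\<And>t a. dd a H t = a * G t" "H 0 = 0"
  shows "prim G = H"
proof
  fix t
  have "prim G t - H t = prim G 0 - H 0"
    by (rule dd_zero_const[where f="\<lambda>t. prim G t - H t"]) (simp_all add: smooth_diff dd_diff prim[OF G] H)
  then show "prim G t = H t" using prim(3)[OF G] H(3) by simp
qed

lemma prim_add: "smooth F \<Longrightarrow> smooth G \<Longrightarrow> prim (\<lambda>t. F t + G t) = (\<lambda>t. prim F t + prim G t)"
  by (rule prim_unique) (simp_all add: smooth_add dd_add prim distrib_left)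

lemma prim_cmult: "smooth G \<Longrightarrow> prim (\<lambda>t. c * G t) = (\<lambda>t. c * prim G t)"
  by (rule prim_unique) (simp_all add: smooth_cmult dd_cmult prim mult.left_commute)

lemma prim_zero [simp]: "prim (\<lambda>t. 0) = (\<lambda>t. 0)"
  by (rule prim_unique) simp_all

section \<open>Cohomology of a mapping torus\<close>

text \<open>
  The differentials of smooth forms in a class \<open>S\<close>, such as the periodic or the invariant forms.  Only 0 is exact
  in degree 0.
\<close>

definition exact_in :: "(('e::euclidean_space \<Rightarrow> 'e multiform) \<Rightarrow> bool) \<Rightarrow> nat \<Rightarrow> ('e \<Rightarrow> 'e multiform) \<Rightarrow> bool" where
  "exact_in S q \<eta> \<longleftrightarrow> (if q = 0 then \<eta> = (\<lambda>x v. 0)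
     else \<exists>\<beta>. smooth_form (q - 1) \<beta> \<and> S \<beta> \<and> \<eta> = dext (q - 1) \<beta>)"

lemma exact_in_Suc: "exact_in S (Suc k) \<eta> \<longleftrightarrow> (\<exists>\<beta>. smooth_form k \<beta> \<and> S \<beta> \<and> \<eta> = dext k \<beta>)"
  and exact_in_0: "exact_in S 0 \<eta> \<longleftrightarrow> \<eta> = (\<lambda>x v. 0)"
  by (simp_all add: exact_in_def)

context mapping_torus
begin

text \<open>
  A form without component in the direction \<open>e\<close> sees only the projections of its arguments along \<open>e\<close> to
  the kernel of the height.
\<close>

lemma alternating_drop_e:
  assumes c: "alternating q c" and z: "contr q e c = (\<lambda>v. 0)"
  shows "c v = c (\<lambda>i. v i - ht (v i) *\<^sub>R e)"
proof -
  have ce: "c (v(i := e)) = 0" if "i < q" for i v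
  proof (cases "i = 0")
    case True
    have "v(i := e) = case_nat e (\<lambda>i. v (Suc i))" using True by (auto split: nat.split)
    then show ?thesis using fun_cong[OF z, of "\<lambda>i. v (Suc i)"] that by (simp add: contr_def)
  next
    case False
    let ?w = "\<lambda>n. (v(i := e)) (Transposition.transpose 0 i n)"
    have "?w = case_nat e (\<lambda>n. ?w (Suc n))" by (auto split: nat.split simp: fun_eq_iff)
    then have "c ?w = 0" using fun_cong[OF z, of "\<lambda>n. ?w (Suc n)"] that by (simp add: contr_def)
    then show ?thesis using alternating_transpose[OF c _ that, of 0 "v(i := e)"] that False by simp
  qed
  have "c (\<lambda>i. if i < j then v i - ht (v i) *\<^sub>R e else v i) = c v" if "j \<le> q" for j
    using that
  proof (induction j)
    case 0
    then show ?case by simp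
  next
    case (Suc j)
    let ?v = "\<lambda>i. if i < j then v i - ht (v i) *\<^sub>R e else v i"
    have 1: "(\<lambda>i. if i < Suc j then v i - ht (v i) *\<^sub>R e else v i) = ?v(j := v j - ht (v j) *\<^sub>R e)"
      by (auto simp: fun_eq_iff less_Suc_eq)
    have 2: "?v(j := v j) = ?v" by auto
    note lin = alternating_linear[OF c, of j ?v]
    show ?case
      unfolding 1 using linear_diff[OF lin, of "v j"] linear_scale[OF lin] ce[of j ?v] Suc 2 by simp
  qed
  from this[of q] have "c v = c (\<lambda>i. if i < q then v i - ht (v i) *\<^sub>R e else v i)" by simp
  also have "\<dots> = c (\<lambda>i. v i - ht (v i) *\<^sub>R e)" by (rule alternating_cong[OF c]) simp
  finally show ?thesis .
qed

lemma ht_kernel_in_span: "ht a = 0 \<Longrightarrow> a \<in> span \<Lambda>"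
proof -
  assume a: "ht a = 0"
  obtain r where r: "a - r *\<^sub>R e \<in> span \<Lambda>"
    using span_breakdown_eq[of a e \<Lambda>] span_periods by auto
  have "ht b = 0" if "b \<in> span \<Lambda>" for b
    using linear_eq_0_on_span[OF lin_ht, of \<Lambda> b] ht_periods that by blast
  from this[OF r] have "r = 0" using a by (simp add: linear_diff[OF lin_ht] linear_scale[OF lin_ht] ht_e)
  then show ?thesis using r by simp
qed

lemma finite_spanning_periods: "\<exists>B. finite B \<and> B \<subseteq> \<Lambda> \<and> span B = span \<Lambda>"
proof -
  obtain B where B: "B \<subseteq> \<Lambda>" "independent B" "\<Lambda> \<subseteq> span B"
    using maximal_independent_subset[of \<Lambda>] by blast
  have "B \<subseteq> span \<Lambda>" using B(1) span_superset[of \<Lambda>] by (rule subset_trans)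
  then have "span B = span \<Lambda>" unfolding span_eq using B(3) by (rule conjI)
  with B(1) independent_imp_finite[OF B(2)] show ?thesis by (intro exI[of _ B] conjI)
qed

text \<open>
  After averaging, a primitive of the constant form \<open>c\<close> is invariant under all translations in the
  fibre, so its differential vanishes on vectors tangent to the fibre; and \<open>c\<close> is determined by its values
  on these.
\<close>

lemma constant_form_not_exact:
  assumes c: "alternating q c" and z: "contr q e c = (\<lambda>v. 0)" and ex: "exact_in (periodic \<Lambda>) q (\<lambda>x. c)"
  shows "c = (\<lambda>v. 0)"
proof (cases q)
  case 0
  then show ?thesis using ex by (simp add: exact_in_0 fun_eq_iff)
next
  case (Suc k)
  obtain \<beta> where b: "smooth_form k \<beta>" "periodic \<Lambda> \<beta>" "dext k \<beta> = (\<lambda>x. c)"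
    using ex Suc by (auto simp: exact_in_Suc)
  obtain B where B: "finite B" "B \<subseteq> \<Lambda>" "span B = span \<Lambda>" using finite_spanning_periods by blast
  obtain \<gamma> where g: "smooth_form k \<gamma>" "dext k \<gamma> = (\<lambda>x. c)" "\<forall>b\<in>B. fdd b \<gamma> = (\<lambda>x v. 0)"
    using average_primitive[OF b(1,3,2) B(1,2)] by blast
  show ?thesis
  proof
    fix v
    have "c v = c (\<lambda>i. v i - ht (v i) *\<^sub>R e)" by (rule alternating_drop_e[OF c z])
    also have "\<dots> = dext k \<gamma> 0 (\<lambda>i. v i - ht (v i) *\<^sub>R e)" by (simp add: g(2))
    also have "\<dots> = 0"
    proof -
      have "v i - ht (v i) *\<^sub>R e \<in> span B" for i
        unfolding B(3) by (rule ht_kernel_in_span) (simp add: linear_diff[OF lin_ht] linear_scale[OF lin_ht] ht_e)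
      then have "fdd (v i - ht (v i) *\<^sub>R e) \<gamma> = (\<lambda>x v. 0)" for i
        using fdd_zero_span[OF g(1)] g(3) by blast
      then have "dd (v i - ht (v i) *\<^sub>R e) (\<lambda>y. \<gamma> y w) 0 = 0" for i w by (simp add: fdd_def[abs_def] fun_eq_iff)
      then show ?thesis by (simp add: dext_def)
    qed
    finally show "c v = 0" .
  qed
qed

text \<open>
  The cover by the periods is a cylinder over a torus, whose cohomology consists of the constant forms
  on the torus factor.  First \<open>\<alpha>\<close> is averaged along finitely many periods spanning the fibre direction; the result \<open>\<gamma>\<close>
  depends only on the height.  Then the component of \<open>\<gamma>\<close> in the direction \<open>e\<close> is integrated along the
  height and removed.
\<close>

lemma periodic_cohomology:
  assumes sf: "smooth_form q \<alpha>" and cl: "dext q \<alpha> = (\<lambda>x v. 0)" and p: "periodic \<Lambda> \<alpha>"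
  shows "\<exists>c \<eta>. alternating q c \<and> contr q e c = (\<lambda>v. 0) \<and> exact_in (periodic \<Lambda>) q \<eta> \<and> \<alpha> = (\<lambda>x v. c v + \<eta> x v)"
proof (cases q)
  case 0
  have "dd a (\<lambda>y. \<alpha> y v) x = 0" for a v x
    using fun_cong[OF fun_cong[OF cl, of x], of "case_nat a v"] 0 by (simp add: dext_def)
  then have "\<alpha> x v = \<alpha> 0 v" for x v
    using dd_zero_const[OF smooth_formD(2)[OF sf, of v]] by blast
  then have "\<alpha> = (\<lambda>x v. \<alpha> 0 v + 0)" by (intro ext) simp
  then show ?thesis
    using smooth_formD(1)[OF sf, of 0] 0
    by (intro exI[of _ "\<alpha> 0"] exI[of _ "\<lambda>x v. 0"]) (simp add: exact_in_0)
next
  case (Suc k)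
  obtain B where B: "finite B" "B \<subseteq> \<Lambda>" "span B = span \<Lambda>" using finite_spanning_periods by blast
  obtain \<beta>1 where b1: "smooth_form k \<beta>1" "periodic \<Lambda> \<beta>1"
    "\<forall>b\<in>B. fdd b (\<lambda>x v. \<alpha> x v + dext k \<beta>1 x v) = (\<lambda>x v. 0)"
    using kill_periodic_directions[OF sf[unfolded Suc] cl[unfolded Suc] p B(1,2)] by blast
  define \<gamma> where "\<gamma> = (\<lambda>x v. \<alpha> x v + dext k \<beta>1 x v)"
  have sg: "smooth_form (Suc k) \<gamma>" unfolding \<gamma>_def using sf Suc by (intro smooth_form_add smooth_form_dext b1) simp
  have cg: "dext (Suc k) \<gamma> = (\<lambda>x v. 0)"
    using dext_add[OF sf[unfolded Suc] smooth_form_dext[OF b1(1)], of "Suc k"] dext_dext[OF b1(1)] cl Suc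
    by (simp add: fun_eq_iff \<gamma>_def)
  have g0: "fdd a \<gamma> = (\<lambda>x v. 0)" if "ht a = 0" for a
    using fdd_zero_span[OF sg, of B a] b1(3) B(3) ht_kernel_in_span[OF that] by (simp add: \<gamma>_def)
  have gx: "\<gamma> (ht x *\<^sub>R e) = \<gamma> x" for x
  proof -
    have "ht (x - ht x *\<^sub>R e) = 0" by (simp add: linear_diff[OF lin_ht] linear_scale[OF lin_ht] ht_e)
    from fdd_zero_translate[OF sg g0[OF this], of "ht x *\<^sub>R e"] show ?thesis by simp
  qed
  define G where "G v t = \<gamma> (t *\<^sub>R e) (case_nat e v)" for v t
  have lin_e: "linear (\<lambda>t. t *\<^sub>R e)" by (intro linearI) (simp_all add: scaleR_add_left)
  have sG: "smooth (G v)" for v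
    using smooth_affine[OF smooth_formD(2)[OF sg, of "case_nat e v"] lin_e, of 0] by (simp add: G_def[abs_def])
  \<comment> \<open>the integral of the e-component of \<gamma> along the height\<close>
  define \<beta> where "\<beta> x v = prim (G v) (ht x)" for x v
  have altG: "alternating k (\<lambda>v. G v t)" for t
    unfolding G_def using alternating_contr_Suc[OF smooth_formD(1)[OF sg]] .
  have sb: "smooth_form k \<beta>"
    unfolding smooth_form_def
  proof (intro conjI allI)
    show "smooth (\<lambda>x. \<beta> x v)" for v
      using smooth_affine[OF prim(1)[OF sG[of v]] lin_ht, of 0] by (simp add: \<beta>_def)
    fix x
    show "alternating k (\<beta> x)"
      unfolding alternating_def
    proof (intro conjI allI impI)
      fix v w :: "nat \<Rightarrow> 'e" assume "\<forall>i<k. v i = w i"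
      then have "G v = G w" using alternating_cong[OF altG] by blast
      then show "\<beta> x v = \<beta> x w" by (simp add: \<beta>_def)
    next
      fix v i assume "i < k"
      note lin = alternating_linear[OF altG \<open>i < k\<close>]
      have "G (v(i := a + b)) = (\<lambda>t. G (v(i := a)) t + G (v(i := b)) t)" for a b
        using linear_add[OF lin] by (intro ext) blast
      moreover have "G (v(i := r *\<^sub>R a)) = (\<lambda>t. r * G (v(i := a)) t)" for r a
        using linear_scale[OF lin] by (intro ext) simp
      ultimately show "linear (\<lambda>a. \<beta> x (v(i := a)))"
        by (intro linearI) (simp_all add: \<beta>_def prim_add prim_cmult sG)
    next
      fix v :: "nat \<Rightarrow> 'e" and i j assume "i < j \<and> j < k \<and> v i = v j"
      then have "G v = (\<lambda>t. 0)" using alternating_repeat[OF altG, of i j v] by auto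
      then show "\<beta> x v = 0" by (simp add: \<beta>_def)
    qed
  qed
  have pb: "periodic \<Lambda> \<beta>"
    using ht_periods by (simp add: periodic_def fun_eq_iff \<beta>_def linear_add[OF lin_ht])
  have fb: "fdd a \<beta> x v = ht a * contr (Suc k) e (\<gamma> x) v" for a x v
  proof -
    have "fdd a \<beta> x v = dd (ht a) (prim (G v)) (ht x)"
      using dd_affine[OF prim(1)[OF sG[of v]] lin_ht, of a 0 x] by (simp add: fdd_def \<beta>_def)
    then show ?thesis by (simp add: prim(2)[OF sG] G_def gx)
  qed
  \<comment> \<open>what remains is constant: by Cartan's formula its derivative in the direction e vanishes too\<close>
  define c where "c = (\<lambda>x v. \<gamma> x v - dext k \<beta> x v)"
  have sc: "smooth_form (Suc k) c" unfolding c_def by (intro smooth_form_diff sg smooth_form_dext sb)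
  have "fdd a c x v = 0" for a x v
  proof -
    have ci: "dext k (\<lambda>y. contr (Suc k) e (\<gamma> y)) = fdd e \<gamma>"
      using closed_fdd_contr[OF cg, of e] by simp
    have "fdd a c x v = fdd a \<gamma> x v - dext k (fdd a \<beta>) x v"
      unfolding c_def by (simp only: fdd_diff[OF sg smooth_form_dext[OF sb]] fdd_dext[OF sb])
    also have "fdd a \<beta> = (\<lambda>x v. ht a * contr (Suc k) e (\<gamma> x) v)" using fb by (intro ext)
    also have "dext k \<dots> x v = ht a * fdd e \<gamma> x v"
      using dext_cmult[OF smooth_form_contr[OF sg, of e], of k "ht a" x v] by (simp only: ci diff_Suc_1)
    also have "fdd a \<gamma> x v - ht a * fdd e \<gamma> x v = fdd (a - ht a *\<^sub>R e) \<gamma> x v"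
      using linear_diff[OF linear_fdd[OF sg, of x v], of a] linear_scale[OF linear_fdd[OF sg, of x v]] by simp
    also have "\<dots> = 0"
      using g0[of "a - ht a *\<^sub>R e"] by (simp add: linear_diff[OF lin_ht] linear_scale[OF lin_ht] ht_e)
    finally show ?thesis .
  qed
  then have "c x v = c 0 v" for x v
    using dd_zero_const[OF smooth_formD(2)[OF sc, of v], of x 0] by (simp add: fdd_def)
  then have c0: "\<gamma> x v = c 0 v + dext k \<beta> x v" for x v
    unfolding c_def by (metis (no_types) diff_add_cancel)
  have contr_c: "contr (Suc k) e (c 0) = (\<lambda>v. 0)"
  proof
    fix v
    have "(\<lambda>y. contr k e (\<beta> y)) = (\<lambda>y v. 0)"
    proof (intro ext)
      fix y v
      show "contr k e (\<beta> y) v = 0"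
      proof (cases k)
        case (Suc j)
        have "G (case_nat e v) = (\<lambda>t. 0)"
          unfolding G_def using alternating_repeat[OF smooth_formD(1)[OF sg], of 0 1] Suc by auto
        then show ?thesis using Suc by (simp add: \<beta>_def)
      qed simp
    qed
    then have "contr (Suc k) e (dext k \<beta> 0) v = fdd e \<beta> 0 v" using contr_dext[of k e \<beta> 0 v] by simp
    also have "\<dots> = contr (Suc k) e (\<gamma> 0) v" by (simp add: fb ht_e)
    finally show "contr (Suc k) e (c 0) v = 0" by (simp add: c_def)
  qed
  have "\<alpha> = (\<lambda>x v. c 0 v + dext k (\<lambda>x v. \<beta> x v - \<beta>1 x v) x v)"
  proof (intro ext)
    fix x v
    have "\<alpha> x v = \<gamma> x v - dext k \<beta>1 x v" by (simp add: \<gamma>_def)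
    then show "\<alpha> x v = c 0 v + dext k (\<lambda>x v. \<beta> x v - \<beta>1 x v) x v"
      by (simp add: dext_diff[OF sb b1(1)] c0)
  qed
  moreover have "exact_in (periodic \<Lambda>) q (dext k (\<lambda>x v. \<beta> x v - \<beta>1 x v))"
    unfolding Suc exact_in_Suc using sb b1 pb by (blast intro: smooth_form_diff periodic_diff)
  ultimately show ?thesis
    using smooth_formD(1)[OF sc, of 0] contr_c Suc by blast
qed

definition invariant :: "('e \<Rightarrow> 'e multiform) \<Rightarrow> bool" where
  "invariant \<alpha> \<longleftrightarrow> periodic \<Lambda> \<alpha> \<and> pull \<alpha> = \<alpha>"

text \<open>
  The constant forms that descend to the mapping torus.
\<close>

definition harmonic :: "nat \<Rightarrow> 'e multiform \<Rightarrow> bool" where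
  "harmonic q c \<longleftrightarrow> alternating q c \<and> (\<forall>v. c (\<lambda>i. L (v i)) = c v)"

lemma harmonic_add: "harmonic q c \<Longrightarrow> harmonic q d \<Longrightarrow> harmonic q (\<lambda>v. c v + d v)"
  and harmonic_diff: "harmonic q c \<Longrightarrow> harmonic q d \<Longrightarrow> harmonic q (\<lambda>v. c v - d v)"
  by (auto simp: harmonic_def alternating_add alternating_diff)

lemma harmonic_zero [simp]: "harmonic q (\<lambda>v. 0)"
  by (simp add: harmonic_def)

text \<open>
  The product of the height with a constant form; its differential is the constant form \<open>d(ht) \<and> c\<close>.
  In degree \<open>Suc k\<close> such forms account for the classes coming from the base circle.
\<close>

lemma ht_form:
  assumes c: "alternating k c"
  shows "smooth_form k (\<lambda>x v. ht x * c v)" "periodic \<Lambda> (\<lambda>x v. ht x * c v)"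
    "fdd a (\<lambda>x v. ht x * c v) = (\<lambda>x v. ht a * c v)"
    "dext k (\<lambda>x v. ht x * c v) = (\<lambda>x. dext k (\<lambda>x v. ht x * c v) 0)"
proof -
  show "smooth_form k (\<lambda>x v. ht x * c v)"
    by (rule smooth_form_mult[OF smooth_ht smooth_form_const[OF c]])
  show "periodic \<Lambda> (\<lambda>x v. ht x * c v)"
    using ht_periods by (simp add: periodic_def linear_add[OF lin_ht])
  have d: "dd a (\<lambda>x. ht x * r) x = ht a * r" for a r x
    using dd_cmult[OF smooth_ht, of a r x] dd_linear[OF lin_ht, of a x] by (simp add: mult.commute)
  show "fdd a (\<lambda>x v. ht x * c v) = (\<lambda>x v. ht a * c v)" by (simp add: fdd_def d fun_eq_iff)
  show "dext k (\<lambda>x v. ht x * c v) = (\<lambda>x. dext k (\<lambda>x v. ht x * c v) 0)"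
    by (simp add: dext_def d fun_eq_iff)
qed

lemma pull_ht_form:
  assumes c: "harmonic k c"
  shows "pull (\<lambda>x v. ht x * c v) = (\<lambda>x v. ht x * c v + c v)"
  using c by (simp add: affine_pull_def[abs_def] harmonic_def linear_add[OF lin_ht] ht_L ht_e algebra_simps)

lemma harmonic_dext_ht:
  assumes c: "harmonic k c"
  shows "harmonic (Suc k) (dext k (\<lambda>x v. ht x * c v) 0)"
proof -
  let ?h = "\<lambda>x v. ht x * c v"
  have a: "alternating k c" using c by (simp add: harmonic_def)
  note h = ht_form[OF a]
  have "pull (dext k ?h) = dext k (\<lambda>x v. ht x * c v + c v)"
    using dext_affine_pull[OF linL h(1), of e] by (simp add: pull_ht_form[OF c])
  also have "\<dots> = dext k ?h"
    using dext_add[OF h(1) smooth_form_const[OF a], of k] by (simp add: fun_eq_iff)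
  finally have "pull (dext k ?h) x v = dext k ?h x v" for x v by simp
  then have "dext k ?h (L x + e) (\<lambda>i. L (v i)) = dext k ?h x v" for x v by (simp add: affine_pull_def)
  then have "dext k ?h 0 (\<lambda>i. L (v i)) = dext k ?h 0 v" for v using h(4) by metis
  then show ?thesis using alternating_dext[OF h(1)] by (simp add: harmonic_def)
qed

lemma pull_const: "pull (\<lambda>x. c) = (\<lambda>x v. c (\<lambda>i. L (v i)))"
  by (simp add: affine_pull_def[abs_def])

lemma contr_pull_const:
  assumes "contr q e c = (\<lambda>v. 0)"
  shows "contr q e (\<lambda>v. c (\<lambda>i. L (v i))) = (\<lambda>v. 0)"
proof
  fix v
  have "(\<lambda>i. L (case_nat e v i)) = case_nat e (\<lambda>i. L (v i))" using Le by (auto split: nat.split)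
  then show "contr q e (\<lambda>v. c (\<lambda>i. L (v i))) v = 0"
    using fun_cong[OF assms, of "\<lambda>i. L (v i)"] by (cases q) auto
qed

text \<open>
  Write \<open>\<alpha> = c + dext \<beta>\<close> with \<open>\<beta>\<close> periodic.  As \<open>\<alpha>\<close> is invariant, \<open>c\<close> minus its pullback is exact, hence
  0, and \<open>\<gamma> = pull \<beta> - \<beta>\<close> is closed.  So \<open>\<gamma>\<close> is a constant form \<open>c'\<close> plus an exact form \<open>\<zeta>\<close>.  The exact
  form is \<open>pull \<theta> - \<theta>\<close> for a closed \<open>\<theta>\<close>, and the constant form is \<open>c0 + (pull h - h)\<close> with \<open>c0\<close>
  invariant; all these terms are absorbed by changing \<open>\<beta>\<close>, except \<open>c0\<close>.  That one is the defect
  \<open>pull - 1\<close> of \<open>ht * c0\<close>, whose differential is harmonic.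
\<close>

theorem invariant_cohomology:
  assumes sf: "smooth_form q \<alpha>" and cl: "dext q \<alpha> = (\<lambda>x v. 0)" and inv: "invariant \<alpha>"
  shows "\<exists>c \<eta>. harmonic q c \<and> exact_in invariant q \<eta> \<and> \<alpha> = (\<lambda>x v. c v + \<eta> x v)"
proof -
  have p: "periodic \<Lambda> \<alpha>" and pa: "pull \<alpha> = \<alpha>" using inv by (auto simp: invariant_def)
  obtain c \<eta> where c: "alternating q c" "contr q e c = (\<lambda>v. 0)" and \<eta>: "exact_in (periodic \<Lambda>) q \<eta>"
    and \<alpha>: "\<alpha> = (\<lambda>x v. c v + \<eta> x v)"
    using periodic_cohomology[OF sf cl p] by blast
  let ?Lc = "\<lambda>v. c (\<lambda>i. L (v i))"
  have pe: "?Lc v + pull \<eta> x v = c v + \<eta> x v" for x v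
    using fun_cong[OF fun_cong[OF pa, of x], of v] unfolding \<alpha> by (simp add: affine_pull_def)
  show ?thesis
  proof (cases q)
    case 0
    then have e0: "\<eta> = (\<lambda>x v. 0)" using \<eta> by (simp add: exact_in_0)
    then have "?Lc v = c v" for v using pe[of v] by (simp add: affine_pull_def)
    then show ?thesis using c \<alpha> e0 0 by (intro exI[of _ c] exI[of _ \<eta>]) (simp add: harmonic_def exact_in_0)
  next
    case (Suc k)
    obtain \<beta> where b: "smooth_form k \<beta>" "periodic \<Lambda> \<beta>" "\<eta> = dext k \<beta>" using \<eta> Suc by (auto simp: exact_in_Suc)
    have spb: "smooth_form k (pull \<beta>)" and ppb: "periodic \<Lambda> (pull \<beta>)"
      using smooth_form_affine_pull[OF linL b(1)] periodic_affine_pull[OF b(2) linL L_periods] by blast+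
    have pe': "?Lc v - c v = dext k (\<lambda>x v. \<beta> x v - pull \<beta> x v) x v" for x v
    proof -
      have "?Lc v - c v = \<eta> x v - pull \<eta> x v" using pe[of v x] by linarith
      then show ?thesis by (simp only: dext_diff[OF b(1) spb] dext_affine_pull[OF linL b(1)] b(3))
    qed
    have "(\<lambda>v. ?Lc v - c v) = (\<lambda>v. 0)"
    proof (rule constant_form_not_exact)
      show "alternating q (\<lambda>v. ?Lc v - c v)" by (rule alternating_diff[OF alternating_pull[OF c(1) linL] c(1)])
      show "contr q e (\<lambda>v. ?Lc v - c v) = (\<lambda>v. 0)"
        using contr_pull_const[OF c(2)] c(2) unfolding Suc by (simp add: fun_eq_iff)
      show "exact_in (periodic \<Lambda>) q (\<lambda>x v. ?Lc v - c v)"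
        unfolding Suc exact_in_Suc
      proof (intro exI conjI)
        show "(\<lambda>x v. ?Lc v - c v) = dext k (\<lambda>x v. \<beta> x v - pull \<beta> x v)" by (intro ext) (rule pe')
      qed (rule smooth_form_diff[OF b(1) spb] periodic_diff[OF b(2) ppb])+
    qed
    then have Lc: "?Lc v = c v" for v by (simp add: fun_eq_iff)
    have hc: "harmonic q c" using c(1) Lc by (simp add: harmonic_def)
    define \<gamma> where "\<gamma> = (\<lambda>x v. pull \<beta> x v - \<beta> x v)"
    have sg: "smooth_form k \<gamma>" and pg: "periodic \<Lambda> \<gamma>"
      unfolding \<gamma>_def by (intro smooth_form_diff periodic_diff b spb ppb)+
    have "dext k \<gamma> x v = 0" for x v
      using pe'[of v x] Lc unfolding \<gamma>_def by (simp add: dext_diff[OF b(1) spb] dext_diff[OF spb b(1)])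
    then have cg: "dext k \<gamma> = (\<lambda>x v. 0)" by (intro ext)
    obtain c' \<zeta> where c': "alternating k c'" and \<zeta>: "exact_in (periodic \<Lambda>) k \<zeta>" and \<gamma>: "\<gamma> = (\<lambda>x v. c' v + \<zeta> x v)"
      using periodic_cohomology[OF sg cg pg] by blast
    obtain c0 h where c0: "alternating k c0" "\<And>v. c0 (\<lambda>i. L (v i)) = c0 v" and h: "alternating k h"
      and c'_eq: "\<And>v. c' v = c0 v + (h (\<lambda>i. L (v i)) - h v)"
      using diagonal_weight_split[OF linL L_Basis s_nz c', of 1] by auto
    have hc0: "harmonic k c0" using c0 by (simp add: harmonic_def)
    obtain \<theta> where \<theta>: "smooth_form k \<theta>" "periodic \<Lambda> \<theta>" "dext k \<theta> = (\<lambda>x v. 0)" "\<zeta> = (\<lambda>x v. pull \<theta> x v - \<theta> x v)"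
    proof (cases k)
      case 0
      then show thesis using \<zeta> that[of "\<lambda>x v. 0"] by (simp add: exact_in_0 affine_pull_def[abs_def])
    next
      case (Suc j)
      obtain \<delta> where d: "smooth_form j \<delta>" "periodic \<Lambda> \<delta>" "\<zeta> = dext j \<delta>" using \<zeta> Suc by (auto simp: exact_in_Suc)
      obtain \<epsilon> where ep: "smooth_form j \<epsilon>" "periodic \<Lambda> \<epsilon>" "\<delta> = (\<lambda>x v. pull \<epsilon> x v - \<epsilon> x v)"
        using cohomological_equation[OF d(1,2)] by blast
      have "\<zeta> = (\<lambda>x v. pull (dext j \<epsilon>) x v - dext j \<epsilon> x v)"
        unfolding d(3) ep(3)
        by (intro ext) (simp add: dext_diff[OF smooth_form_affine_pull[OF linL ep(1)] ep(1)] dext_affine_pull[OF linL ep(1)])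
      then show thesis
        using that[of "dext j \<epsilon>"] Suc smooth_form_dext[OF ep(1)] periodic_dext[OF ep(2,1)] dext_dext[OF ep(1)] by simp
    qed
    let ?h = "\<lambda>x v. ht x * c0 v"
    note hf = ht_form[OF c0(1)]
    \<comment> \<open>the corrected primitive, which is invariant\<close>
    define \<beta>' where "\<beta>' = (\<lambda>x v. \<beta> x v - h v - \<theta> x v - ht x * c0 v)"
    have s1: "smooth_form k (\<lambda>x v. \<beta> x v - h v)" by (intro smooth_form_diff b smooth_form_const h)
    have s2: "smooth_form k (\<lambda>x v. \<beta> x v - h v - \<theta> x v)" by (intro smooth_form_diff s1 \<theta>)
    have sb': "smooth_form k \<beta>'" unfolding \<beta>'_def by (intro smooth_form_diff s2 hf)
    have pb': "periodic \<Lambda> \<beta>'" unfolding \<beta>'_def by (intro periodic_diff b \<theta> hf periodic_const)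
    have "pull \<beta>' x v - \<beta>' x v = 0" for x v
    proof -
      have "pull \<beta>' x v = pull \<beta> x v - h (\<lambda>i. L (v i)) - pull \<theta> x v - (ht x * c0 v + c0 v)"
        using fun_cong[OF fun_cong[OF pull_ht_form[OF hc0], of x], of v] by (simp add: \<beta>'_def affine_pull_def)
      moreover have "pull \<beta> x v - \<beta> x v = c' v + \<zeta> x v" using \<gamma> by (simp add: \<gamma>_def fun_eq_iff)
      ultimately show ?thesis using c'_eq[of v] by (simp add: \<theta>(4) \<beta>'_def)
    qed
    then have ib': "invariant \<beta>'" using pb' by (simp add: invariant_def fun_eq_iff)
    have db': "dext k \<beta>' x v = dext k \<beta> x v - dext k ?h 0 v" for x v
    proof -
      have "dext k \<beta>' x v = dext k \<beta> x v - dext k (\<lambda>x. h) x v - dext k \<theta> x v - dext k ?h x v"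
        unfolding \<beta>'_def by (simp only: dext_diff[OF s2 hf(1)] dext_diff[OF s1 \<theta>(1)] dext_diff[OF b(1) smooth_form_const[OF h]])
      then show ?thesis using fun_cong[OF hf(4), of x] \<theta>(3) by simp
    qed
    have "\<alpha> = (\<lambda>x v. (c v + dext k ?h 0 v) + dext k \<beta>' x v)"
      unfolding \<alpha> b(3) by (simp add: db')
    moreover have "harmonic q (\<lambda>v. c v + dext k ?h 0 v)"
      using hc harmonic_dext_ht[OF hc0] Suc by (intro harmonic_add) auto
    moreover have "exact_in invariant q (dext k \<beta>')" unfolding Suc exact_in_Suc using sb' ib' by blast
    ultimately show ?thesis by blast
  qed
qed

text \<open>
  Let \<open>\<beta>\<close> be an invariant primitive of \<open>c\<close> and \<open>c'\<close> the contraction of \<open>c\<close> with \<open>e\<close>.  Comparing with the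
  primitive \<open>ht * c'\<close> shows \<open>c = dext (ht * c')\<close>, as nonzero constant forms on the fibre have no
  periodic primitive.
  Then \<open>\<beta> - ht * c'\<close> is closed and its pullback is itself minus \<open>c'\<close>, so \<open>c'\<close> is of the form
  \<open>c'' - pull c''\<close>.  It is also fixed by \<open>pull\<close>, hence it is 0.
\<close>

theorem harmonic_not_exact:
  assumes hc: "harmonic q c" and ex: "exact_in invariant q (\<lambda>x. c)"
  shows "c = (\<lambda>v. 0)"
proof (cases q)
  case 0
  then show ?thesis using ex by (simp add: exact_in_0 fun_eq_iff)
next
  case (Suc k)
  have c: "alternating (Suc k) c" and Lc: "\<And>v. c (\<lambda>i. L (v i)) = c v" using hc Suc by (auto simp: harmonic_def)
  obtain \<beta> where b: "smooth_form k \<beta>" "periodic \<Lambda> \<beta>" "pull \<beta> = \<beta>" "dext k \<beta> = (\<lambda>x. c)"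
    using ex Suc by (auto simp: exact_in_Suc invariant_def)
  define c' where "c' = contr (Suc k) e c"
  have c': "alternating k c'" unfolding c'_def using alternating_contr[OF c, of e] by simp
  have Lc': "c' (\<lambda>i. L (v i)) = c' v" for v
  proof -
    have "(\<lambda>i. L (case_nat e v i)) = case_nat e (\<lambda>i. L (v i))" using Le by (auto split: nat.split)
    then show ?thesis using Lc[of "case_nat e v"] by (simp add: c'_def)
  qed
  have ec': "contr k e c' = (\<lambda>v. 0)" unfolding c'_def using contr_contr_same[OF c, of e] by auto
  have hc': "harmonic k c'" using c' Lc' by (simp add: harmonic_def)
  let ?h = "\<lambda>x v. ht x * c' v"
  note hf = ht_form[OF c']
  define \<gamma> where "\<gamma> = (\<lambda>x v. \<beta> x v - ht x * c' v)"
  have sg: "smooth_form k \<gamma>" and pg: "periodic \<Lambda> \<gamma>"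
    unfolding \<gamma>_def by (intro smooth_form_diff periodic_diff b hf)+
  have dg: "dext k \<gamma> = (\<lambda>x v. c v - dext k ?h 0 v)"
  proof (intro ext)
    fix x v
    have "dext k \<gamma> x v = dext k \<beta> x v - dext k ?h x v"
      unfolding \<gamma>_def by (rule dext_diff[OF b(1) hf(1)])
    also have "dext k ?h x v = dext k ?h 0 v" by (rule fun_cong[OF fun_cong[OF hf(4)]])
    finally show "dext k \<gamma> x v = c v - dext k ?h 0 v" by (simp only: b(4))
  qed
  have "(\<lambda>v. c v - dext k ?h 0 v) = (\<lambda>v. 0)"
  proof (rule constant_form_not_exact)
    show "alternating (Suc k) (\<lambda>v. c v - dext k ?h 0 v)" by (intro alternating_diff c alternating_dext hf)
    have "contr (Suc k) e (dext k ?h 0) v = c' v" for v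
    proof -
      have "(\<lambda>y. contr k e (\<lambda>v. ht y * c' v)) = (\<lambda>y v. 0)"
        using ec' by (cases k) (auto simp: fun_eq_iff)
      then show ?thesis using contr_dext[of k e ?h 0 v] by (simp add: hf(3) ht_e)
    qed
    then show "contr (Suc k) e (\<lambda>v. c v - dext k ?h 0 v) = (\<lambda>v. 0)"
      by (simp add: c'_def fun_eq_iff)
    show "exact_in (periodic \<Lambda>) (Suc k) (\<lambda>x v. c v - dext k ?h 0 v)"
      unfolding exact_in_Suc using sg pg dg by (intro exI[of _ \<gamma>]) simp
  qed
  then have ch: "c v = dext k ?h 0 v" for v by (simp add: fun_eq_iff)
  then have "dext k \<gamma> = (\<lambda>x v. 0)" by (simp add: dg)
  from periodic_cohomology[OF sg this pg]
  obtain c'' \<eta> where c'': "alternating k c''" "contr k e c'' = (\<lambda>v. 0)" and \<eta>: "exact_in (periodic \<Lambda>) k \<eta>"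
    and \<gamma>: "\<gamma> = (\<lambda>x v. c'' v + \<eta> x v)" by blast
  let ?d = "\<lambda>v. c' v + (c'' (\<lambda>i. L (v i)) - c'' v)"
  have de: "?d v = \<eta> x v - pull \<eta> x v" for x v
  proof -
    have "pull \<gamma> x v = pull \<beta> x v - (ht x * c' v + c' v)"
      using fun_cong[OF fun_cong[OF pull_ht_form[OF hc'], of x], of v] by (simp add: \<gamma>_def affine_pull_def)
    then have "pull \<gamma> x v = \<gamma> x v - c' v" by (simp add: b(3) \<gamma>_def)
    moreover have "pull \<gamma> x v = c'' (\<lambda>i. L (v i)) + pull \<eta> x v" unfolding \<gamma> by (simp add: affine_pull_def)
    moreover have "\<gamma> x v = c'' v + \<eta> x v" using \<gamma> by simp
    ultimately show ?thesis by simp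
  qed
  have "?d = (\<lambda>v. 0)"
  proof (rule constant_form_not_exact)
    show "alternating k ?d" by (rule alternating_add[OF c' alternating_diff[OF alternating_pull[OF c''(1) linL] c''(1)]])
    show "contr k e ?d = (\<lambda>v. 0)"
      using contr_pull_const[OF c''(2)] c''(2) ec' by (cases k) (auto simp: fun_eq_iff)
    show "exact_in (periodic \<Lambda>) k (\<lambda>x. ?d)"
    proof (cases k)
      case 0
      then have "\<eta> = (\<lambda>x v. 0)" using \<eta> by (simp add: exact_in_0)
      then show ?thesis using de 0 by (simp add: exact_in_0 affine_pull_def)
    next
      case (Suc j)
      obtain \<delta> where d: "smooth_form j \<delta>" "periodic \<Lambda> \<delta>" "\<eta> = dext j \<delta>" using \<eta> Suc by (auto simp: exact_in_Suc)
      have sp: "smooth_form j (pull \<delta>)" and pp: "periodic \<Lambda> (pull \<delta>)"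
        using smooth_form_affine_pull[OF linL d(1)] periodic_affine_pull[OF d(2) linL L_periods] by blast+
      have eq: "?d v = dext j (\<lambda>x v. \<delta> x v - pull \<delta> x v) x v" for x v
        by (simp only: de[of v x] d(3) dext_diff[OF d(1) sp] dext_affine_pull[OF linL d(1)])
      show ?thesis
        unfolding Suc exact_in_Suc
      proof (intro exI conjI)
        show "(\<lambda>x. ?d) = dext j (\<lambda>x v. \<delta> x v - pull \<delta> x v)" by (intro ext) (rule eq)
      qed (rule smooth_form_diff[OF d(1) sp] periodic_diff[OF d(2) pp])+
    qed
  qed
  then have "?d v = 0" for v by (rule fun_cong)
  then have d0: "c' v = c'' v - c'' (\<lambda>i. L (v i))" for v by (simp only: eq_diff_eq add_diff_eq right_minus_eq)
  \<comment> \<open>on a tuple of basis vectors, \<open>pull\<close> is the multiplication by a number p, so \<open>c' = (1 - p) c''\<close> and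
    \<open>(1 - p) c' = 0\<close>; this excludes a Jordan block\<close>
  have "c' = (\<lambda>v. 0)"
  proof (rule alternating_eq_on_Basis[OF c' alternating_zero])
    fix t :: "nat \<Rightarrow> 'e" assume t: "\<And>i. i < k \<Longrightarrow> t i \<in> Basis"
    have Lt: "f (\<lambda>i. L (t i)) = (\<Prod>i<k. s (t i)) * f t" if f: "alternating k f" for f
    proof -
      have "f (\<lambda>i. L (t i)) = f (\<lambda>i. s (t i) *\<^sub>R t i)"
        using t L_Basis by (intro alternating_cong[OF f]) auto
      then show ?thesis using alternating_scale_all[OF f] by simp
    qed
    have "c' t = (1 - (\<Prod>i<k. s (t i))) * c'' t" using d0[of t] Lt[OF c''(1)] by (simp add: algebra_simps)
    moreover have "(1 - (\<Prod>i<k. s (t i))) * c' t = 0" using Lc'[of t] Lt[OF c'] by (simp add: algebra_simps)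
    ultimately show "c' t = 0" by auto
  qed
  then show ?thesis using ch by (simp add: fun_eq_iff)
qed

end

section \<open>The Hard Lefschetz property of a mapping torus\<close>

definition fwedge :: "nat \<Rightarrow> nat \<Rightarrow> ('e \<Rightarrow> 'e multiform) \<Rightarrow> ('e \<Rightarrow> 'e multiform) \<Rightarrow> 'e::euclidean_space \<Rightarrow> 'e multiform" where
  "fwedge k l \<alpha> \<beta> = (\<lambda>x. alt_wedge k l (\<alpha> x) (\<beta> x))"

definition fpower :: "('e::euclidean_space \<Rightarrow> 'e multiform) \<Rightarrow> nat \<Rightarrow> 'e \<Rightarrow> 'e multiform" where
  "fpower \<eta> r = (\<lambda>x. alt_power (\<eta> x) r)"

lemma fpower_Suc: "fpower \<eta> (Suc r) = fwedge 2 (2 * r) \<eta> (fpower \<eta> r)"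
  and fpower_0: "fpower \<eta> 0 = (\<lambda>x v. 1)"
  by (simp_all add: fpower_def fwedge_def)

context mapping_torus
begin

definition closed_inv :: "nat \<Rightarrow> ('e \<Rightarrow> 'e multiform) \<Rightarrow> bool" where
  "closed_inv k \<alpha> \<longleftrightarrow> smooth_form k \<alpha> \<and> invariant \<alpha> \<and> dext k \<alpha> = (\<lambda>x v. 0)"

abbreviation exact_inv :: "nat \<Rightarrow> ('e \<Rightarrow> 'e multiform) \<Rightarrow> bool" where
  "exact_inv \<equiv> exact_in invariant"

lemma invariant_add: "invariant \<alpha> \<Longrightarrow> invariant \<beta> \<Longrightarrow> invariant (\<lambda>x v. \<alpha> x v + \<beta> x v)"
  and invariant_diff: "invariant \<alpha> \<Longrightarrow> invariant \<beta> \<Longrightarrow> invariant (\<lambda>x v. \<alpha> x v - \<beta> x v)"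
  by (auto simp: invariant_def pull_add pull_diff intro: periodic_add periodic_diff)

lemma invariant_cmult: "invariant \<alpha> \<Longrightarrow> invariant (\<lambda>x v. r * \<alpha> x v)"
  by (auto simp: invariant_def periodic_def affine_pull_def fun_eq_iff)

lemma invariant_zero: "invariant (\<lambda>x v. 0)"
  by (simp add: invariant_def affine_pull_def[abs_def])

lemma invariant_wedge: "invariant \<alpha> \<Longrightarrow> invariant \<beta> \<Longrightarrow> invariant (fwedge k l \<alpha> \<beta>)"
  by (auto simp: invariant_def fwedge_def affine_pull_wedge periodic_def)

lemma invariant_const: "harmonic k c \<Longrightarrow> invariant (\<lambda>x. c)"
  by (simp add: invariant_def harmonic_def pull_const fun_eq_iff)

lemma closed_inv_const: "harmonic k c \<Longrightarrow> closed_inv k (\<lambda>x. c)"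
  using invariant_const[of k c] by (simp add: closed_inv_def harmonic_def smooth_form_const)

lemma closed_inv_diff: "closed_inv k \<alpha> \<Longrightarrow> closed_inv k \<beta> \<Longrightarrow> closed_inv k (\<lambda>x v. \<alpha> x v - \<beta> x v)"
  unfolding closed_inv_def
  by (auto simp: smooth_form_diff invariant_diff fun_eq_iff dext_diff)

lemma closed_inv_wedge:
  assumes "closed_inv k \<alpha>" "closed_inv l \<beta>"
  shows "closed_inv (k + l) (fwedge k l \<alpha> \<beta>)"
proof -
  have a: "smooth_form k \<alpha>" "invariant \<alpha>" "dext k \<alpha> = (\<lambda>x v. 0)"
    and b: "smooth_form l \<beta>" "invariant \<beta>" "dext l \<beta> = (\<lambda>x v. 0)" using assms by (auto simp: closed_inv_def)
  have "dext (k + l) (fwedge k l \<alpha> \<beta>) = (\<lambda>x v. 0)"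
    unfolding fwedge_def by (rule ext) (simp add: dext_wedge[OF a(1) b(1)] a(3) b(3))
  then show ?thesis
    using smooth_form_wedge[OF a(1) b(1)] invariant_wedge[OF a(2) b(2), of k l] by (simp add: closed_inv_def fwedge_def)
qed

lemma exact_inv_zero [simp]: "exact_inv q (\<lambda>x v. 0)"
  unfolding exact_in_def
  by (auto simp: invariant_zero intro!: exI[of _ "\<lambda>x v. 0"])

lemma exact_inv_add: "exact_inv q \<alpha> \<Longrightarrow> exact_inv q \<beta> \<Longrightarrow> exact_inv q (\<lambda>x v. \<alpha> x v + \<beta> x v)"
proof (cases q)
  case (Suc k)
  assume "exact_inv q \<alpha>" "exact_inv q \<beta>"
  then obtain a b where ab: "smooth_form k a" "invariant a" "\<alpha> = dext k a" "smooth_form k b" "invariant b" "\<beta> = dext k b"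
    unfolding Suc exact_in_Suc by blast
  have "(\<lambda>x v. \<alpha> x v + \<beta> x v) = dext k (\<lambda>x v. a x v + b x v)"
    by (simp add: ab(3,6) fun_eq_iff dext_add[OF ab(1,4)])
  then show ?thesis
    unfolding Suc exact_in_Suc using smooth_form_add[OF ab(1,4)] invariant_add[OF ab(2,5)] by blast
qed (simp add: exact_in_0)

lemma exact_inv_cmult: "exact_inv q \<alpha> \<Longrightarrow> exact_inv q (\<lambda>x v. r * \<alpha> x v)"
proof (cases q)
  case (Suc k)
  assume "exact_inv q \<alpha>"
  then obtain a where a: "smooth_form k a" "invariant a" "\<alpha> = dext k a"
    unfolding Suc exact_in_Suc by blast
  have "(\<lambda>x v. r * \<alpha> x v) = dext k (\<lambda>x v. r * a x v)"
    by (simp add: a(3) fun_eq_iff dext_cmult[OF a(1)])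
  then show ?thesis
    unfolding Suc exact_in_Suc using smooth_form_cmult[OF a(1)] invariant_cmult[OF a(2)] by blast
qed (simp add: exact_in_0)

text \<open>
  The Leibniz rule: for closed \<open>\<alpha>\<close>, the form \<open>\<alpha> \<and> dext \<beta>\<close> is up to sign the differential of \<open>\<alpha> \<and> \<beta>\<close>.
\<close>

lemma exact_wedge_right:
  assumes a: "closed_inv k \<alpha>" and t: "exact_inv l \<theta>"
  shows "exact_inv (k + l) (fwedge k l \<alpha> \<theta>)"
proof (cases l)
  case 0
  then show ?thesis using t by (simp add: exact_in_0 fwedge_def)
next
  case (Suc j)
  obtain b where b: "smooth_form j b" "invariant b" "\<theta> = dext j b" using t unfolding Suc exact_in_Suc by blast
  have sa: "smooth_form k \<alpha>" and da: "dext k \<alpha> = (\<lambda>x v. 0)" and ia: "invariant \<alpha>" using a by (auto simp: closed_inv_def)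
  let ?w = "fwedge k j \<alpha> b"
  have sw: "smooth_form (k + j) ?w" unfolding fwedge_def by (rule smooth_form_wedge[OF sa b(1)])
  have sgn: "(- 1) ^ k * ((- 1) ^ k * y) = y" for y :: real
    by (simp add: mult.assoc[symmetric] power_mult_distrib[symmetric])
  have "dext (k + j) ?w x v = (- 1) ^ k * alt_wedge k (Suc j) (\<alpha> x) (dext j b x) v" for x v
    using fun_cong[OF dext_wedge[OF sa b(1), of x], of v] by (simp add: fwedge_def da)
  then have "fwedge k l \<alpha> \<theta> = (\<lambda>x v. (- 1) ^ k * dext (k + j) ?w x v)"
    by (simp add: fwedge_def Suc b(3) sgn fun_eq_iff)
  moreover have "exact_inv (k + l) (dext (k + j) ?w)"
    unfolding Suc add_Suc_right exact_in_Suc using sw invariant_wedge[OF ia b(2)] by blast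
  ultimately show ?thesis using exact_inv_cmult[of "k + l" "dext (k + j) ?w" "(- 1) ^ k"] by simp
qed

lemma exact_wedge_left:
  assumes a: "closed_inv k \<alpha>" and t: "exact_inv l \<theta>"
  shows "exact_inv (l + k) (fwedge l k \<theta> \<alpha>)"
proof (cases l)
  case 0
  then show ?thesis using t by (simp add: exact_in_0 fwedge_def)
next
  case (Suc j)
  obtain b where b: "smooth_form j b" "invariant b" "\<theta> = dext j b" using t unfolding Suc exact_in_Suc by blast
  have sa: "smooth_form k \<alpha>" and da: "dext k \<alpha> = (\<lambda>x v. 0)" and ia: "invariant \<alpha>" using a by (auto simp: closed_inv_def)
  let ?w = "fwedge j k b \<alpha>"
  have sw: "smooth_form (j + k) ?w" unfolding fwedge_def by (rule smooth_form_wedge[OF b(1) sa])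
  have "dext (j + k) ?w x v = alt_wedge (Suc j) k (dext j b x) (\<alpha> x) v" for x v
    using fun_cong[OF dext_wedge[OF b(1) sa, of x], of v] by (simp add: fwedge_def da)
  then have "fwedge l k \<theta> \<alpha> = dext (j + k) ?w"
    by (simp add: fwedge_def Suc b(3) fun_eq_iff)
  then show ?thesis
    unfolding Suc add_Suc exact_in_Suc using sw invariant_wedge[OF b(2) ia] by blast
qed

definition cohomologous_inv :: "nat \<Rightarrow> ('e \<Rightarrow> 'e multiform) \<Rightarrow> ('e \<Rightarrow> 'e multiform) \<Rightarrow> bool" where
  "cohomologous_inv q \<alpha> \<beta> \<longleftrightarrow> exact_inv q (\<lambda>x v. \<alpha> x v - \<beta> x v)"

lemma cohomologous_wedge:
  assumes a: "closed_inv k \<alpha>" "closed_inv k \<alpha>'" "cohomologous_inv k \<alpha> \<alpha>'"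
    and b: "closed_inv l \<beta>" "closed_inv l \<beta>'" "cohomologous_inv l \<beta> \<beta>'"
  shows "cohomologous_inv (k + l) (fwedge k l \<alpha> \<beta>) (fwedge k l \<alpha>' \<beta>')"
proof -
  have "(\<lambda>x v. fwedge k l \<alpha> \<beta> x v - fwedge k l \<alpha>' \<beta>' x v) =
      (\<lambda>x v. fwedge k l (\<lambda>x v. \<alpha> x v - \<alpha>' x v) \<beta> x v + fwedge k l \<alpha>' (\<lambda>x v. \<beta> x v - \<beta>' x v) x v)"
    by (simp add: fwedge_def alt_wedge_diff_left alt_wedge_diff_right)
  then show ?thesis
    unfolding cohomologous_inv_def
    using exact_inv_add[OF exact_wedge_left[OF b(1) a(3)[unfolded cohomologous_inv_def]]
        exact_wedge_right[OF a(2) b(3)[unfolded cohomologous_inv_def]]] by simp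
qed

lemma cohomologous_refl: "cohomologous_inv q \<alpha> \<alpha>"
  by (simp add: cohomologous_inv_def)

lemma harmonic_representative:
  assumes "closed_inv q \<alpha>"
  shows "\<exists>c. harmonic q c \<and> cohomologous_inv q \<alpha> (\<lambda>x. c)"
proof -
  obtain c \<eta> where "harmonic q c" "exact_inv q \<eta>" "\<alpha> = (\<lambda>x v. c v + \<eta> x v)"
    using invariant_cohomology[of q \<alpha>] assms by (auto simp: closed_inv_def)
  then show ?thesis by (intro exI[of _ c]) (simp add: cohomologous_inv_def)
qed

lemma cohomologous_harmonic_eq:
  assumes "harmonic q c" "harmonic q c'" "cohomologous_inv q (\<lambda>x. c) (\<lambda>x. c')"
  shows "c = c'"
proof -
  have "(\<lambda>v. c v - c' v) = (\<lambda>v. 0)"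
    using harmonic_not_exact[OF harmonic_diff[OF assms(1,2)]] assms(3) by (simp add: cohomologous_inv_def)
  then show ?thesis by (simp add: fun_eq_iff)
qed

lemma cohomologous_trans: "cohomologous_inv q \<alpha> \<beta> \<Longrightarrow> cohomologous_inv q \<beta> \<gamma> \<Longrightarrow> cohomologous_inv q \<alpha> \<gamma>"
  unfolding cohomologous_inv_def using exact_inv_add[of q "\<lambda>x v. \<alpha> x v - \<beta> x v" "\<lambda>x v. \<beta> x v - \<gamma> x v"] by simp

lemma cohomologous_sym: "cohomologous_inv q \<alpha> \<beta> \<Longrightarrow> cohomologous_inv q \<beta> \<alpha>"
  unfolding cohomologous_inv_def using exact_inv_cmult[of q "\<lambda>x v. \<alpha> x v - \<beta> x v" "-1"] by simp

lemma harmonic_wedge: "harmonic k c \<Longrightarrow> harmonic l d \<Longrightarrow> harmonic (k + l) (alt_wedge k l c d)"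
proof -
  assume h: "harmonic k c" "harmonic l d"
  then have "(\<lambda>v. c (\<lambda>i. L (v i))) = c" "(\<lambda>v. d (\<lambda>i. L (v i))) = d" by (auto simp: harmonic_def)
  then have "alt_wedge k l c d (\<lambda>i. L (v i)) = alt_wedge k l c d v" for v
    using alt_wedge_pull[of k l c L d v] by simp
  then show ?thesis using h alternating_wedge by (auto simp: harmonic_def)
qed

lemma harmonic_power: "harmonic 2 c \<Longrightarrow> harmonic (2 * r) (alt_power c r)"
proof (induction r)
  case 0
  show ?case by (simp add: harmonic_def)
next
  case (Suc r)
  then show ?case using harmonic_wedge[of 2 c "2 * r" "alt_power c r"] by simp
qed

lemma harmonic_lef: "harmonic 2 c \<Longrightarrow> harmonic k f \<Longrightarrow> harmonic (2 * r + k) (lef c r k f)"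
  unfolding lef_def by (intro harmonic_wedge harmonic_power)

lemma closed_inv_one: "closed_inv 0 (\<lambda>x v. 1)"
  using closed_inv_const[of 0 "\<lambda>v. 1"] by (simp add: harmonic_def)

lemma closed_inv_fpower: "closed_inv 2 \<eta> \<Longrightarrow> closed_inv (2 * r) (fpower \<eta> r)"
proof (induction r)
  case 0
  then show ?case using closed_inv_one by (simp add: fpower_0)
next
  case (Suc r)
  then show ?case using closed_inv_wedge[of 2 \<eta> "2 * r" "fpower \<eta> r"] by (simp add: fpower_Suc)
qed

lemma cohomologous_fpower:
  assumes \<eta>: "closed_inv 2 \<eta>" and c: "harmonic 2 c" and "cohomologous_inv 2 \<eta> (\<lambda>x. c)"
  shows "cohomologous_inv (2 * r) (fpower \<eta> r) (\<lambda>x. alt_power c r)"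
proof (induction r)
  case 0
  then show ?case by (simp add: fpower_0 cohomologous_refl)
next
  case (Suc r)
  have "cohomologous_inv (2 + 2 * r) (fwedge 2 (2 * r) \<eta> (fpower \<eta> r)) (fwedge 2 (2 * r) (\<lambda>x. c) (\<lambda>x. alt_power c r))"
    by (intro cohomologous_wedge \<eta> closed_inv_const c assms closed_inv_fpower harmonic_power Suc)
  then show ?case by (simp add: fpower_Suc fwedge_def)
qed

lemma cohomologous_lefschetz:
  assumes "closed_inv 2 \<eta>" "harmonic 2 w" "cohomologous_inv 2 \<eta> (\<lambda>x. w)"
    and "closed_inv k \<alpha>" "harmonic k c" "cohomologous_inv k \<alpha> (\<lambda>x. c)"
  shows "cohomologous_inv (2 * r + k) (fwedge (2 * r) k (fpower \<eta> r) \<alpha>) (\<lambda>x. lef w r k c)"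
proof -
  have "cohomologous_inv (2 * r + k) (fwedge (2 * r) k (fpower \<eta> r) \<alpha>) (fwedge (2 * r) k (\<lambda>x. alt_power w r) (\<lambda>x. c))"
    by (intro cohomologous_wedge closed_inv_const closed_inv_fpower harmonic_power cohomologous_fpower assms)
  then show ?thesis by (simp add: fwedge_def lef_def)
qed

text \<open>
  The top power of a harmonic representative \<open>c\<close> is the harmonic representative of the top power of \<open>\<eta>\<close>.
  If the latter is a constant invariant form \<open>T\<close>, they coincide by uniqueness, and \<open>c\<close> has a nonzero top power.
\<close>

lemma nondegenerate_harmonic_representative:
  assumes \<eta>: "closed_inv 2 \<eta>" and c: "harmonic 2 c" "cohomologous_inv 2 \<eta> (\<lambda>x. c)"
    and d: "DIM('e) = 2 * d"
    and T: "harmonic (2 * d) T" "\<And>x. alt_power (\<eta> x) d = T" "T u \<noteq> 0"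
  shows "nondegenerate c"
proof -
  have "cohomologous_inv (2 * d) (\<lambda>x. T) (\<lambda>x. alt_power c d)"
    using cohomologous_fpower[OF \<eta> c, of d] T(2) by (simp add: fpower_def)
  then have "T = alt_power c d"
    by (rule cohomologous_harmonic_eq[OF T(1) harmonic_power[OF c(1)]])
  then have nz: "alt_power c d u \<noteq> 0" using T(3) by simp
  obtain r where r: "d = Suc r" using d DIM_positive[where 'a='e] by (cases d) auto
  show ?thesis
    by (rule power_nonzero_imp_nondegenerate[of c r u]) (use c(1) d nz r in \<open>auto simp: harmonic_def\<close>)
qed

text \<open>
  On harmonic representatives the map is the algebraic Lefschetz map of \<open>w\<close>, the harmonic representative of
  \<open>\<eta>\<close>.  For surjectivity, a preimage \<open>f\<close> of a harmonic form is itself harmonic, because \<open>f\<close> minus its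
  pullback is in the kernel of the injective Lefschetz map.
\<close>

theorem mapping_torus_hard_lefschetz:
  assumes \<eta>: "closed_inv 2 \<eta>" and d: "DIM('e) = 2 * d" and k: "k \<le> d"
    and T: "harmonic (2 * d) T" "\<And>x. alt_power (\<eta> x) d = T" "T u \<noteq> 0"
  shows "\<And>\<alpha>. closed_inv k \<alpha> \<Longrightarrow> exact_inv (2 * (d - k) + k) (fwedge (2 * (d - k)) k (fpower \<eta> (d - k)) \<alpha>) \<Longrightarrow> exact_inv k \<alpha>"
    and "\<And>\<gamma>. closed_inv (2 * (d - k) + k) \<gamma> \<Longrightarrow>
      \<exists>\<alpha>. closed_inv k \<alpha> \<and> cohomologous_inv (2 * (d - k) + k) (fwedge (2 * (d - k)) k (fpower \<eta> (d - k)) \<alpha>) \<gamma>"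
proof -
  let ?r = "d - k"
  let ?q = "2 * ?r + k"
  obtain w where w: "harmonic 2 w" "cohomologous_inv 2 \<eta> (\<lambda>x. w)" using harmonic_representative[OF \<eta>] by blast
  have nd: "nondegenerate w" by (rule nondegenerate_harmonic_representative[OF \<eta> w d T])
  have aw: "alternating 2 w" using w(1) by (simp add: harmonic_def)
  have q: "?q = 2 * d - k" using k by simp
  {
    fix \<alpha> assume \<alpha>: "closed_inv k \<alpha>" and ex: "exact_inv ?q (fwedge (2 * ?r) k (fpower \<eta> ?r) \<alpha>)"
    obtain c where c: "harmonic k c" "cohomologous_inv k \<alpha> (\<lambda>x. c)" using harmonic_representative[OF \<alpha>] by blast
    have "cohomologous_inv ?q (\<lambda>x. lef w ?r k c) (fwedge (2 * ?r) k (fpower \<eta> ?r) \<alpha>)"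
      by (rule cohomologous_sym[OF cohomologous_lefschetz[OF \<eta> w \<alpha> c]])
    moreover have "cohomologous_inv ?q (fwedge (2 * ?r) k (fpower \<eta> ?r) \<alpha>) (\<lambda>x v. 0)"
      using ex by (simp add: cohomologous_inv_def)
    ultimately have "cohomologous_inv ?q (\<lambda>x. lef w ?r k c) (\<lambda>x v. 0)" by (rule cohomologous_trans)
    then have "lef w ?r k c = (\<lambda>v. 0)"
      by (rule cohomologous_harmonic_eq[OF harmonic_lef[OF w(1) c(1)] harmonic_zero])
    then have "c = (\<lambda>v. 0)"
      using lef_injective[OF aw nd d k] c(1) by (simp add: harmonic_def)
    then show "exact_inv k \<alpha>" using c(2) by (simp add: cohomologous_inv_def)
  next
    fix \<gamma> assume \<gamma>: "closed_inv ?q \<gamma>"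
    obtain C where C: "harmonic ?q C" "cohomologous_inv ?q \<gamma> (\<lambda>x. C)" using harmonic_representative[OF \<gamma>] by blast
    have "alternating (2 * d - k) C" using C(1) unfolding harmonic_def q by blast
    then obtain f where f: "alternating k f" "lef w ?r k f = C" using lef_surjective[OF aw nd d k] by blast
    have fL: "alternating k (\<lambda>v. f (\<lambda>i. L (v i)))" by (rule alternating_pull[OF f(1) linL])
    have pw: "(\<lambda>v. alt_power w ?r (\<lambda>i. L (v i))) = alt_power w ?r"
      using harmonic_power[OF w(1)] by (simp add: harmonic_def)
    have "lef w ?r k (\<lambda>v. f (\<lambda>i. L (v i)) - f v) v = 0" for v
    proof -
      have "lef w ?r k (\<lambda>v. f (\<lambda>i. L (v i))) v = C (\<lambda>i. L (v i))"
        using alt_wedge_pull[of "2 * ?r" k "alt_power w ?r" L f v] by (simp add: lef_def pw f(2)[symmetric])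
      then show ?thesis
        using C(1) f(2) by (simp add: lef_def alt_wedge_diff_right harmonic_def fun_eq_iff)
    qed
    then have "lef w ?r k (\<lambda>v. f (\<lambda>i. L (v i)) - f v) = (\<lambda>v. 0)" by (intro ext)
    then have "(\<lambda>v. f (\<lambda>i. L (v i)) - f v) = (\<lambda>v. 0)"
      by (rule lef_injective[OF aw nd d k alternating_diff[OF fL f(1)]])
    then have hf: "harmonic k f" using f(1) by (simp add: harmonic_def fun_eq_iff)
    have "cohomologous_inv ?q (fwedge (2 * ?r) k (fpower \<eta> ?r) (\<lambda>x. f)) (\<lambda>x. C)"
      using cohomologous_lefschetz[OF \<eta> w closed_inv_const[OF hf] hf cohomologous_refl, of ?r] f(2) by simp
    then have "cohomologous_inv ?q (fwedge (2 * ?r) k (fpower \<eta> ?r) (\<lambda>x. f)) \<gamma>"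
      using cohomologous_sym[OF C(2)] by (rule cohomologous_trans)
    then show "\<exists>\<alpha>. closed_inv k \<alpha> \<and> cohomologous_inv ?q (fwedge (2 * ?r) k (fpower \<eta> ?r) \<alpha>) \<gamma>"
      using closed_inv_const[OF hf] by blast
  }
qed

end

section \<open>Differential forms on the quotient by a discrete group of affine maps\<close>

text \<open>
  A discrete set of affine transformations of a Euclidean space, closed under composition and inverses, given by
  left multiplication in a group whose product is affine in the second factor.  The condition \<open>discrete\<close> is a
  uniform one, so that the projection is injective on all balls of radius \<open>r / 2\<close>.
\<close>

locale affine_quotient =
  fixes G :: "('e::euclidean_space, 'b) monoid_scheme" and \<Gamma> :: "'e set"
    and A :: "'e \<Rightarrow> 'e \<Rightarrow> 'e" and r :: real
  assumes mult: "\<And>g x. g \<otimes>\<^bsub>G\<^esub> x = A g x + g" and lin: "\<And>g. linear (A g)"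
    and unit: "0 \<in> \<Gamma>" "\<And>x. A 0 x = x"
    and compose: "\<And>g h. g \<in> \<Gamma> \<Longrightarrow> h \<in> \<Gamma> \<Longrightarrow> \<exists>k\<in>\<Gamma>. \<forall>x. g \<otimes>\<^bsub>G\<^esub> (h \<otimes>\<^bsub>G\<^esub> x) = k \<otimes>\<^bsub>G\<^esub> x"
    and inverse: "\<And>g. g \<in> \<Gamma> \<Longrightarrow> \<exists>h\<in>\<Gamma>. \<forall>x. h \<otimes>\<^bsub>G\<^esub> (g \<otimes>\<^bsub>G\<^esub> x) = x"
    and r_pos: "0 < r" and discrete: "\<And>g x. g \<in> \<Gamma> \<Longrightarrow> dist (g \<otimes>\<^bsub>G\<^esub> x) x < r \<Longrightarrow> g \<otimes>\<^bsub>G\<^esub> x = x"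
begin

abbreviation proj :: "'e \<Rightarrow> 'e set" where "proj \<equiv> quotient_proj G \<Gamma>"
abbreviation atlas :: "('e set, 'e) chart set" where "atlas \<equiv> quotient_atlas G \<Gamma>"
abbreviation act :: "'e \<Rightarrow> 'e \<Rightarrow> 'e" where "act g x \<equiv> g \<otimes>\<^bsub>G\<^esub> x"

definition chart_on :: "'e set \<Rightarrow> ('e set, 'e) chart" where
  "chart_on U = (proj ` U, inv_into U proj)"

definition invariant_form :: "('e \<Rightarrow> 'e multiform) \<Rightarrow> bool" where
  "invariant_form \<eta> \<longleftrightarrow> (\<forall>g\<in>\<Gamma>. affine_pull (A g) g \<eta> = \<eta>)"

text \<open>
  The form on the quotient induced by a form on the cover: in each chart, the restriction to the chart image,
  extended by 0 as required of members of \<open>diff_forms\<close>.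
\<close>

definition descend :: "('e \<Rightarrow> 'e multiform) \<Rightarrow> ('e set, 'e) dform" where
  "descend \<eta> = (\<lambda>c x v. if c \<in> atlas \<and> x \<in> chart_image c then \<eta> x v else 0)"

lemma proj_eq_iff: "proj x = proj y \<longleftrightarrow> (\<exists>g\<in>\<Gamma>. y = act g x)"
proof
  have P: "proj z = {act g z | g. g \<in> \<Gamma>}" for z by (auto simp: quotient_proj_def r_coset_def)
  have g0: "0 \<in> \<Gamma>" "\<And>x. act 0 x = x" by (simp_all add: unit mult)
  show "\<exists>g\<in>\<Gamma>. y = act g x" if "proj x = proj y"
  proof -
    have "y \<in> proj y" unfolding P using g0 by (metis (mono_tags, lifting) mem_Collect_eq)
    then show ?thesis using that unfolding P by blast
  qed
  show "proj x = proj y" if g: "\<exists>g\<in>\<Gamma>. y = act g x"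
  proof -
    obtain g where g: "g \<in> \<Gamma>" "y = act g x" using g by blast
    obtain h where h: "h \<in> \<Gamma>" "act h y = x" using inverse[OF g(1)] g(2) by blast
    have 1: "proj u \<subseteq> proj z" if "k \<in> \<Gamma>" "u = act k z" for k u z
      unfolding P that(2) using compose[OF _ that(1)] by blast
    show ?thesis using 1[OF g(1) g(2)] 1[OF h(1) h(2)[symmetric]] by blast
  qed
qed

lemma proj_act: "g \<in> \<Gamma> \<Longrightarrow> proj (act g x) = proj x"
  using proj_eq_iff by metis

lemma inj_ball: "inj_on proj (ball x (r / 2))"
proof (rule inj_onI)
  fix y z assume y: "y \<in> ball x (r / 2)" and z: "z \<in> ball x (r / 2)" and "proj y = proj z"
  then obtain g where g: "g \<in> \<Gamma>" "z = act g y" using proj_eq_iff by blast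
  have "dist z y < r" using y z dist_triangle_half_r[of x z r y] by (simp add: dist_commute)
  then show "y = z" using discrete[OF g(1), of y] g(2) by simp
qed

lemma atlas_iff: "c \<in> atlas \<longleftrightarrow> (\<exists>U. open U \<and> inj_on proj U \<and> c = chart_on U)"
  by (auto simp: quotient_atlas_def chart_on_def)

lemma chart_image_on: "inj_on proj U \<Longrightarrow> chart_image (chart_on U) = U"
  by (auto simp: chart_image_def chart_on_def image_image)

lemma chart_on_ball: "chart_on (ball x (r / 2)) \<in> atlas" "chart_image (chart_on (ball x (r / 2))) = ball x (r / 2)"
  using inj_ball by (auto simp: atlas_iff chart_image_on)

lemma ex_chart: "\<exists>c\<in>atlas. x \<in> chart_image c"
  using chart_on_ball[of x] r_pos by (intro bexI[of _ "chart_on (ball x (r / 2))"]) auto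

lemma open_chart_image: "c \<in> atlas \<Longrightarrow> open (chart_image c)"
  using chart_image_on by (auto simp: atlas_iff)

lemma transition_chart_on:
  assumes U: "inj_on proj U" and U': "inj_on proj U'" and x: "x \<in> U"
    and g: "g \<in> \<Gamma>" "act g x \<in> U'"
  shows "transition (chart_on U) (chart_on U') x = act g x"
proof -
  have "inv_into (proj ` U) (inv_into U proj) x = proj x"
  proof -
    have "inj_on (inv_into U proj) (proj ` U)" by (rule inj_on_inv_into) simp
    moreover have "inv_into U proj (proj x) = x" using U x by simp
    ultimately show ?thesis using x by (metis imageI inv_into_f_f)
  qed
  moreover have "inv_into U' proj (proj x) = act g x"
    using U' g by (metis inv_into_f_f proj_act)
  ultimately show ?thesis by (simp add: transition_def chart_on_def)
qed

lemma chart_overlap_iff: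
  assumes U: "inj_on proj U"
  shows "x \<in> chart_overlap (chart_on U) (chart_on U') \<longleftrightarrow> x \<in> U \<and> (\<exists>g\<in>\<Gamma>. act g x \<in> U')"
proof
  assume "x \<in> chart_overlap (chart_on U) (chart_on U')"
  then obtain y z where "y \<in> U" "z \<in> U'" "proj y = proj z" "x = inv_into U proj (proj y)"
    by (auto simp: chart_overlap_def chart_on_def)
  then have "x = y" using inv_into_f_f[OF U \<open>y \<in> U\<close>] by (simp only:)
  then show "x \<in> U \<and> (\<exists>g\<in>\<Gamma>. act g x \<in> U')"
    using \<open>y \<in> U\<close> \<open>z \<in> U'\<close> \<open>proj y = proj z\<close> proj_eq_iff[of y z] by auto
next
  assume x: "x \<in> U \<and> (\<exists>g\<in>\<Gamma>. act g x \<in> U')"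
  then obtain g where "g \<in> \<Gamma>" "act g x \<in> U'" by blast
  then have "proj x \<in> proj ` U \<inter> proj ` U'" using x proj_act by (metis IntI imageI)
  moreover have "x = inv_into U proj (proj x)" using U x by simp
  ultimately show "x \<in> chart_overlap (chart_on U) (chart_on U')"
    unfolding chart_overlap_def chart_on_def by (metis fst_conv image_eqI snd_conv)
qed

text \<open>
  The coordinate change between two charts is, near \<open>x\<close>, the element of the group that moves \<open>x\<close> into the
  image of the second chart.
\<close>

lemma pullback_transition:
  assumes U: "open U" "inj_on proj U" and U': "open U'" "inj_on proj U'" and x: "x \<in> U"
    and g: "g \<in> \<Gamma>" "act g x \<in> U'"
  shows "pullback (transition (chart_on U) (chart_on U')) \<beta> x = affine_pull (A g) g \<beta> x"
proof -
  let ?t = "transition (chart_on U) (chart_on U')"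
  have der: "((\<lambda>x. A g x + g) has_derivative A g) (at x)"
    using lin[of g] by (auto intro!: derivative_eq_intros bounded_linear_imp_has_derivative simp: linear_conv_bounded_linear)
  have "continuous_on UNIV (\<lambda>x. A g x + g)"
    using lin[of g] by (intro continuous_intros linear_continuous_on) (simp add: linear_conv_bounded_linear)
  then have "open ((\<lambda>x. A g x + g) -` U')" by (intro open_vimage U')
  then have op: "open (U \<inter> (\<lambda>x. A g x + g) -` U')" using U(1) by blast
  have "(?t has_derivative A g) (at x)"
    by (rule has_derivative_transform_within_open[OF der op])
      (use x g transition_chart_on[OF U(2) U'(2) _ g(1)] in \<open>auto simp: mult\<close>)
  then have "frechet_derivative ?t (at x) = A g" using frechet_derivative_at by metis
  then show ?thesis
    using transition_chart_on[OF U(2) U'(2) x g] by (simp add: pullback_def affine_pull_def mult fun_eq_iff)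
qed

lemma descend_in_diff_forms:
  assumes sf: "smooth_form k \<eta>" and inv: "invariant_form \<eta>"
  shows "descend \<eta> \<in> diff_forms atlas k"
  unfolding diff_forms_def
proof (intro CollectI conjI allI impI ballI)
  fix c x v assume "c \<notin> atlas \<or> x \<notin> chart_image c"
  then show "descend \<eta> c x v = 0" by (auto simp: descend_def)
next
  fix c x assume c: "c \<in> atlas" "x \<in> chart_image c"
  then have "descend \<eta> c x = \<eta> x" by (simp add: descend_def fun_eq_iff)
  then show "alternating k (descend \<eta> c x)" using smooth_formD(1)[OF sf] by simp
next
  fix c v assume c: "c \<in> atlas"
  show "smooth_on (\<lambda>x. descend \<eta> c x v) (chart_image c)"
    by (rule smooth_on_cong[OF open_chart_image[OF c], of "\<lambda>x. \<eta> x v"])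
      (use c smooth_formD(2)[OF sf, of v] smooth_on_subset in \<open>auto simp: descend_def\<close>)
next
  fix c c' x assume c: "c \<in> atlas" and c': "c' \<in> atlas" and x: "x \<in> chart_overlap c c'"
  obtain U where U: "open U" "inj_on proj U" "c = chart_on U" using c unfolding atlas_iff by blast
  obtain U' where U': "open U'" "inj_on proj U'" "c' = chart_on U'" using c' unfolding atlas_iff by blast
  obtain g where g: "x \<in> U" "g \<in> \<Gamma>" "act g x \<in> U'" using x U U' chart_overlap_iff[of U x U'] by blast
  have "pullback (transition c c') (descend \<eta> c') x = affine_pull (A g) g (descend \<eta> c') x"
    unfolding U(3) U'(3) by (rule pullback_transition[OF U(1,2) U'(1,2) g])
  also have "\<dots> = affine_pull (A g) g \<eta> x"
    using g(3) c' by (simp add: affine_pull_def descend_def U'(3) chart_image_on[OF U'(2)] mult fun_eq_iff)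
  also have "\<dots> = \<eta> x" using inv g(2) by (simp add: invariant_form_def)
  also have "\<dots> = descend \<eta> c x"
    using g(1) c by (simp add: descend_def U(3) chart_image_on[OF U(2)] fun_eq_iff)
  finally show "descend \<eta> c x = pullback (transition c c') (descend \<eta> c') x" by simp
qed

text \<open>
  The form on the cover is read off at \<open>x\<close> in the chart given by the ball around \<open>x\<close>.  Compatibility with the
  coordinate changes shows that every other chart gives the same value, whence smoothness, and that the form is
  invariant.
\<close>

lemma diff_form_descends:
  assumes \<alpha>: "\<alpha> \<in> diff_forms atlas k"
  shows "\<exists>\<eta>. smooth_form k \<eta> \<and> invariant_form \<eta> \<and> \<alpha> = descend \<eta>"
proof -
  let ?B = "\<lambda>x. ball x (r / 2)"
  define \<eta> where "\<eta> x = \<alpha> (chart_on (?B x)) x" for x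
  have compat: "\<alpha> (chart_on U) x = affine_pull (A g) g (\<alpha> (chart_on U')) x"
    if "open U" "inj_on proj U" "open U'" "inj_on proj U'" "x \<in> U" "g \<in> \<Gamma>" "act g x \<in> U'" for U U' x g
  proof -
    have "\<alpha> (chart_on U) x = pullback (transition (chart_on U) (chart_on U')) (\<alpha> (chart_on U')) x"
    proof -
      have "\<forall>c\<in>atlas. \<forall>c'\<in>atlas. \<forall>x\<in>chart_overlap c c'. \<alpha> c x = pullback (transition c c') (\<alpha> c') x"
        using \<alpha> unfolding diff_forms_def by blast
      moreover have "chart_on U \<in> atlas" "chart_on U' \<in> atlas" unfolding atlas_iff using that(1-4) by blast+
      moreover have "x \<in> chart_overlap (chart_on U) (chart_on U')" using that chart_overlap_iff[of U x U'] by blast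
      ultimately show ?thesis by blast
    qed
    then show ?thesis using pullback_transition[OF that] by simp
  qed
  have local: "\<alpha> c x = \<eta> x" if "c \<in> atlas" "x \<in> chart_image c" for c x
  proof -
    from that(1)[unfolded atlas_iff] obtain U where U: "open U" "inj_on proj U" "c = chart_on U"
      by (elim exE conjE)
    have "\<alpha> (chart_on U) x = affine_pull (A 0) 0 (\<alpha> (chart_on (?B x))) x"
    proof (rule compat[OF U(1,2) open_ball inj_ball _ unit(1)])
      show "x \<in> U" using that(2) chart_image_on[OF U(2)] by (simp only: U(3))
      show "act 0 x \<in> ?B x" using r_pos by (simp add: mult unit)
    qed
    then show ?thesis using U(3) by (simp add: \<eta>_def affine_pull_def unit fun_eq_iff)
  qed
  have S: "\<forall>c\<in>atlas. \<forall>v. smooth_on (\<lambda>x. \<alpha> c x v) (chart_image c)"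
    and Alt: "\<forall>c\<in>atlas. \<forall>x\<in>chart_image c. alternating k (\<alpha> c x)"
    and Z: "\<forall>c x v. c \<notin> atlas \<or> x \<notin> chart_image c \<longrightarrow> \<alpha> c x v = 0"
    using \<alpha> unfolding diff_forms_def by blast+
  have sm: "smooth (\<lambda>x. \<eta> x v)" for v
  proof (rule smooth_on_local)
    fix x
    have 1: "smooth_on (\<lambda>y. \<alpha> (chart_on (?B x)) y v) (?B x)"
      using bspec[OF S chart_on_ball(1)[of x]] by (simp add: chart_on_ball(2))
    have 2: "\<alpha> (chart_on (?B x)) y v = \<eta> y v" if "y \<in> ?B x" for y
      using local[OF chart_on_ball(1)[of x], of y] that by (simp add: chart_on_ball(2))
    have "smooth_on (\<lambda>y. \<eta> y v) (?B x)"
      by (rule smooth_on_cong[OF open_ball 2 1])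
    then show "\<exists>T. open T \<and> x \<in> T \<and> smooth_on (\<lambda>x. \<eta> x v) T" using r_pos by (intro exI[of _ "?B x"]) auto
  qed
  have alt: "alternating k (\<eta> x)" for x
    using bspec[OF Alt chart_on_ball(1)[of x]] r_pos by (simp add: chart_on_ball(2) \<eta>_def)
  have inv: "invariant_form \<eta>"
    unfolding invariant_form_def
  proof (intro ballI ext)
    fix g x v assume g: "g \<in> \<Gamma>"
    have "\<alpha> (chart_on (?B x)) x = affine_pull (A g) g (\<alpha> (chart_on (?B (act g x)))) x"
      by (rule compat[OF open_ball inj_ball open_ball inj_ball _ g]) (use r_pos in simp_all)
    then show "affine_pull (A g) g \<eta> x v = \<eta> x v" by (simp add: \<eta>_def affine_pull_def mult)
  qed
  have "\<alpha> c x v = descend \<eta> c x v" for c x v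
  proof (cases "c \<in> atlas \<and> x \<in> chart_image c")
    case True
    then show ?thesis using local[of c x] by (simp add: descend_def)
  next
    case False
    then show ?thesis using Z[rule_format, of c x v] by (auto simp: descend_def)
  qed
  then have "\<alpha> = descend \<eta>" by (intro ext)
  then show ?thesis using sm alt inv by (auto simp: smooth_form_def)
qed

lemma descend_inject: "descend \<eta> = descend \<eta>' \<longleftrightarrow> \<eta> = \<eta>'"
proof
  assume eq: "descend \<eta> = descend \<eta>'"
  show "\<eta> = \<eta>'"
  proof (intro ext)
    fix x v
    obtain c where "c \<in> atlas" "x \<in> chart_image c" using ex_chart by blast
    then show "\<eta> x v = \<eta>' x v"
      using fun_cong[OF fun_cong[OF fun_cong[OF eq, of c], of x], of v] by (simp add: descend_def)
  qed
qed simp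

lemma descend_zero: "descend (\<lambda>x v. 0) = (\<lambda>c x v. 0)"
  by (simp add: descend_def fun_eq_iff)

lemma descend_diff: "(\<lambda>c x v. descend \<alpha> c x v - descend \<beta> c x v) = descend (\<lambda>x v. \<alpha> x v - \<beta> x v)"
  by (intro ext) (simp add: descend_def)

lemma ext_deriv_descend:
  assumes sf: "smooth_form k \<eta>"
  shows "ext_deriv k (descend \<eta>) = descend (dext k \<eta>)"
proof (intro ext)
  fix c x v
  show "ext_deriv k (descend \<eta>) c x v = descend (dext k \<eta>) c x v"
  proof (cases "c \<in> atlas \<and> x \<in> chart_image c")
    case True
    have "frechet_derivative (\<lambda>y. descend \<eta> c y w) (at x) a = dd a (\<lambda>y. \<eta> y w) x" for w a
    proof -
      have "((\<lambda>y. descend \<eta> c y w) has_derivative (\<lambda>a. dd a (\<lambda>y. \<eta> y w) x)) (at x)"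
        by (rule has_derivative_transform_within_open[OF smooth_has_derivative[OF smooth_formD(2)[OF sf, of w]] open_chart_image[of c]])
          (use True in \<open>auto simp: descend_def\<close>)
      from frechet_derivative_at[OF this] show ?thesis by metis
    qed
    then show ?thesis using True by (simp add: ext_deriv_def descend_def dext_def)
  next
    case False
    then have "descend \<eta> c = (\<lambda>x v. 0)" if "x \<in> chart_image c" using that by (auto simp: descend_def fun_eq_iff)
    then show ?thesis using False by (auto simp: ext_deriv_def descend_def)
  qed
qed

definition closed_invariant :: "nat \<Rightarrow> ('e \<Rightarrow> 'e multiform) \<Rightarrow> bool" where
  "closed_invariant k \<alpha> \<longleftrightarrow> smooth_form k \<alpha> \<and> invariant_form \<alpha> \<and> dext k \<alpha> = (\<lambda>x v. 0)"

lemma closed_forms_eq: "closed_forms atlas k = descend ` {\<alpha>. closed_invariant k \<alpha>}"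
proof (intro equalityI subsetI)
  fix \<alpha> assume a: "\<alpha> \<in> closed_forms atlas k"
  then obtain \<eta> where \<eta>: "smooth_form k \<eta>" "invariant_form \<eta>" "\<alpha> = descend \<eta>"
    using diff_form_descends by (auto simp: closed_forms_def)
  have "descend (dext k \<eta>) = descend (\<lambda>x v. 0)"
    using a \<eta> by (simp add: closed_forms_def ext_deriv_descend descend_zero)
  then show "\<alpha> \<in> descend ` {\<alpha>. closed_invariant k \<alpha>}" using \<eta> by (auto simp: descend_inject closed_invariant_def)
next
  fix \<alpha> assume "\<alpha> \<in> descend ` {\<alpha>. closed_invariant k \<alpha>}"
  then show "\<alpha> \<in> closed_forms atlas k"
    using descend_in_diff_forms by (auto simp: closed_forms_def closed_invariant_def ext_deriv_descend descend_zero)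
qed

lemma exact_forms_iff: "descend \<alpha> \<in> exact_forms atlas q \<longleftrightarrow> exact_in invariant_form q \<alpha>"
proof (cases q)
  case 0
  then show ?thesis using descend_inject[of \<alpha> "\<lambda>x v. 0"] by (simp add: exact_in_0 descend_zero)
next
  case (Suc k)
  show ?thesis
  proof
    assume "descend \<alpha> \<in> exact_forms atlas q"
    then obtain \<beta> where "\<beta> \<in> diff_forms atlas k" "descend \<alpha> = ext_deriv k \<beta>" using Suc by auto
    then obtain \<eta> where \<eta>: "smooth_form k \<eta>" "invariant_form \<eta>" "descend \<alpha> = ext_deriv k (descend \<eta>)"
      using diff_form_descends by blast
    then have "\<alpha> = dext k \<eta>" by (simp add: ext_deriv_descend descend_inject)
    then show "exact_in invariant_form q \<alpha>" using \<eta> Suc by (auto simp: exact_in_Suc)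
  next
    assume "exact_in invariant_form q \<alpha>"
    then obtain \<eta> where \<eta>: "smooth_form k \<eta>" "invariant_form \<eta>" "\<alpha> = dext k \<eta>"
      using Suc by (auto simp: exact_in_Suc)
    then have "descend \<alpha> = ext_deriv k (descend \<eta>)" by (simp add: ext_deriv_descend)
    then show "descend \<alpha> \<in> exact_forms atlas q" using descend_in_diff_forms[OF \<eta>(1,2)] Suc by simp
  qed
qed

lemma cohomologous_iff:
  "(descend \<alpha>, descend \<beta>) \<in> cohomologous atlas q \<longleftrightarrow>
    closed_invariant q \<alpha> \<and> closed_invariant q \<beta> \<and> exact_in invariant_form q (\<lambda>x v. \<alpha> x v - \<beta> x v)"
  by (auto simp: cohomologous_def closed_forms_eq descend_diff exact_forms_iff image_iff descend_inject)

lemma wedge_power_descend: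
  "wedge (2 * s) k (form_power (descend \<eta>) s) (descend \<alpha>) = descend (fwedge (2 * s) k (fpower \<eta> s) \<alpha>)"
proof (intro ext)
  fix c x v
  show "wedge (2 * s) k (form_power (descend \<eta>) s) (descend \<alpha>) c x v =
      descend (fwedge (2 * s) k (fpower \<eta> s) \<alpha>) c x v"
  proof (cases "c \<in> atlas \<and> x \<in> chart_image c")
    case True
    then have d: "descend \<alpha> c x = \<alpha> x" "descend \<eta> c x = \<eta> x" by (simp_all add: descend_def fun_eq_iff)
    have "form_power (descend \<eta>) s c x = alt_power (\<eta> x) s"
      by (induction s) (simp_all add: wedge_def d)
    then show ?thesis using True d by (simp add: wedge_def fwedge_def fpower_def descend_def)
  next
    case False
    then have z: "descend \<alpha> c x = (\<lambda>v. 0)" "descend \<theta> c x v = 0" for \<theta> by (auto simp: descend_def)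
    show ?thesis by (simp only: wedge_def z alt_wedge_zero)
  qed
qed

end

section \<open>Hard Lefschetz for quotients that are mapping tori\<close>

text \<open>
  The quotient whose invariant forms are those of a mapping torus.  The two notions of invariance are
  stated for different generating sets of the group, the second one being \<open>\<Lambda>\<close> and a single further map.
\<close>

locale mapping_torus_quotient = mapping_torus L L' s e ht \<Lambda> + affine_quotient G \<Gamma> A r
  for L L' :: "'e::euclidean_space \<Rightarrow> 'e" and s :: "'e \<Rightarrow> real" and e :: 'e and ht :: "'e \<Rightarrow> real" and \<Lambda> :: "'e set"
    and G :: "('e, 'b) monoid_scheme" and \<Gamma> :: "'e set" and A :: "'e \<Rightarrow> 'e \<Rightarrow> 'e" and r :: real +
  assumes invariant_form_iff: "\<And>\<eta>. invariant_form \<eta> \<longleftrightarrow> invariant \<eta>"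
begin

lemma closed_invariant_iff: "closed_invariant k \<alpha> \<longleftrightarrow> closed_inv k \<alpha>"
  by (simp add: closed_invariant_def closed_inv_def invariant_form_iff)

lemma exact_invariant_form: "exact_in invariant_form q \<alpha> \<longleftrightarrow> exact_inv q \<alpha>"
  by (simp add: exact_in_def invariant_form_iff)

lemma closed_forms_image: "closed_forms atlas k = descend ` {\<alpha>. closed_inv k \<alpha>}"
  by (simp add: closed_forms_eq closed_invariant_iff)

lemma cohomologous_descend_iff:
  "(descend \<alpha>, descend \<beta>) \<in> cohomologous atlas q \<longleftrightarrow> closed_inv q \<alpha> \<and> closed_inv q \<beta> \<and> cohomologous_inv q \<alpha> \<beta>"
  by (simp add: cohomologous_iff closed_invariant_iff exact_invariant_form cohomologous_inv_def)

lemma equiv_cohomologous: "equiv (closed_forms atlas q) (cohomologous atlas q)"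
proof (rule equivI)
  show "cohomologous atlas q \<subseteq> closed_forms atlas q \<times> closed_forms atlas q"
    by (auto simp: cohomologous_def)
  show "refl_on (closed_forms atlas q) (cohomologous atlas q)"
    by (rule refl_onI) (auto simp: closed_forms_image cohomologous_descend_iff cohomologous_refl)
  show "sym (cohomologous atlas q)"
  proof (rule symI)
    fix a b assume ab: "(a, b) \<in> cohomologous atlas q"
    then obtain \<alpha> \<beta> where "a = descend \<alpha>" "b = descend \<beta>" by (auto simp: cohomologous_def closed_forms_image)
    then show "(b, a) \<in> cohomologous atlas q" using ab cohomologous_sym by (auto simp: cohomologous_descend_iff)
  qed
  show "trans (cohomologous atlas q)"
  proof (rule transI)
    fix a b c assume ab: "(a, b) \<in> cohomologous atlas q" and bc: "(b, c) \<in> cohomologous atlas q"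
    then obtain \<alpha> \<beta> \<gamma> where "a = descend \<alpha>" "b = descend \<beta>" "c = descend \<gamma>" by (auto simp: cohomologous_def closed_forms_image)
    then show "(a, c) \<in> cohomologous atlas q" using ab bc cohomologous_trans by (auto simp: cohomologous_descend_iff)
  qed
qed

text \<open>
  The Lefschetz map on classes of forms on the quotient, transported to the cover by \<open>descend\<close>.
\<close>

theorem hard_lefschetz_descend:
  assumes \<eta>: "closed_inv 2 \<eta>" and d: "DIM('e) = 2 * d"
    and T: "harmonic (2 * d) T" "\<And>x. alt_power (\<eta> x) d = T" "T u \<noteq> 0"
  shows "hard_lefschetz atlas (descend \<eta>)"
proof -
  have "bij_betw (lefschetz_map atlas (descend \<eta>) (d - k) k) (de_rham atlas k) (de_rham atlas (2 * d - k))"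
    if k: "k \<le> d" for k
  proof -
    let ?s = "d - k"
    let ?q = "2 * ?s + k"
    let ?L = "fwedge (2 * ?s) k (fpower \<eta> ?s)"
    let ?cls = "\<lambda>q \<alpha>. cohomologous atlas q `` {descend \<alpha>}"
    have q: "2 * d - k = ?q" using k by simp
    have cls_eq: "?cls m \<alpha> = ?cls m \<beta> \<longleftrightarrow> cohomologous_inv m \<alpha> \<beta>"
      if "closed_inv m \<alpha>" "closed_inv m \<beta>" for m \<alpha> \<beta>
      using eq_equiv_class_iff[OF equiv_cohomologous[of m], of "descend \<alpha>" "descend \<beta>"] that cohomologous_descend_iff
      by (auto simp: closed_forms_image)
    have dr: "de_rham atlas m = ?cls m ` {\<alpha>. closed_inv m \<alpha>}" for m
      by (auto simp: de_rham_def quotient_def closed_forms_image)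
    have lef: "closed_inv ?q (?L \<alpha>)" if "closed_inv k \<alpha>" for \<alpha>
      by (rule closed_inv_wedge[OF closed_inv_fpower[OF \<eta>] that])
    have L_diff: "(\<lambda>x v. ?L \<alpha> x v - ?L \<beta> x v) = ?L (\<lambda>x v. \<alpha> x v - \<beta> x v)" for \<alpha> \<beta>
      by (intro ext) (simp add: fwedge_def alt_wedge_diff_right)
    have cls_L: "?cls ?q (?L \<alpha>) = ?cls ?q (?L \<beta>)"
      if "closed_inv k \<alpha>" "closed_inv k \<beta>" "cohomologous_inv k \<alpha> \<beta>" for \<alpha> \<beta>
      using cls_eq[OF lef[OF that(1)] lef[OF that(2)]]
        cohomologous_wedge[OF closed_inv_fpower[OF \<eta>] closed_inv_fpower[OF \<eta>] cohomologous_refl that] by blast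
    have map: "lefschetz_map atlas (descend \<eta>) ?s k (?cls k \<alpha>) = ?cls ?q (?L \<alpha>)" if a: "closed_inv k \<alpha>" for \<alpha>
    proof -
      have "cohomologous atlas ?q `` {wedge (2 * ?s) k (form_power (descend \<eta>) ?s) \<beta>} = ?cls ?q (?L \<alpha>)"
        if "\<beta> \<in> ?cls k \<alpha>" for \<beta>
      proof -
        have "\<beta> \<in> closed_forms atlas k" using that by (simp add: cohomologous_def)
        then obtain b where b: "\<beta> = descend b" unfolding closed_forms_image by blast
        then have "closed_inv k b" "cohomologous_inv k \<alpha> b"
          using that cohomologous_descend_iff by auto
        then show ?thesis using cls_L[OF a] by (simp add: b wedge_power_descend)
      qed
      moreover have "descend \<alpha> \<in> ?cls k \<alpha>"
        using a equiv_class_self[OF equiv_cohomologous] by (simp add: closed_forms_image)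
      ultimately show ?thesis unfolding lefschetz_map_def by blast
    qed
    show ?thesis
      unfolding bij_betw_def q
    proof
      show "inj_on (lefschetz_map atlas (descend \<eta>) ?s k) (de_rham atlas k)"
      proof (rule inj_onI)
        fix X Y assume "X \<in> de_rham atlas k" "Y \<in> de_rham atlas k"
          and eq: "lefschetz_map atlas (descend \<eta>) ?s k X = lefschetz_map atlas (descend \<eta>) ?s k Y"
        then obtain \<alpha> \<beta> where ab: "closed_inv k \<alpha>" "X = ?cls k \<alpha>" "closed_inv k \<beta>" "Y = ?cls k \<beta>"
          unfolding dr by blast
        have "?cls ?q (?L \<alpha>) = ?cls ?q (?L \<beta>)" using eq ab map by simp
        then have "exact_inv ?q (?L (\<lambda>x v. \<alpha> x v - \<beta> x v))"
          using cls_eq[OF lef[OF ab(1)] lef[OF ab(3)]] by (simp add: cohomologous_inv_def L_diff)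
        then have "exact_inv k (\<lambda>x v. \<alpha> x v - \<beta> x v)"
          by (rule mapping_torus_hard_lefschetz(1)[OF \<eta> d k T closed_inv_diff[OF ab(1,3)]])
        then show "X = Y" using ab cls_eq by (simp add: cohomologous_inv_def)
      qed
      show "lefschetz_map atlas (descend \<eta>) ?s k ` de_rham atlas k = de_rham atlas ?q"
      proof (intro equalityI subsetI)
        fix Y assume "Y \<in> lefschetz_map atlas (descend \<eta>) ?s k ` de_rham atlas k"
        then obtain \<alpha> where "closed_inv k \<alpha>" "Y = ?cls ?q (?L \<alpha>)" unfolding dr[of k] using map by auto
        then show "Y \<in> de_rham atlas ?q" unfolding dr using lef by blast
      next
        fix Y assume "Y \<in> de_rham atlas ?q"
        then obtain \<gamma> where \<gamma>: "closed_inv ?q \<gamma>" "Y = ?cls ?q \<gamma>" unfolding dr by blast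
        obtain \<alpha> where \<alpha>: "closed_inv k \<alpha>" "cohomologous_inv ?q (?L \<alpha>) \<gamma>"
          using mapping_torus_hard_lefschetz(2)[OF \<eta> d k T \<gamma>(1)] by blast
        have "Y = lefschetz_map atlas (descend \<eta>) ?s k (?cls k \<alpha>)"
          using map[OF \<alpha>(1)] cls_eq[OF lef[OF \<alpha>(1)] \<gamma>(1)] \<alpha>(2) \<gamma>(2) by simp
        then show "Y \<in> lefschetz_map atlas (descend \<eta>) ?s k ` de_rham atlas k" unfolding dr[of k] using \<alpha>(1) by blast
      qed
    qed
  qed
  then show ?thesis unfolding hard_lefschetz_def using d by simp
qed

end

section \<open>The solvable group of a generalized Nakamura manifold\<close>

text \<open>
  The representation that defines the group depends only on the real part \<open>t\<close> of its argument.
\<close>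

definition dil :: "('n::finite \<Rightarrow> real) \<Rightarrow> real \<Rightarrow> complex^'n \<Rightarrow> complex^'n" where
  "dil lam t z = (\<chi> i. exp (lam i * t) *\<^sub>R z $ i)"

definition nak_linear :: "('n::finite \<Rightarrow> real) \<Rightarrow> real \<Rightarrow> complex \<times> (complex^'n) \<Rightarrow> complex \<times> (complex^'n)" where
  "nak_linear lam t x = (fst x, dil lam t (snd x))"

lemma dil_0 [simp]: "dil lam 0 z = z"
  by (simp add: dil_def vec_eq_iff)

lemma dil_dil: "dil lam s (dil lam t z) = dil lam (s + t) z"
  by (simp add: dil_def vec_eq_iff exp_add distrib_left)

lemma linear_dil: "linear (dil lam t)"
  by (rule linearI) (simp_all add: dil_def vec_eq_iff scaleR_add_right)

lemma linear_nak_linear: "linear (nak_linear lam t)"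
  by (rule linearI) (simp_all add: nak_linear_def linear_add[OF linear_dil] linear_scale[OF linear_dil])

lemma nak_linear_0 [simp]: "nak_linear lam 0 x = x"
  by (simp add: nak_linear_def)

lemma nak_linear_add: "nak_linear lam s (nak_linear lam t x) = nak_linear lam (s + t) x"
  by (simp add: nak_linear_def dil_dil)

lemma fst_nak_linear [simp]: "fst (nak_linear lam t x) = fst x"
  by (simp add: nak_linear_def)

lemma nak_rho_mult: "nak_rho lam w *v z = dil lam (Re w) z"
proof -
  have "exp (1 / 2 * complex_of_real (lam i) * (w + cnj w)) = of_real (exp (lam i * Re w))" for i
    by (simp add: complex_add_cnj exp_of_real[symmetric])
  then show ?thesis
    by (simp add: nak_rho_def diag_mat_def dil_def matrix_vector_mult_def vec_eq_iff if_distrib if_distribR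
        sum.delta scaleR_conv_of_real cong: if_cong)
qed

lemma nak_mult: "g \<otimes>\<^bsub>nak_group lam\<^esub> x = nak_linear lam (Re (fst g)) x + g"
  by (simp add: nak_group_def nak_linear_def split_beta nak_rho_mult add.commute prod_eq_iff)

text \<open>
  A standard basis vector is an eigenvector of all the maps \<open>nak_linear lam t\<close>; the weight is the logarithm
  of its eigenvalue for \<open>t = 1\<close>.  A basis vector of the second factor has exactly one nonzero coordinate, so the
  description is proper.
\<close>

definition weight :: "('n::finite \<Rightarrow> real) \<Rightarrow> complex \<times> (complex^'n) \<Rightarrow> real" where
  "weight lam b = (if snd b = 0 then 0 else lam (THE i. snd b $ i \<noteq> 0))"

lemma weight_fst [simp]: "weight lam (c, 0) = 0"
  by (simp add: weight_def)

lemma weight_axis: "c \<noteq> 0 \<Longrightarrow> weight lam (0, axis i c) = lam i"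
proof -
  assume "c \<noteq> 0"
  then have "axis i c \<noteq> 0" and "(THE j. axis i c $ j \<noteq> 0) = i"
    by (auto simp: axis_def vec_eq_iff)
  then show ?thesis by (simp add: weight_def)
qed

lemma Basis_nak:
  "(Basis :: (complex \<times> (complex^'n::finite)) set) = (\<lambda>c. (c, 0)) ` {1, \<i>} \<union> (\<lambda>(i, c). (0, axis i c)) ` (UNIV \<times> {1, \<i>})"
  by (auto simp: Basis_prod_def Basis_vec_def Basis_complex_def image_iff)

lemma nak_Basis_cases:
  assumes "b \<in> (Basis :: (complex \<times> (complex^'n::finite)) set)"
  obtains c where "b = (c, 0)" "c \<in> {1, \<i>}" | i c where "b = (0, axis i c)" "c \<in> {1, \<i>}"
  using assms unfolding Basis_nak by auto

lemma nak_linear_Basis: "b \<in> Basis \<Longrightarrow> nak_linear lam t b = exp (weight lam b * t) *\<^sub>R b"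
proof (erule nak_Basis_cases)
  fix c assume "b = (c, 0)"
  then show ?thesis by (simp add: nak_linear_def dil_def vec_eq_iff)
next
  fix i c assume "b = (0, axis i c)" "c \<in> {1, \<i>}"
  moreover from this have "c \<noteq> 0" by auto
  ultimately show ?thesis by (simp add: nak_linear_def dil_def vec_eq_iff weight_axis) (simp add: axis_def)
qed

text \<open>
  The maps have determinant 1, as the weights of the second factor are the numbers \<open>lam i\<close>, each taken twice.
\<close>

lemma prod_Basis_weight:
  fixes lam :: "'n::finite \<Rightarrow> real"
  assumes "(\<Sum>i\<in>UNIV. lam i) = 0"
  shows "(\<Prod>b\<in>(Basis :: (complex \<times> (complex^'n)) set). exp (weight lam b * t)) = 1"
proof -
  let ?B1 = "(\<lambda>c. (c, 0)) ` {1, \<i>} :: (complex \<times> (complex^'n)) set"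
  let ?B2 = "(\<lambda>(i, c). (0, axis i c)) ` (UNIV \<times> {1, \<i>}) :: (complex \<times> (complex^'n)) set"
  have inj: "inj_on (\<lambda>(i, c). (0 :: complex, axis i c :: complex^'n)) (UNIV \<times> {1, \<i>})"
    by (auto simp: inj_on_def axis_eq_axis)
  have "(\<Sum>b\<in>(Basis :: (complex \<times> (complex^'n)) set). weight lam b) = sum (weight lam) ?B1 + sum (weight lam) ?B2"
    unfolding Basis_nak by (rule sum.union_disjoint) (auto simp: axis_eq_0_iff)
  also have "sum (weight lam) ?B1 = 0" by (rule sum.neutral) auto
  also have "sum (weight lam) ?B2 = (\<Sum>(i, c)\<in>UNIV \<times> {1, \<i>}. lam i)"
    unfolding sum.reindex[OF inj] by (rule sum.cong) (auto simp: weight_axis)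
  also have "\<dots> = (\<Sum>i\<in>UNIV. \<Sum>c\<in>{1, \<i>}. lam i)" by (simp only: sum.cartesian_product)
  also have "\<dots> = (\<Sum>i\<in>UNIV. 2 * lam i)" by (intro sum.cong refl) (simp add: complex_i_not_one[symmetric])
  also have "\<dots> = 0" using assms by (simp add: sum_distrib_left[symmetric])
  finally have "(\<Sum>b\<in>(Basis :: (complex \<times> (complex^'n)) set). weight lam b * t) = 0"
    by (simp add: sum_distrib_right[symmetric])
  then show ?thesis by (simp add: exp_sum[symmetric])
qed

section \<open>The lattice\<close>

definition emb :: "real^'n \<Rightarrow> real^'n \<Rightarrow> complex^'n::finite" where
  "emb u v = (\<chi> i. complex_of_real (u $ i) + \<i> * complex_of_real (v $ i))"

definition integral_vec :: "real^'n \<Rightarrow> bool" where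
  "integral_vec x \<longleftrightarrow> (\<forall>i. x $ i \<in> \<int>)"

definition nak_fibre :: "real^'n^'n \<Rightarrow> (complex^'n::finite) set" where
  "nak_fibre P = {emb (P *v x) (P *v y) | x y. integral_vec x \<and> integral_vec y}"

lemma nak_lattice_eq: "nak_lattice P \<tau> = {of_int a + complex_of_real \<tau> * \<i> * of_int b | a b. True} \<times> nak_fibre P"
  by (simp add: nak_lattice_def nak_fibre_def emb_def integral_vec_def)

lemma emb_add: "emb u v + emb u' v' = emb (u + u') (v + v')"
  and emb_minus: "- emb u v = emb (- u) (- v)"
  and emb_0 [simp]: "emb 0 0 = 0"
  and emb_scaleR: "c *\<^sub>R emb u v = emb (c *\<^sub>R u) (c *\<^sub>R v)"
  by (simp_all add: emb_def vec_eq_iff complex_eq_iff)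

lemma nak_fibre_add: "x \<in> nak_fibre P \<Longrightarrow> y \<in> nak_fibre P \<Longrightarrow> x + y \<in> nak_fibre P"
proof -
  assume "x \<in> nak_fibre P" "y \<in> nak_fibre P"
  then obtain a b c d where "x = emb (P *v a) (P *v b)" "y = emb (P *v c) (P *v d)"
    and i: "integral_vec a" "integral_vec b" "integral_vec c" "integral_vec d" unfolding nak_fibre_def by blast
  then have "x + y = emb (P *v (a + c)) (P *v (b + d))"
    by (simp add: emb_add matrix_vector_right_distrib)
  moreover have "integral_vec (a + c)" "integral_vec (b + d)" using i by (auto simp: integral_vec_def)
  ultimately show ?thesis unfolding nak_fibre_def by blast
qed

lemma nak_fibre_minus: "x \<in> nak_fibre P \<Longrightarrow> - x \<in> nak_fibre P"
proof -
  assume "x \<in> nak_fibre P"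
  then obtain a b where "x = emb (P *v a) (P *v b)" and i: "integral_vec a" "integral_vec b"
    unfolding nak_fibre_def by blast
  then have "- x = emb (P *v (- a)) (P *v (- b))"
    by (simp add: emb_minus linear_neg[OF matrix_vector_mul_linear])
  moreover have "integral_vec (- a)" "integral_vec (- b)" using i by (auto simp: integral_vec_def)
  ultimately show ?thesis unfolding nak_fibre_def by blast
qed

lemma nak_fibre_0: "0 \<in> nak_fibre P"
proof -
  have "0 = emb (P *v 0) (P *v 0)" by simp
  then show ?thesis unfolding nak_fibre_def integral_vec_def by (auto intro!: exI[of _ 0])
qed

lemma of_int_det: "det (\<chi> i j. real_of_int (M $ i $ j)) = of_int (det (M :: int^'n^'n::finite))"
  by (simp add: det_def)

lemma integral_vec_mult:
  assumes "integral_vec x"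
  shows "integral_vec ((\<chi> i j. real_of_int (M $ i $ j)) *v x)"
  using assms by (auto simp: integral_vec_def matrix_vector_mult_def intro!: Ints_sum Ints_mult)

text \<open>
  Cramer's rule expresses the preimage by determinants of integral matrices.
\<close>

lemma integral_vec_unimodular_preimage:
  fixes M :: "int^'n^'n::finite"
  assumes M: "det M = 1" and y: "integral_vec y"
  shows "\<exists>x. integral_vec x \<and> (\<chi> i j. real_of_int (M $ i $ j)) *v x = y"
proof -
  let ?A = "\<chi> i j. real_of_int (M $ i $ j)"
  have d: "det ?A = 1" using M of_int_det[of M] by simp
  obtain b :: "int^'n" where b: "\<And>i. y $ i = of_int (b $ i)"
  proof -
    have "\<forall>i. \<exists>k::int. y $ i = of_int k" using y by (auto simp: integral_vec_def elim: Ints_cases)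
    then obtain f :: "'n \<Rightarrow> int" where "\<And>i. y $ i = of_int (f i)" by metis
    then show thesis using that[of "\<chi> i. f i"] by simp
  qed
  define x :: "real^'n" where "x = (\<chi> k. det (\<chi> i j. if j = k then y $ i else ?A $ i $ j) / det ?A)"
  have "?A *v x = y" using cramer[of ?A x y] d by (simp add: x_def)
  moreover have "x $ k \<in> \<int>" for k
  proof -
    have "(\<chi> i j. if j = k then y $ i else ?A $ i $ j) =
        (\<chi> i j. real_of_int ((\<chi> i j. if j = k then b $ i else M $ i $ j) $ i $ j))"
      by (simp add: vec_eq_iff b)
    then have "x $ k = of_int (det (\<chi> i j. if j = k then b $ i else M $ i $ j))"
      using of_int_det[of "\<chi> i j. if j = k then b $ i else M $ i $ j"] by (simp add: x_def d)
    then show ?thesis by simp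
  qed
  ultimately show ?thesis by (auto simp: integral_vec_def)
qed

locale nakamura_data =
  fixes M :: "int^'n^'n" and P :: "real^'n^'n" and lam :: "'n::finite \<Rightarrow> real" and \<tau> :: real
  assumes det_M: "det M = 1" and inv_P: "invertible P"
    and diag: "P ** (\<chi> i j. real_of_int (M $ i $ j)) ** matrix_inv P = diag_mat (\<lambda>i. exp (lam i))"
    and \<tau>: "\<tau> \<noteq> 0"
begin

abbreviation MR :: "real^'n^'n" where "MR \<equiv> \<chi> i j. real_of_int (M $ i $ j)"

lemma P_inverse: "P ** matrix_inv P = mat 1" "matrix_inv P ** P = mat 1"
  using someI_ex[OF inv_P[unfolded invertible_def], folded matrix_inv_def] by blast+

lemma diag_mat_mult: "diag_mat d *v u = (\<chi> i. d i * u $ i)" for u :: "real^'n"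
  by (simp add: diag_mat_def matrix_vector_mult_def vec_eq_iff if_distrib if_distribR sum.delta cong: if_cong)

lemma P_MR: "P *v (MR *v x) = (\<chi> i. exp (lam i) * (P *v x) $ i)"
proof -
  have "P ** MR = P ** MR ** matrix_inv P ** P" by (simp add: matrix_mul_assoc[symmetric] P_inverse)
  also have "\<dots> = diag_mat (\<lambda>i. exp (lam i)) ** P" by (simp only: diag)
  finally have "P *v (MR *v x) = diag_mat (\<lambda>i. exp (lam i)) *v (P *v x)"
    by (simp add: matrix_vector_mul_assoc)
  then show ?thesis by (simp add: diag_mat_mult)
qed

lemma sum_lam: "(\<Sum>i\<in>UNIV. lam i) = 0"
proof -
  have "(\<Prod>i\<in>UNIV. exp (lam i)) = det (diag_mat (\<lambda>i. exp (lam i)) :: real^'n^'n)"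
    by (subst det_diagonal) (auto simp: diag_mat_def)
  also have "\<dots> = det P * det MR * det (matrix_inv P)" by (simp add: diag[symmetric] det_mul)
  also have "\<dots> = det MR * det (P ** matrix_inv P)" by (simp add: det_mul)
  also have "\<dots> = 1" by (simp add: P_inverse of_int_det det_M)
  finally have "exp (\<Sum>i\<in>UNIV. lam i) = 1" by (simp add: exp_sum)
  then show ?thesis by simp
qed

text \<open>
  As \<open>P\<close> conjugates \<open>M\<close> to the dilation, the dilation acts on \<open>P\<close> applied to integral vectors through
  \<open>M\<close>, which is integral.  The inverse dilation needs \<open>det M = 1\<close>.
\<close>

lemma dil_fibre_1: "z \<in> nak_fibre P \<Longrightarrow> dil lam 1 z \<in> nak_fibre P"
proof -
  assume "z \<in> nak_fibre P"
  then obtain x y where z: "z = emb (P *v x) (P *v y)" and i: "integral_vec x" "integral_vec y"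
    unfolding nak_fibre_def by blast
  have "dil lam 1 z = emb (P *v (MR *v x)) (P *v (MR *v y))"
    unfolding z P_MR by (simp add: dil_def emb_def vec_eq_iff scaleR_conv_of_real algebra_simps)
  then show ?thesis unfolding nak_fibre_def using i integral_vec_mult by blast
qed

lemma dil_fibre_m1: "z \<in> nak_fibre P \<Longrightarrow> dil lam (- 1) z \<in> nak_fibre P"
proof -
  assume "z \<in> nak_fibre P"
  then obtain x y where z: "z = emb (P *v x) (P *v y)" and i: "integral_vec x" "integral_vec y"
    unfolding nak_fibre_def by blast
  obtain x' y' where x': "integral_vec x'" "MR *v x' = x" and y': "integral_vec y'" "MR *v y' = y"
    using integral_vec_unimodular_preimage[OF det_M] i by metis
  have "z = dil lam 1 (emb (P *v x') (P *v y'))"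
    unfolding z x'(2)[symmetric] y'(2)[symmetric] P_MR
    by (simp add: dil_def emb_def vec_eq_iff scaleR_conv_of_real algebra_simps)
  then have "dil lam (- 1) z = emb (P *v x') (P *v y')" by (simp add: dil_dil)
  then show ?thesis unfolding nak_fibre_def using x' y' by blast
qed

lemma dil_fibre: "z \<in> nak_fibre P \<Longrightarrow> dil lam (of_int a) z \<in> nak_fibre P"
proof (induction a rule: int_induct[where k=0])
  case base
  then show ?case by simp
next
  case (step1 a)
  then show ?case using dil_fibre_1[of "dil lam (of_int a) z"] by (simp add: dil_dil add.commute)
next
  case (step2 a)
  then show ?case using dil_fibre_m1[of "dil lam (of_int a) z"] by (simp add: dil_dil)
qed

lemma P_bound: "\<exists>K>0. \<forall>x. norm x \<le> K * norm (P *v x)"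
proof -
  obtain K where K: "K > 0" "\<And>u. norm (matrix_inv P *v u) \<le> norm u * K"
    using bounded_linear.pos_bounded[of "(*v) (matrix_inv P)"] matrix_vector_mul_bounded_linear by blast
  have "norm x \<le> K * norm (P *v x)" for x
    using K(2)[of "P *v x"] by (simp add: matrix_vector_mul_assoc P_inverse mult.commute)
  then show ?thesis using K(1) by blast
qed

lemma integral_vec_small: "integral_vec x \<Longrightarrow> norm x < 1 \<Longrightarrow> x = 0"
proof -
  assume x: "integral_vec x" "norm x < 1"
  have "x $ i = 0" for i
  proof -
    have "\<bar>x $ i\<bar> < 1" using component_le_norm_cart[of x i] x(2) by linarith
    moreover obtain k :: int where "x $ i = of_int k" using x(1) by (auto simp: integral_vec_def elim: Ints_cases)
    ultimately show ?thesis by simp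
  qed
  then show ?thesis by (simp add: vec_eq_iff)
qed

lemma norm_emb_ge: "norm u \<le> norm (emb u v)" "norm v \<le> norm (emb u v)"
proof -
  have "\<bar>u $ i\<bar> \<le> cmod (emb u v $ i)" "\<bar>v $ i\<bar> \<le> cmod (emb u v $ i)" for i
    using abs_Re_le_cmod[of "emb u v $ i"] abs_Im_le_cmod[of "emb u v $ i"] by (simp_all add: emb_def)
  then show "norm u \<le> norm (emb u v)" "norm v \<le> norm (emb u v)"
    unfolding norm_vec_def by (auto intro!: L2_set_mono)
qed

text \<open>
  The matrix \<open>P\<close> is bounded below, and a nonzero integral vector has norm at least 1.
\<close>

lemma nak_fibre_discrete: "\<exists>r>0. \<forall>z\<in>nak_fibre P. norm z < r \<longrightarrow> z = 0"
proof -
  obtain K where K: "K > 0" "\<And>x. norm x \<le> K * norm (P *v x)" using P_bound by blast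
  have "z = 0" if "z \<in> nak_fibre P" "norm z < 1 / K" for z
  proof -
    obtain x y where z: "z = emb (P *v x) (P *v y)" and i: "integral_vec x" "integral_vec y"
      using \<open>z \<in> nak_fibre P\<close> unfolding nak_fibre_def by blast
    have "norm w < 1" if "norm (P *v w) \<le> norm z" for w
    proof -
      have "norm w \<le> K * norm z" using K(2)[of w] that K(1) by (meson mult_left_mono order_trans less_imp_le)
      also have "\<dots> < 1" using \<open>norm z < 1 / K\<close> K(1) by (simp add: field_simps)
      finally show ?thesis .
    qed
    then have "x = 0" "y = 0" using integral_vec_small i norm_emb_ge(1)[of "P *v x" "P *v y"] norm_emb_ge(2)[of "P *v y" "P *v x"] z by auto
    then show ?thesis by (simp add: z)
  qed
  then show ?thesis using K(1) by (intro exI[of _ "1 / K"]) auto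
qed

text \<open>
  The part of the lattice that acts by translations.
\<close>

definition periods :: "(complex \<times> (complex^'n)) set" where
  "periods = {complex_of_real \<tau> * \<i> * of_int b | b. True} \<times> nak_fibre P"

lemma lattice_split: "nak_lattice P \<tau> = {(of_int a, 0) + p | a p. p \<in> periods}"
  unfolding nak_lattice_eq periods_def by force

lemma lattice_E:
  assumes "g \<in> nak_lattice P \<tau>"
  obtains a p where "g = (of_int a, 0) + p" "p \<in> periods" "Re (fst p) = 0"
  using assms unfolding lattice_split by (auto simp: periods_def)

lemma Re_fst_periods: "p \<in> periods \<Longrightarrow> Re (fst p) = 0"
  by (auto simp: periods_def)

lemma span_periods: "span (insert (1, 0) periods) = UNIV"
proof (intro equalityI subset_UNIV subsetI)
  fix x :: "complex \<times> (complex^'n)"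
  let ?S = "span (insert (1, 0) periods)"
  have emb_span: "(0, emb (P *v u) (P *v v)) \<in> ?S" for u v
  proof -
    define T where "T q = (0 :: complex, emb (P *v fst q) (P *v snd q))" for q :: "(real^'n) \<times> (real^'n)"
    have "linear T"
      by (rule linearI) (simp_all add: T_def emb_add emb_scaleR matrix_vector_right_distrib matrix_vector_mult_scaleR)
    moreover have "T ` Basis \<subseteq> periods"
    proof
      fix y assume "y \<in> T ` Basis"
      then obtain q where q: "q \<in> Basis" "y = T q" by blast
      have "integral_vec (fst q)" "integral_vec (snd q)"
        using q(1) by (auto simp: Basis_prod_def Basis_vec_def integral_vec_def axis_def)
      then have "emb (P *v fst q) (P *v snd q) \<in> nak_fibre P" unfolding nak_fibre_def by blast
      then show "y \<in> periods" unfolding q(2) T_def periods_def by (auto intro!: exI[of _ 0])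
    qed
    ultimately have "T (u, v) \<in> span periods"
      using linear_span_image[of T Basis] span_mono[of "T ` Basis" periods] by auto
    then show ?thesis using span_mono[of periods "insert (1, 0) periods"] by (auto simp: T_def)
  qed
  have "(complex_of_real \<tau> * \<i>, 0) \<in> periods"
    unfolding periods_def using nak_fibre_0 by (auto intro!: exI[of _ 1])
  then have 1: "(complex_of_real \<tau> * \<i>, 0) \<in> ?S" by (intro span_base) simp
  have 2: "(1, 0) \<in> ?S" by (intro span_base) simp
  obtain w z where x: "x = (w, z)" by fastforce
  have zz: "z = emb (P *v (matrix_inv P *v (\<chi> i. Re (z $ i)))) (P *v (matrix_inv P *v (\<chi> i. Im (z $ i))))"
    by (simp add: matrix_vector_mul_assoc P_inverse emb_def vec_eq_iff complex_eq)
  have "x = Re w *\<^sub>R (1, 0) + (Im w / \<tau>) *\<^sub>R (complex_of_real \<tau> * \<i>, 0) + (0, z)"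
    using \<tau> by (simp add: x complex_eq_iff)
  moreover have "(0, z) \<in> ?S" using emb_span by (subst zz)
  ultimately show "x \<in> ?S" using 1 2 by (metis span_add span_scale)
qed

lemma nak_linear_periods: "p \<in> periods \<Longrightarrow> nak_linear lam (of_int a) p \<in> periods"
  using dil_fibre by (auto simp: periods_def nak_linear_def)

sublocale mapping_torus "nak_linear lam 1" "nak_linear lam (- 1)" "\<lambda>b. exp (weight lam b * 1)" "(1, 0)" "\<lambda>x. Re (fst x)" periods
proof (rule mapping_torus.intro)
  show "linear (nak_linear lam 1)" "linear (nak_linear lam (- 1))" by (rule linear_nak_linear)+
  show "nak_linear lam 1 (nak_linear lam (- 1) x) = x" "nak_linear lam (- 1) (nak_linear lam 1 x) = x" for x
    by (simp_all add: nak_linear_add)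
  show "b \<in> Basis \<Longrightarrow> nak_linear lam 1 b = exp (weight lam b * 1) *\<^sub>R b" for b by (rule nak_linear_Basis)
  show "exp (weight lam b * 1) \<noteq> 0" for b by simp
  show "nak_linear lam 1 (1, 0) = (1, 0)" by (simp add: nak_linear_def linear_0[OF linear_dil])
  show "linear (\<lambda>x :: complex \<times> (complex^'n). Re (fst x))" by (rule linearI) simp_all
  show "Re (fst (1, 0)) = 1" by simp
  show "Re (fst (nak_linear lam 1 x)) = Re (fst x)" for x by simp
  show "a \<in> periods \<Longrightarrow> Re (fst a) = 0" for a by (rule Re_fst_periods)
  show "a \<in> periods \<Longrightarrow> nak_linear lam 1 a \<in> periods" "a \<in> periods \<Longrightarrow> nak_linear lam (- 1) a \<in> periods" for a
    using nak_linear_periods[of a 1] nak_linear_periods[of a "- 1"] by simp_all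
  show "span (insert (1, 0) periods) = UNIV" by (rule span_periods)
qed

abbreviation Aff :: "complex \<times> (complex^'n) \<Rightarrow> complex \<times> (complex^'n) \<Rightarrow> complex \<times> (complex^'n)" where
  "Aff g \<equiv> nak_linear lam (Re (fst g))"

text \<open>
  The distance of a point from its image bounds the first coordinate of the group element.  If this distance is less than
  1 and less than the absolute value of \<open>\<tau>\<close>, that coordinate is 0, so the element is a translation by a vector of the
  discrete set \<open>nak_fibre P\<close>.
\<close>

lemma affine_quotient_lattice: "\<exists>r. affine_quotient (nak_group lam) (nak_lattice P \<tau>) Aff r"
proof -
  let ?G = "nak_group lam" and ?\<Gamma> = "nak_lattice P \<tau>"
  obtain r0 where r0: "r0 > 0" "\<And>z. z \<in> nak_fibre P \<Longrightarrow> norm z < r0 \<Longrightarrow> z = 0" using nak_fibre_discrete by blast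
  have lat: "g \<in> ?\<Gamma> \<longleftrightarrow> (\<exists>a b. fst g = of_int a + complex_of_real \<tau> * \<i> * of_int b) \<and> snd g \<in> nak_fibre P" for g
    by (cases g) (auto simp: nak_lattice_eq)
  have "affine_quotient ?G ?\<Gamma> Aff (min r0 (min 1 \<bar>\<tau>\<bar>))"
  proof (rule affine_quotient.intro)
    show "g \<otimes>\<^bsub>?G\<^esub> x = Aff g x + g" for g x by (rule nak_mult)
    show "linear (Aff g)" for g by (rule linear_nak_linear)
    show "0 \<in> ?\<Gamma>" unfolding lat using nak_fibre_0 by (auto intro!: exI[of _ 0])
    show "Aff 0 x = x" for x by simp
    show "0 < min r0 (min 1 \<bar>\<tau>\<bar>)" using r0 \<tau> by simp
  next
    fix g h assume gh: "g \<in> ?\<Gamma>" "h \<in> ?\<Gamma>"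
    obtain a b where a: "fst g = of_int a + complex_of_real \<tau> * \<i> * of_int b" using gh lat by blast
    obtain c d where c: "fst h = of_int c + complex_of_real \<tau> * \<i> * of_int d" using gh lat by blast
    let ?k = "Aff g h + g"
    have "fst ?k = of_int (c + a) + complex_of_real \<tau> * \<i> * of_int (d + b)" by (simp add: a c algebra_simps)
    moreover have "snd ?k \<in> nak_fibre P"
      using gh dil_fibre[of "snd h" a] a by (simp add: lat nak_linear_def nak_fibre_add)
    ultimately have "?k \<in> ?\<Gamma>" unfolding lat by blast
    moreover have "g \<otimes>\<^bsub>?G\<^esub> (h \<otimes>\<^bsub>?G\<^esub> x) = ?k \<otimes>\<^bsub>?G\<^esub> x" for x
      by (simp add: nak_mult linear_add[OF linear_nak_linear] nak_linear_add add_ac)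
    ultimately show "\<exists>k\<in>?\<Gamma>. \<forall>x. g \<otimes>\<^bsub>?G\<^esub> (h \<otimes>\<^bsub>?G\<^esub> x) = k \<otimes>\<^bsub>?G\<^esub> x" by blast
  next
    fix g assume g: "g \<in> ?\<Gamma>"
    obtain a b where a: "fst g = of_int a + complex_of_real \<tau> * \<i> * of_int b" using g lat by blast
    \<comment> \<open>the inverse of g in the group\<close>
    let ?h = "- nak_linear lam (- Re (fst g)) g"
    have "fst ?h = of_int (- a) + complex_of_real \<tau> * \<i> * of_int (- b)" by (simp add: a algebra_simps)
    moreover have "snd ?h \<in> nak_fibre P"
      using g dil_fibre[of "snd g" "- a"] a by (simp add: lat nak_linear_def nak_fibre_minus)
    ultimately have "?h \<in> ?\<Gamma>" unfolding lat by blast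
    moreover have "?h \<otimes>\<^bsub>?G\<^esub> (g \<otimes>\<^bsub>?G\<^esub> x) = x" for x
      by (simp add: nak_mult linear_add[OF linear_nak_linear] nak_linear_add)
    ultimately show "\<exists>h\<in>?\<Gamma>. \<forall>x. h \<otimes>\<^bsub>?G\<^esub> (g \<otimes>\<^bsub>?G\<^esub> x) = x" by blast
  next
    fix g x assume g: "g \<in> ?\<Gamma>" and near: "dist (g \<otimes>\<^bsub>?G\<^esub> x) x < min r0 (min 1 \<bar>\<tau>\<bar>)"
    obtain a b where a: "fst g = of_int a + complex_of_real \<tau> * \<i> * of_int b" using g lat by blast
    have d: "norm (Aff g x + g - x) < min r0 (min 1 \<bar>\<tau>\<bar>)" using near by (simp add: nak_mult dist_norm)
    have f: "fst (Aff g x + g - x) = fst g" by simp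
    have ng: "cmod (fst g) < min 1 \<bar>\<tau>\<bar>"
    proof -
      have "norm (fst q) \<le> norm q" for q :: "complex \<times> (complex^'n)" by (metis norm_fst_le prod.collapse)
      from this[of "Aff g x + g - x"] show ?thesis using d unfolding f by simp
    qed
    have "\<bar>real_of_int a\<bar> < 1" using abs_Re_le_cmod[of "fst g"] ng by (simp add: a)
    then have a0: "a = 0" by linarith
    have "\<bar>\<tau> * real_of_int b\<bar> < \<bar>\<tau>\<bar>" using abs_Im_le_cmod[of "fst g"] ng by (simp add: a)
    then have "\<bar>real_of_int b\<bar> < 1" using \<tau> by (simp add: abs_mult)
    then have b0: "b = 0" by linarith
    have g0: "fst g = 0" by (simp add: a a0 b0)
    then have "norm g < r0" using d by simp
    then have "norm (snd g) < r0" using norm_snd_le[of "snd g" "fst g"] by simp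
    then have "snd g = 0" using r0(2) g lat by blast
    then show "g \<otimes>\<^bsub>?G\<^esub> x = x" using g0 by (simp add: nak_mult prod_eq_iff)
  qed
  then show ?thesis by blast
qed

text \<open>
  A name for the radius provided by the preceding lemma, because the instantiation of the locale needs a term.
\<close>

definition radius :: real where
  "radius = (SOME r. affine_quotient (nak_group lam) (nak_lattice P \<tau>) Aff r)"

sublocale affine_quotient "nak_group lam" "nak_lattice P \<tau>" Aff radius
  unfolding radius_def using affine_quotient_lattice by (rule someI_ex)

text \<open>
  Iterating the invariance under \<open>x \<mapsto> L x + e\<close> in both directions; together with the periods this gives
  invariance under the whole lattice.
\<close>

lemma invariant_integer_translation:
  assumes inv: "invariant \<eta>"
  shows "\<eta> (nak_linear lam (of_int a) x + (of_int a, 0)) (\<lambda>i. nak_linear lam (of_int a) (v i)) = \<eta> x v"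
proof -
  have one: "\<eta> (nak_linear lam 1 x + (1, 0)) (\<lambda>i. nak_linear lam 1 (v i)) = \<eta> x v" for x v
  proof -
    have "pull \<eta> = \<eta>" using inv by (simp add: invariant_def)
    from fun_cong[OF fun_cong[OF this, of x], of v] show ?thesis by (simp add: affine_pull_def)
  qed
  have step: "\<eta> (nak_linear lam (t + 1) x + (of_real (t + 1), 0)) (\<lambda>i. nak_linear lam (t + 1) (v i)) =
      \<eta> (nak_linear lam t x + (of_real t, 0)) (\<lambda>i. nak_linear lam t (v i))" for t x v
  proof -
    have "nak_linear lam 1 (nak_linear lam t x + (of_real t, 0)) + (1, 0) = nak_linear lam (t + 1) x + (of_real (t + 1), 0)"
      by (simp add: linear_add[OF linear_nak_linear] nak_linear_add)
        (simp add: nak_linear_def linear_0[OF linear_dil] add.commute)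
    then show ?thesis
      using one[of "nak_linear lam t x + (of_real t, 0)" "\<lambda>i. nak_linear lam t (v i)"]
      by (simp add: nak_linear_add add.commute)
  qed
  show ?thesis
  proof (induction a rule: int_induct[where k=0])
    case base
    have "(0, 0) = (0 :: complex \<times> (complex^'n))" by (simp add: zero_prod_def)
    then show ?case by simp
  next
    case (step1 a)
    then show ?case using step[of "of_int a" x v] by simp
  next
    case (step2 a)
    then show ?case using step[of "of_int a - 1" x v] by simp
  qed
qed

sublocale mapping_torus_quotient "nak_linear lam 1" "nak_linear lam (- 1)" "\<lambda>b. exp (weight lam b * 1)" "(1, 0)" "\<lambda>x. Re (fst x)" periods
  "nak_group lam" "nak_lattice P \<tau>" Aff radius
proof
  fix \<eta>
  show "invariant_form \<eta> \<longleftrightarrow> invariant \<eta>"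
  proof
    assume inv: "invariant_form \<eta>"
    have "\<eta> (x + p) = \<eta> x" if "p \<in> periods" for p x
    proof -
      have "(of_int 0, 0) + p \<in> nak_lattice P \<tau>" unfolding lattice_split using that by blast
      then have "p \<in> nak_lattice P \<tau>" by (simp add: zero_prod_def[symmetric])
      then have "affine_pull (Aff p) p \<eta> = \<eta>" using inv by (simp add: invariant_form_def)
      from fun_cong[OF this, of x] show ?thesis
        using Re_fst_periods[OF that] by (simp add: affine_pull_def fun_eq_iff)
    qed
    moreover have "pull \<eta> = \<eta>"
    proof -
      have "0 \<in> periods" using nak_fibre_0 by (auto simp: periods_def zero_prod_def intro!: exI[of _ 0])
      then have "(of_int 1, 0) + 0 \<in> nak_lattice P \<tau>" unfolding lattice_split by blast
      then have "(1, 0) \<in> nak_lattice P \<tau>" by simp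
      then have "affine_pull (Aff (1, 0)) (1, 0) \<eta> = \<eta>" using inv unfolding invariant_form_def by blast
      then show ?thesis by simp
    qed
    ultimately show "invariant \<eta>" by (simp add: invariant_def periodic_def)
  next
    assume inv: "invariant \<eta>"
    show "invariant_form \<eta>"
      unfolding invariant_form_def
    proof (intro ballI ext)
      fix g x v assume "g \<in> nak_lattice P \<tau>"
      then obtain a p where g: "g = (of_int a, 0) + p" "p \<in> periods" "Re (fst p) = 0" by (rule lattice_E)
      have A: "Aff g = nak_linear lam (of_int a)" using g by simp
      have "\<eta> (nak_linear lam (of_int a) x + (of_int a, 0) + p) = \<eta> (nak_linear lam (of_int a) x + (of_int a, 0))"
        using inv periodicD[OF _ g(2), of \<eta>] by (simp add: invariant_def)
      then show "affine_pull (Aff g) g \<eta> x v = \<eta> x v"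
        using invariant_integer_translation[OF inv, of a x v]
        unfolding affine_pull_def A g(1) by (simp add: add.assoc g(3))
    qed
  qed
qed

end

section \<open>Invariant symplectic forms as forms on the group\<close>

lemma alt_power_pull: "alt_power w r (\<lambda>i. L (v i)) = alt_power (\<lambda>v. w (\<lambda>i. L (v i))) r v"
proof (induction r arbitrary: v)
  case 0
  show ?case by simp
next
  case (Suc r)
  have "alt_power (\<lambda>v. w (\<lambda>i. L (v i))) r = (\<lambda>v. alt_power w r (\<lambda>i. L (v i)))"
    using Suc.IH by (intro ext) (rule sym)
  then show ?case using alt_wedge_pull[of 2 "2 * r" w L "alt_power w r" v] by simp
qed

lemma nondegenerate_iff:
  assumes w: "alternating 2 w"
  shows "nondegenerate w \<longleftrightarrow> (\<forall>u. (\<forall>v. w (\<lambda>i. if i = 0 then u else v) = 0) \<longrightarrow> u = 0)"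
proof -
  have 1: "w (case_nat u v) = w (\<lambda>i. if i = 0 then u else v 0)" for u v
    by (rule alternating_cong[OF w]) (auto split: nat.split simp: less_Suc_eq numeral_2_eq_2)
  have "(\<forall>v. contr 2 u w v = 0) \<longleftrightarrow> (\<forall>v. w (\<lambda>i. if i = 0 then u else v) = 0)" for u
  proof
    assume *: "\<forall>v. contr 2 u w v = 0"
    show "\<forall>v. w (\<lambda>i. if i = 0 then u else v) = 0"
    proof
      fix v show "w (\<lambda>i. if i = 0 then u else v) = 0"
        using *[rule_format, of "\<lambda>_. v"] 1[of u "\<lambda>_. v"] by (simp add: contr_2)
    qed
  next
    assume *: "\<forall>v. w (\<lambda>i. if i = 0 then u else v) = 0"
    show "\<forall>v. contr 2 u w v = 0" by (simp add: contr_2 1 *)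
  qed
  then show ?thesis by (simp add: nondegenerate_def)
qed

context nakamura_data
begin

lemma DIM_nak: "DIM(complex \<times> (complex^'n)) = 2 * (CARD('n) + 1)"
  by simp

definition left_invariant :: "(complex \<times> (complex^'n) \<Rightarrow> (complex \<times> (complex^'n)) multiform) \<Rightarrow> bool" where
  "left_invariant \<eta> \<longleftrightarrow> (\<forall>g. affine_pull (Aff g) g \<eta> = \<eta>)"

definition symplectic_on_group :: "(complex \<times> (complex^'n) \<Rightarrow> (complex \<times> (complex^'n)) multiform) \<Rightarrow> bool" where
  "symplectic_on_group \<eta> \<longleftrightarrow> smooth_form 2 \<eta> \<and> left_invariant \<eta> \<and>
     dext 2 \<eta> = (\<lambda>x v. 0) \<and> (\<forall>x. nondegenerate (\<eta> x))"

lemma pullback_left_mult: "pullback (\<lambda>x. g \<otimes>\<^bsub>nak_group lam\<^esub> x) \<eta> = affine_pull (Aff g) g \<eta>"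
proof -
  have "((\<lambda>x. g \<otimes>\<^bsub>nak_group lam\<^esub> x) has_derivative Aff g) (at x)" for x
    unfolding nak_mult using linear_nak_linear[of lam "Re (fst g)"]
    by (auto intro!: derivative_eq_intros bounded_linear_imp_has_derivative simp: linear_conv_bounded_linear)
  from frechet_derivative_at[OF this] show ?thesis
    by (simp add: pullback_def affine_pull_def[abs_def] nak_mult)
qed

lemma left_invariant_forms_iff:
  "\<eta> \<in> left_invariant_forms (nak_group lam) k \<longleftrightarrow> smooth_form k \<eta> \<and> left_invariant \<eta>"
  unfolding left_invariant_forms_def pullback_left_mult left_invariant_def by (auto simp: smooth_form_def nak_group_def)

text \<open>
  An invariant symplectic structure on the quotient is the same as a left-invariant symplectic form on the group.
\<close>

lemma invariant_symplectic_iff: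
  "invariant_symplectic lam P \<tau> \<omega> \<longleftrightarrow> (\<exists>\<eta>. \<omega> = descend \<eta> \<and> symplectic_on_group \<eta>)"
proof
  assume "invariant_symplectic lam P \<tau> \<omega>"
  then have inv: "\<omega> \<in> invariant_forms (nak_group lam) (nak_lattice P \<tau>) 2" and sy: "symplectic_form atlas \<omega>"
    by (auto simp: invariant_symplectic_def nakamura_def)
  from inv obtain \<eta> where om: "\<omega> \<in> diff_forms atlas 2" and \<eta>: "\<eta> \<in> left_invariant_forms (nak_group lam) 2"
    and eq: "\<forall>c\<in>atlas. \<forall>x\<in>chart_image c. \<omega> c x = \<eta> x" unfolding invariant_forms_def by blast
  have sf: "smooth_form 2 \<eta>" and li: "left_invariant \<eta>" using \<eta> left_invariant_forms_iff by auto
  have Z: "\<forall>c x v. c \<notin> atlas \<or> x \<notin> chart_image c \<longrightarrow> \<omega> c x v = 0"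
    using om unfolding diff_forms_def by blast
  have de: "\<omega> = descend \<eta>"
  proof (intro ext)
    fix c x v
    show "\<omega> c x v = descend \<eta> c x v"
      using Z[rule_format, of c x v] eq by (auto simp: descend_def)
  qed
  have "\<omega> \<in> closed_forms atlas 2" using sy by (simp add: symplectic_form_def)
  then obtain \<eta>' where "\<omega> = descend \<eta>'" "closed_inv 2 \<eta>'" unfolding closed_forms_image by blast
  then have cl: "dext 2 \<eta> = (\<lambda>x v. 0)" using de descend_inject by (simp add: closed_inv_def)
  have "nondegenerate (\<eta> x)" for x
  proof -
    obtain c where c: "c \<in> atlas" "x \<in> chart_image c" using ex_chart by blast
    then have "\<omega> c x = \<eta> x" using eq by blast
    then show ?thesis
      using sy c unfolding symplectic_form_def nondegenerate_iff[OF smooth_formD(1)[OF sf]] by metis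
  qed
  then show "\<exists>\<eta>. \<omega> = descend \<eta> \<and> symplectic_on_group \<eta>"
    using de sf li cl unfolding symplectic_on_group_def by blast
next
  assume "\<exists>\<eta>. \<omega> = descend \<eta> \<and> symplectic_on_group \<eta>"
  then obtain \<eta> where de: "\<omega> = descend \<eta>" and \<eta>: "smooth_form 2 \<eta>" "left_invariant \<eta>"
    "dext 2 \<eta> = (\<lambda>x v. 0)" "\<And>x. nondegenerate (\<eta> x)" unfolding symplectic_on_group_def by blast
  have inv: "invariant_form \<eta>" using \<eta>(2) unfolding left_invariant_def invariant_form_def by blast
  have val: "\<omega> c x = \<eta> x" if "c \<in> atlas" "x \<in> chart_image c" for c x
    using that by (auto simp: de descend_def)
  have "\<omega> \<in> invariant_forms (nak_group lam) (nak_lattice P \<tau>) 2"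
    unfolding invariant_forms_def
    using descend_in_diff_forms[OF \<eta>(1) inv] left_invariant_forms_iff[of \<eta> 2] \<eta>(1,2) val de by blast
  moreover have "\<omega> \<in> closed_forms atlas 2"
    unfolding closed_forms_image de using \<eta> inv invariant_form_iff by (auto simp: closed_inv_def)
  moreover have "\<forall>c\<in>atlas. \<forall>x\<in>chart_image c. \<forall>u. (\<forall>v. \<omega> c x (\<lambda>i. if i = 0 then u else v) = 0) \<longrightarrow> u = 0"
    using \<eta>(4) val unfolding nondegenerate_iff[OF smooth_formD(1)[OF \<eta>(1)]] by simp
  ultimately show "invariant_symplectic lam P \<tau> \<omega>"
    by (simp add: invariant_symplectic_def symplectic_form_def nakamura_def)
qed

lemma value_at_origin:
  assumes "left_invariant \<eta>"
  shows "\<eta> x (\<lambda>i. Aff x (v i)) = \<eta> 0 v"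
proof -
  have "affine_pull (Aff x) x \<eta> = \<eta>" using assms unfolding left_invariant_def by blast
  then have "affine_pull (Aff x) x \<eta> 0 v = \<eta> 0 v" by simp
  then show ?thesis by (simp add: affine_pull_def linear_0[OF linear_nak_linear])
qed

text \<open>
  The top power of \<open>\<eta>\<close> at \<open>x\<close> is that at the origin, transported by a diagonal map of determinant 1; so it is the same
  form at all points, which makes the theorem on mapping tori applicable.
\<close>

theorem symplectic_hard_lefschetz:
  assumes "symplectic_on_group \<eta>"
  shows "hard_lefschetz atlas (descend \<eta>)"
proof -
  have sf: "smooth_form 2 \<eta>" and li: "left_invariant \<eta>" and cl: "dext 2 \<eta> = (\<lambda>x v. 0)"
    and nd: "\<And>x. nondegenerate (\<eta> x)" using assms unfolding symplectic_on_group_def by blast+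
  have "invariant_form \<eta>" using li unfolding left_invariant_def invariant_form_def by blast
  then have ci: "closed_inv 2 \<eta>"
    using sf cl unfolding closed_inv_def invariant_form_iff by blast
  let ?d = "CARD('n) + 1"
  define T where "T = alt_power (\<eta> 0) ?d"
  have D: "DIM(complex \<times> (complex^'n)) = 2 * ?d" by (rule DIM_nak)
  have alt: "alternating DIM(complex \<times> (complex^'n)) (alt_power (\<eta> x) ?d)" for x
    unfolding D by (rule alternating_power[OF smooth_formD(1)[OF sf]])
  have top: "alt_power (\<eta> x) ?d (\<lambda>i. nak_linear lam t (v i)) = alt_power (\<eta> x) ?d v" for x t v
    by (rule top_form_diagonal[OF alt linear_nak_linear nak_linear_Basis prod_Basis_weight[OF sum_lam]])
  have "alt_power (\<eta> x) ?d v = T v" for x v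
  proof -
    have "(\<lambda>v. \<eta> x (\<lambda>i. Aff x (v i))) = \<eta> 0" by (intro ext) (rule value_at_origin[OF li])
    then have "T v = alt_power (\<eta> x) ?d (\<lambda>i. Aff x (v i))" unfolding T_def alt_power_pull by simp
    then show ?thesis using top by simp
  qed
  then have Tx: "alt_power (\<eta> x) ?d = T" for x by (intro ext)
  have "harmonic (2 * ?d) T"
    unfolding harmonic_def T_def using alt[of 0] top[of 0 1] unfolding D by blast
  moreover obtain u where "T u \<noteq> 0"
    using alt_power_nonzero[OF smooth_formD(1)[OF sf] nd, of ?d 0] D unfolding T_def by auto
  ultimately show ?thesis by (intro hard_lefschetz_descend[OF ci D _ Tx])
qed

section \<open>Weights of an invariant symplectic form\<close>

lemma e_Basis: "(1, 0) \<in> (Basis :: (complex \<times> (complex^'n)) set)"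
  by (auto simp: Basis_nak)

lemma Re_fst_Basis: "b \<in> (Basis :: (complex \<times> (complex^'n)) set) \<Longrightarrow> b \<noteq> (1, 0) \<Longrightarrow> Re (fst b) = 0"
  by (erule nak_Basis_cases) auto

text \<open>
  Left invariance determines \<open>\<eta>\<close> at \<open>y\<close> by its value at the origin, through a map that scales basis vectors.
\<close>

lemma invariant_form_on_Basis:
  assumes sf: "smooth_form 2 \<eta>" and li: "left_invariant \<eta>"
    and ab: "a \<in> Basis" "b \<in> Basis" and w: "w 0 = b"
  shows "\<eta> y (case_nat a w) = exp (- (weight lam a + weight lam b) * Re (fst y)) * \<eta> 0 (case_nat a (\<lambda>_. b))"
proof -
  let ?t = "Re (fst y)"
  let ?v = "case_nat a (\<lambda>_. b)" and ?s = "case_nat (exp (weight lam a * ?t)) (\<lambda>_. exp (weight lam b * ?t))"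
  have eq: "\<eta> y (case_nat a w) = \<eta> y ?v"
    using w by (intro alternating_cong[OF smooth_formD(1)[OF sf]]) (auto split: nat.split simp: less_Suc_eq numeral_2_eq_2)
  have "\<eta> 0 ?v = \<eta> y (\<lambda>i. Aff y (?v i))" by (rule value_at_origin[OF li, symmetric])
  also have "(\<lambda>i. Aff y (?v i)) = (\<lambda>i. ?s i *\<^sub>R ?v i)"
    using nak_linear_Basis[OF ab(1), of lam ?t] nak_linear_Basis[OF ab(2), of lam ?t]
    by (intro ext) (simp split: nat.split)
  also have "\<eta> y \<dots> = (\<Prod>i<2. ?s i) * \<eta> y ?v" by (rule alternating_scale_all[OF smooth_formD(1)[OF sf]])
  also have "(\<Prod>i<2. ?s i) = exp ((weight lam a + weight lam b) * ?t)"
    by (simp add: numeral_2_eq_2 exp_add[symmetric] distrib_right)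
  finally have "\<eta> 0 ?v = exp ((weight lam a + weight lam b) * ?t) * \<eta> y ?v" .
  then show ?thesis
    unfolding eq by (simp add: mult.assoc[symmetric] exp_add[symmetric] distrib_right[symmetric])
qed

text \<open>
  Cartan's formula for \<open>e = (1, 0)\<close> at the origin: the derivative of the coefficient at \<open>(a, b)\<close> in the direction
  \<open>e\<close> is its value times \<open>- (weight a + weight b)\<close>, and the other term vanishes, because all coefficients depend only on the real
  part of the first coordinate and \<open>a\<close> and \<open>b\<close> are different from \<open>e\<close>.
\<close>

lemma closed_weights:
  assumes sf: "smooth_form 2 \<eta>" and li: "left_invariant \<eta>" and cl: "dext 2 \<eta> = (\<lambda>x v. 0)"
    and ab: "a \<in> Basis" "b \<in> Basis" "a \<noteq> (1, 0)" "b \<noteq> (1, 0)"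
  shows "(weight lam a + weight lam b) * \<eta> 0 (case_nat a (\<lambda>_. b)) = 0"
proof -
  let ?e = "(1, 0) :: complex \<times> (complex^'n)"
  let ?v = "case_nat a (\<lambda>_. b)"
  let ?z = "\<lambda>y. contr 2 ?e (\<eta> y)"
  have dexp: "dd h (\<lambda>y. exp (c * Re (fst y)) * B) 0 = c * Re (fst h) * B" for h :: "complex \<times> (complex^'n)" and c B
    by (rule dd_eqI) (auto intro!: derivative_eq_intros simp: algebra_simps)
  have z: "?z y w = exp (- (weight lam ?e + weight lam d) * Re (fst y)) * \<eta> 0 (case_nat ?e (\<lambda>_. d))"
    if "d \<in> Basis" "w 0 = d" for y w d
    unfolding contr_2 by (rule invariant_form_on_Basis[OF sf li e_Basis that(1), where w=w, OF that(2)])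
  have dz: "dd h (\<lambda>y. ?z y w) 0 = 0" if "h \<in> Basis" "h \<noteq> ?e" "w 0 \<in> Basis" for h w
    unfolding z[where d="w 0" and w=w, OF that(3) refl] dexp using Re_fst_Basis[OF that(1,2)] by simp
  have "dext 1 ?z 0 ?v = 0"
    using dz[of a "\<lambda>j. ?v (Suc j)"] dz[of b "\<lambda>j. if j < Suc 0 then ?v j else ?v (Suc j)"] ab
    by (simp add: dext_def)
  moreover have "fdd ?e \<eta> 0 ?v = - (weight lam a + weight lam b) * \<eta> 0 ?v"
  proof -
    have "(\<lambda>y. \<eta> y ?v) = (\<lambda>y. exp (- (weight lam a + weight lam b) * Re (fst y)) * \<eta> 0 ?v)"
      by (rule ext) (rule invariant_form_on_Basis[OF sf li ab(1,2)], simp)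
    then show ?thesis unfolding fdd_def by (simp only: dexp) simp
  qed
  moreover have "0 = fdd ?e \<eta> 0 ?v - dext (2 - 1) ?z 0 ?v"
    using contr_dext[of 2 ?e \<eta> 0 ?v] by (simp only: cl contr_Suc)
  ultimately show ?thesis by auto
qed

definition weight_basis :: "real \<Rightarrow> (complex \<times> (complex^'n)) set" where
  "weight_basis t = {b \<in> Basis. weight lam b = t}"

text \<open>
  Each complex coordinate contributes two real basis vectors.
\<close>

lemma card_weight_basis:
  assumes "t \<noteq> 0"
  shows "card (weight_basis t) = 2 * card {i. lam i = t}"
proof -
  let ?f = "\<lambda>(i, c). (0 :: complex, axis i c :: complex^'n)"
  have "weight_basis t = ?f ` ({i. lam i = t} \<times> {1, \<i>})"
  proof (intro equalityI subsetI)
    fix b assume b: "b \<in> weight_basis t"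
    then have "b \<in> Basis" "weight lam b = t" by (auto simp: weight_basis_def)
    then show "b \<in> ?f ` ({i. lam i = t} \<times> {1, \<i>})"
    proof (elim nak_Basis_cases)
      fix c assume "b = (c, 0)"
      then show ?thesis using \<open>weight lam b = t\<close> assms by simp
    next
      fix i c assume ic: "b = (0, axis i c)" "c \<in> {1, \<i>}"
      then have "lam i = t" using \<open>weight lam b = t\<close> weight_axis[of c lam i] by auto
      then show ?thesis using ic by (intro image_eqI[of _ _ "(i, c)"]) auto
    qed
  next
    fix b assume "b \<in> ?f ` ({i. lam i = t} \<times> {1, \<i>})"
    then show "b \<in> weight_basis t" by (auto simp: weight_basis_def Basis_nak weight_axis)
  qed
  moreover have "inj_on ?f ({i. lam i = t} \<times> {1, \<i>})" by (auto simp: inj_on_def axis_eq_axis)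
  moreover have "card {1, \<i>} = 2" by (simp add: complex_i_not_one[symmetric])
  ultimately show ?thesis by (simp add: card_image card_cartesian_product)
qed

text \<open>
  A vector of nonzero weight \<open>t\<close> pairs to 0 with all basis vectors except \<open>e\<close> and those of weight \<open>- t\<close>.  By
  nondegeneracy the map \<open>G\<close> that records its pairings with these is injective on the space of weight \<open>t\<close>, so
  \<open>2 * card {i. lam i = t} \<le> 2 * card {i. lam i = - t} + 1\<close>, and parity removes the 1.
\<close>

lemma weight_multiplicity_le:
  assumes "symplectic_on_group \<eta>" and t: "t \<noteq> 0"
  shows "card {i. lam i = t} \<le> card {i. lam i = - t}"
proof -
  have sf: "smooth_form 2 \<eta>" and li: "left_invariant \<eta>" and cl: "dext 2 \<eta> = (\<lambda>x v. 0)"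
    and nd: "nondegenerate (\<eta> 0)" using assms(1) unfolding symplectic_on_group_def by blast+
  let ?e = "(1, 0) :: complex \<times> (complex^'n)"
  let ?C = "insert ?e (weight_basis (- t))"
  define W where "W u b = \<eta> 0 (case_nat u (\<lambda>_. b))" for u b
  have a2: "alternating (Suc (Suc 0)) (\<eta> 0)" using smooth_formD(1)[OF sf] by (simp add: numeral_2_eq_2)
  have linW: "linear (\<lambda>u. W u b)" for b unfolding W_def by (rule linear_contr[OF a2])
  define G where "G u = (\<Sum>b\<in>?C. W u b *\<^sub>R b)" for u
  have C: "?C \<subseteq> Basis" "finite ?C" using e_Basis by (auto simp: weight_basis_def intro: finite_subset[OF _ finite_Basis])
  have linG: "linear G"
    unfolding G_def using linear_add[OF linW] linear_scale[OF linW]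
    by (intro linear_compose_sum ballI linearI) (simp_all add: scaleR_add_left)
  have Gb: "G u \<bullet> b = W u b" if b: "b \<in> ?C" for u b
  proof -
    have "G u \<bullet> b = (\<Sum>c\<in>?C. if c = b then W u c else 0)"
      unfolding G_def inner_sum_left
    proof (rule sum.cong[OF refl])
      fix c assume "c \<in> ?C"
      then have "c \<in> Basis" "b \<in> Basis" using C(1) b by blast+
      then show "(W u c *\<^sub>R c) \<bullet> b = (if c = b then W u c else 0)" by (simp add: inner_Basis)
    qed
    also have "\<dots> = W u b" using C(2) b by (simp only: sum.delta if_True)
    finally show ?thesis .
  qed
  have ker: "u = 0" if u: "u \<in> span (weight_basis t)" and G0: "G u = 0" for u
  proof -
    have Wb: "W u b = 0" if b: "b \<in> Basis" for b
    proof (cases "b \<in> ?C")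
      case True
      then show ?thesis using Gb[OF True, of u] G0 by simp
    next
      case False
      then have bw: "b \<noteq> ?e" "weight lam b \<noteq> - t" using b by (auto simp: weight_basis_def)
      have "W a b = 0" if "a \<in> weight_basis t" for a
      proof -
        have "a \<in> Basis" "weight lam a = t" using that by (auto simp: weight_basis_def)
        moreover from this have "a \<noteq> ?e" using t by auto
        ultimately have "(t + weight lam b) * W a b = 0"
          using closed_weights[OF sf li cl _ b _ bw(1), of a] by (simp add: W_def)
        then show ?thesis using bw(2) by (simp add: add_eq_0_iff)
      qed
      then show ?thesis using linear_eq_0_on_span[OF linW, of "weight_basis t" b u] u by blast
    qed
    have "contr 2 u (\<eta> 0) = (\<lambda>v. 0)"
    proof (rule alternating_eq_on_Basis[of "Suc 0"])
      show "alternating (Suc 0) (contr 2 u (\<eta> 0))" using alternating_contr[OF smooth_formD(1)[OF sf], of u 0] by simp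
      fix v :: "nat \<Rightarrow> complex \<times> (complex^'n)" assume "\<And>i. i < Suc 0 \<Longrightarrow> v i \<in> Basis"
      then have "W u (v 0) = 0" using Wb by simp
      moreover have "\<eta> 0 (case_nat u v) = \<eta> 0 (case_nat u (\<lambda>_. v 0))"
        by (rule alternating_cong[OF a2]) (auto split: nat.split simp: less_Suc_eq)
      ultimately show "contr 2 u (\<eta> 0) v = 0" by (simp add: contr_2 W_def)
    qed simp
    then have "\<forall>v. contr 2 u (\<eta> 0) v = 0" by (simp only: simp_thms)
    then show "u = 0" using nd unfolding nondegenerate_def by blast
  qed
  have inj: "inj_on G (span (weight_basis t))"
  proof (rule inj_onI)
    fix u v assume "u \<in> span (weight_basis t)" "v \<in> span (weight_basis t)" "G u = G v"
    then have "u - v \<in> span (weight_basis t)" "G (u - v) = 0"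
      using span_diff[of u _ v] linear_diff[OF linG, of u v] by (blast, simp only: right_minus_eq)
    then have "u - v = 0" by (rule ker)
    then show "u = v" by simp
  qed
  have "independent (weight_basis t)" by (rule independent_mono[OF independent_Basis]) (auto simp: weight_basis_def)
  then have "card (weight_basis t) = dim (weight_basis t)" by (simp add: dim_eq_card_independent)
  also have "\<dots> = dim (G ` weight_basis t)" using dim_image_eq[OF linG inj] by simp
  also have "\<dots> \<le> card ?C"
  proof (rule dim_le_card[OF _ C(2)])
    show "G ` weight_basis t \<subseteq> span ?C"
      unfolding G_def by (auto intro!: span_sum span_scale intro: span_base)
  qed
  also have "\<dots> \<le> card (weight_basis (- t)) + 1" by (simp add: card_insert_le_m1 card_insert_if)
  finally show ?thesis using card_weight_basis[OF t] card_weight_basis[of "- t"] t by simp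
qed

lemma weight_multiplicity:
  assumes "symplectic_on_group \<eta>" "t \<noteq> 0"
  shows "card {i. lam i = t} = card {i. lam i = - t}"
  using weight_multiplicity_le[OF assms] weight_multiplicity_le[OF assms(1), of "- t"] assms(2) by simp

end

section \<open>Pairing opposite values\<close>

definition opposite_pairs :: "('a \<Rightarrow> real) \<Rightarrow> 'a set \<Rightarrow> 'a set set \<Rightarrow> bool" where
  "opposite_pairs f S \<P> \<longleftrightarrow> partition_on S \<P> \<and> (\<forall>B\<in>\<P>. \<exists>i j. i \<noteq> j \<and> B = {i, j} \<and> f i + f j = 0)"

lemma opposite_pairs_insert:
  assumes "opposite_pairs f (S - {i, j}) \<P>" "i \<in> S" "j \<in> S" "i \<noteq> j" "f i + f j = 0"
  shows "opposite_pairs f S (insert {i, j} \<P>)"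
proof -
  have p: "\<Union>\<P> = S - {i, j}" "disjoint \<P>" "{} \<notin> \<P>"
    using assms(1) by (auto simp: opposite_pairs_def partition_on_def)
  have "disjoint (insert {i, j} \<P>)" using p by (auto simp: disjoint_def)
  then have "partition_on S (insert {i, j} \<P>)" using p assms by (auto simp: partition_on_def)
  moreover have "\<forall>B\<in>insert {i, j} \<P>. \<exists>i j. i \<noteq> j \<and> B = {i, j} \<and> f i + f j = 0"
    using assms by (auto simp: opposite_pairs_def)
  ultimately show ?thesis by (simp add: opposite_pairs_def)
qed

lemma opposite_pairs_even:
  assumes "finite S" "opposite_pairs f S \<P>"
  shows "even (card S)"
proof -
  have p: "\<Union>\<P> = S" "disjoint \<P>" using assms(2) by (auto simp: opposite_pairs_def partition_on_def)
  have c: "card B = 2 \<and> finite B" if "B \<in> \<P>" for B using assms(2) that by (auto simp: opposite_pairs_def)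
  have "card S = sum card \<P>" unfolding p(1)[symmetric] using p(2) c by (intro card_Union_disjoint) (auto simp: disjoint_def pairwise_def)
  also have "\<dots> = (\<Sum>B\<in>\<P>. 2)" using c by (intro sum.cong) auto
  finally show ?thesis by simp
qed

text \<open>
  Pairs with opposite values are removed one at a time, which keeps the multiplicities of \<open>t\<close> and \<open>- t\<close> equal.
  When no pair is left, all remaining values are 0, and two remaining indices would form a pair.
\<close>

lemma ex_opposite_pairs:
  assumes "finite S" and "\<And>t. t \<noteq> 0 \<Longrightarrow> card {k\<in>S. f k = t} = card {k\<in>S. f k = - t}"
  shows "\<exists>\<P> R. R \<subseteq> S \<and> card R \<le> 1 \<and> (\<forall>l\<in>R. f l = 0) \<and> opposite_pairs f (S - R) \<P>"
  using assms
proof (induction S rule: finite_psubset_induct)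
  case (psubset S)
  show ?case
  proof (cases "\<exists>i\<in>S. \<exists>j\<in>S. i \<noteq> j \<and> f i + f j = 0")
    case True
    then obtain i j where ij: "i \<in> S" "j \<in> S" "i \<noteq> j" "f j = - f i" by (auto simp: add_eq_0_iff)
    let ?S = "S - {i, j}"
    have cnt: "card {k\<in>S. f k = t} = card {k\<in>?S. f k = t} + ((if f i = t then 1 else 0) + (if f j = t then 1 else 0))" for t
    proof -
      have "{k\<in>S. f k = t} = {k\<in>?S. f k = t} \<union> {k\<in>{i, j}. f k = t}" using ij by auto
      then have "card {k\<in>S. f k = t} = card {k\<in>?S. f k = t} + card {k\<in>{i, j}. f k = t}"
        using psubset.hyps by (simp add: card_Un_disjoint disjoint_iff)
      moreover have "{k\<in>{i, j}. f k = t} = (if f i = t then {i} else {}) \<union> (if f j = t then {j} else {})" by auto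
      ultimately show ?thesis using ij(3) by simp
    qed
    have "card {k\<in>?S. f k = t} = card {k\<in>?S. f k = - t}" if "t \<noteq> 0" for t
    proof -
      have "f j = t \<longleftrightarrow> f i = - t" "f j = - t \<longleftrightarrow> f i = t" using ij(4) by auto
      then show ?thesis using psubset.prems[OF that] cnt[of t] cnt[of "- t"] by (simp only: add_ac)
    qed
    then obtain \<P> R where PR: "R \<subseteq> ?S" "card R \<le> 1" "\<forall>l\<in>R. f l = 0" "opposite_pairs f (?S - R) \<P>"
      using psubset.IH[of ?S] ij(1) by blast
    have "?S - R = (S - R) - {i, j}" by auto
    then have "opposite_pairs f (S - R) (insert {i, j} \<P>)"
      using PR ij by (intro opposite_pairs_insert) auto
    then show ?thesis using PR by blast
  next
    case False
    have z: "f i = 0" if "i \<in> S" for i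
    proof (rule ccontr)
      assume nz: "f i \<noteq> 0"
      have "{k\<in>S. f k = f i} \<noteq> {}" using that by blast
      then have "card {k\<in>S. f k = f i} \<noteq> 0" using psubset.hyps by simp
      then have "card {k\<in>S. f k = - f i} \<noteq> 0" using psubset.prems[OF nz] by simp
      then have "{k\<in>S. f k = - f i} \<noteq> {}" by (metis card.empty)
      then obtain j where "j \<in> S" "f j = - f i" by blast
      moreover from this have "i \<noteq> j" using nz by auto
      ultimately show False using False that by force
    qed
    have "card S \<le> 1"
      using False z psubset.hyps by (intro card_le_Suc0_iff_eq[THEN iffD2, unfolded One_nat_def[symmetric]]) auto
    moreover have "opposite_pairs f (S - S) {}" by (simp add: opposite_pairs_def partition_on_def)
    ultimately show ?thesis using z by blast
  qed
qed

text \<open>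
  The pairing as an involution \<open>\<sigma>\<close>, with a sign that orders each pair.
\<close>

lemma opposite_pairs_involution:
  assumes "opposite_pairs f S \<P>"
  shows "\<exists>\<sigma> s. \<forall>i\<in>S. \<sigma> i \<in> S \<and> \<sigma> (\<sigma> i) = i \<and> f i + f (\<sigma> i) = 0 \<and> (s i = 1 \<or> s i = (- 1 :: real)) \<and> s (\<sigma> i) = - s i"
proof -
  have p: "\<Union>\<P> = S" "disjoint \<P>" using assms by (auto simp: opposite_pairs_def partition_on_def)
  obtain a b where ab: "\<And>B. B \<in> \<P> \<Longrightarrow> a B \<noteq> b B \<and> B = {a B, b B} \<and> f (a B) + f (b B) = 0"
    using assms unfolding opposite_pairs_def by metis
  define blk where "blk i = (THE B. B \<in> \<P> \<and> i \<in> B)" for i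
  have blk: "blk i = B" if "B \<in> \<P>" "i \<in> B" for i B
    unfolding blk_def using that p(2) by (intro the_equality) (auto simp: disjoint_def)
  define \<sigma> where "\<sigma> i = (if i = a (blk i) then b (blk i) else a (blk i))" for i
  define s :: "_ \<Rightarrow> real" where "s i = (if i = a (blk i) then 1 else - 1)" for i
  have "\<sigma> i \<in> S \<and> \<sigma> (\<sigma> i) = i \<and> f i + f (\<sigma> i) = 0 \<and> (s i = 1 \<or> s i = - 1) \<and> s (\<sigma> i) = - s i" if i: "i \<in> S" for i
  proof -
    obtain B where B: "B \<in> \<P>" "i \<in> B" using p i by blast
    have AB: "a B \<noteq> b B" "B = {a B, b B}" "f (a B) + f (b B) = 0" using ab[OF B(1)] by auto
    have in_B: "a B \<in> B" "b B \<in> B" using AB(2) by blast+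
    have bl: "blk i = B" "blk (a B) = B" "blk (b B) = B" using blk B in_B by auto
    have "i = a B \<or> i = b B" using B(2) AB(2) by blast
    moreover have "a B \<in> S" "b B \<in> S" using in_B B(1) p(1) by blast+
    ultimately show ?thesis using AB bl by (auto simp: \<sigma>_def s_def add.commute)
  qed
  then show ?thesis by blast
qed

section \<open>Symplectic forms from pairings\<close>

context nakamura_data
begin

text \<open>
  The form \<open>(u, v) \<mapsto> u \<bullet> J v\<close> for a skew complex structure \<open>J\<close>, which maps the coordinate \<open>\<sigma> i\<close> to the coordinate
  \<open>i\<close> up to sign and multiplies an unpaired coordinate and the first factor by \<open>\<i>\<close>.  As paired weights are opposite and
  unpaired ones are 0, it is invariant under all dilations; so it is a left-invariant form with constant
  coefficients, hence closed.
\<close>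

lemma symplectic_from_pairs:
  assumes P: "opposite_pairs lam (UNIV - R) \<P>" and R: "\<And>l. l \<in> R \<Longrightarrow> lam l = 0"
  shows "\<exists>\<omega>. invariant_symplectic lam P \<tau> \<omega>"
proof -
  obtain \<sigma> s where \<sigma>: "\<And>i. i \<notin> R \<Longrightarrow> \<sigma> i \<notin> R" "\<And>i. i \<notin> R \<Longrightarrow> \<sigma> (\<sigma> i) = i" "\<And>i. i \<notin> R \<Longrightarrow> lam i + lam (\<sigma> i) = 0"
    and s: "\<And>i. i \<notin> R \<Longrightarrow> s i = 1 \<or> s i = (- 1 :: real)" "\<And>i. i \<notin> R \<Longrightarrow> s (\<sigma> i) = - s i"
    using opposite_pairs_involution[OF P] by auto
  define K where "K z = (\<chi> i. if i \<in> R then \<i> * z $ i else s i *\<^sub>R z $ \<sigma> i)" for z :: "complex^'n"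
  define J where "J x = (\<i> * fst x, K (snd x))" for x :: "complex \<times> (complex^'n)"
  have linJ: "linear J"
    by (rule linearI) (auto simp: J_def K_def vec_eq_iff algebra_simps scaleR_add_right)
  have JJ: "J (J x) = - x" for x
  proof -
    have "s i * s (\<sigma> i) = - 1" if "i \<notin> R" for i using s[OF that] by auto
    then have "K (K z) = - z" for z
      using \<sigma>(1,2) by (simp add: K_def vec_eq_iff mult.assoc[symmetric])
    then show ?thesis by (simp add: J_def prod_eq_iff mult.assoc[symmetric])
  qed
  have rot: "w \<bullet> (\<i> * w) = 0" for w :: complex by (simp add: inner_complex_def)
  have skew: "x \<bullet> J x = 0" for x
  proof -
    let ?z = "snd x"
    have "(\<Sum>i\<in>UNIV - R. s i * (?z $ i \<bullet> ?z $ \<sigma> i)) = (\<Sum>i\<in>UNIV - R. s (\<sigma> i) * (?z $ \<sigma> i \<bullet> ?z $ i))"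
      by (rule sum.reindex_bij_witness[where i=\<sigma> and j=\<sigma>]) (use \<sigma> in auto)
    also have "\<dots> = - (\<Sum>i\<in>UNIV - R. s i * (?z $ i \<bullet> ?z $ \<sigma> i))"
      unfolding sum_negf[symmetric] by (intro sum.cong refl) (simp add: s(2) inner_commute)
    finally have 0: "(\<Sum>i\<in>UNIV - R. s i * (?z $ i \<bullet> ?z $ \<sigma> i)) = 0" by simp
    have "?z \<bullet> K ?z = (\<Sum>i\<in>UNIV. if i \<in> R then 0 else s i * (?z $ i \<bullet> ?z $ \<sigma> i))"
      unfolding inner_vec_def K_def by (intro sum.cong refl) (simp add: rot)
    also have "\<dots> = (\<Sum>i\<in>UNIV - R. s i * (?z $ i \<bullet> ?z $ \<sigma> i))"
      by (rule sum.mono_neutral_cong_right) auto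
    finally show ?thesis using 0 by (simp add: inner_prod_def J_def rot)
  qed
  have inv: "nak_linear lam t x \<bullet> J (nak_linear lam t y) = x \<bullet> J y" for t x y
  proof -
    have "dil lam t z \<bullet> K (dil lam t z') = z \<bullet> K z'" for z z'
      unfolding inner_vec_def
    proof (intro sum.cong refl)
      fix i
      have "exp (lam i * t) * exp (lam (\<sigma> i) * t) = 1" if "i \<notin> R"
        using \<sigma>(3)[OF that] by (simp add: exp_add[symmetric] distrib_right[symmetric])
      then show "dil lam t z $ i \<bullet> K (dil lam t z') $ i = z $ i \<bullet> K z' $ i"
        using R by (simp add: dil_def K_def)
    qed
    then show ?thesis by (simp add: nak_linear_def J_def inner_prod_def)
  qed
  define c where "c v = v 0 \<bullet> J (v 1)" for v :: "nat \<Rightarrow> complex \<times> (complex^'n)"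
  have alt: "alternating 2 c"
    unfolding alternating_def
  proof (intro conjI allI impI)
    fix v w :: "nat \<Rightarrow> complex \<times> (complex^'n)" assume "\<forall>i<2. v i = w i"
    then show "c v = c w" by (simp add: c_def)
  next
    fix v :: "nat \<Rightarrow> complex \<times> (complex^'n)" and i :: nat assume "i < 2"
    then consider "i = 0" | "i = 1" by linarith
    then show "linear (\<lambda>a. c (v(i := a)))"
      by cases (rule linearI; simp add: c_def linear_add[OF linJ] linear_scale[OF linJ] inner_left_distrib inner_right_distrib)+
  next
    fix v :: "nat \<Rightarrow> complex \<times> (complex^'n)" and i j :: nat assume "i < j \<and> j < 2 \<and> v i = v j"
    then have "i = 0" "j = 1" "v 0 = v 1" by (auto simp: less_2_cases_iff)
    then show "c v = 0" by (simp add: c_def skew)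
  qed
  have nd: "nondegenerate c"
    unfolding nondegenerate_def
  proof (intro allI impI)
    fix u assume "\<forall>v. contr 2 u c v = 0"
    then have "contr 2 u c (\<lambda>_. - J u) = 0" by blast
    then have "u \<bullet> J (- J u) = 0" by (simp add: contr_2 c_def)
    then show "u = 0" by (simp add: linear_neg[OF linJ] JJ)
  qed
  have "left_invariant (\<lambda>x. c)"
    unfolding left_invariant_def by (intro allI ext) (simp add: affine_pull_def c_def inv)
  then have "symplectic_on_group (\<lambda>x. c)"
    using smooth_form_const[OF alt] nd by (simp add: symplectic_on_group_def)
  then show ?thesis using invariant_symplectic_iff by blast
qed

text \<open>
  The set \<open>R\<close> of unpaired indices has at most one element; the parity of the number of indices decides whether it is
  empty.
\<close>

lemma pairs_from_symplectic:
  assumes "invariant_symplectic lam P \<tau> \<omega>"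
  shows "\<exists>\<P> R. card R \<le> 1 \<and> (\<forall>l\<in>R. lam l = 0) \<and> opposite_pairs lam (UNIV - R) \<P>"
proof -
  obtain \<eta> where \<eta>: "symplectic_on_group \<eta>" using assms invariant_symplectic_iff by blast
  have "card {k\<in>UNIV. lam k = t} = card {k\<in>UNIV. lam k = - t}" if "t \<noteq> 0" for t
    using weight_multiplicity[OF \<eta> that] by simp
  from ex_opposite_pairs[OF finite this] show ?thesis by blast
qed

lemma symplectic_iff_even:
  assumes "CARD('n) = 2 * m"
  shows "(\<exists>\<omega>. invariant_symplectic lam P \<tau> \<omega>) \<longleftrightarrow> (\<exists>\<P>. opposite_pairs lam UNIV \<P>)"
proof
  assume "\<exists>\<omega>. invariant_symplectic lam P \<tau> \<omega>"
  then obtain \<P> R where PR: "card R \<le> 1" "opposite_pairs lam (UNIV - R) \<P>" using pairs_from_symplectic by blast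
  have "even (card (UNIV - R))" using opposite_pairs_even[OF _ PR(2)] by simp
  then have "even (card R)" using assms card_Diff_subset[of R UNIV] card_mono[of UNIV R] by simp
  then have "card R = 0" using PR(1) by (cases "card R") auto
  then have "R = {}" by simp
  then show "\<exists>\<P>. opposite_pairs lam UNIV \<P>" using PR(2) by auto
next
  assume "\<exists>\<P>. opposite_pairs lam UNIV \<P>"
  then show "\<exists>\<omega>. invariant_symplectic lam P \<tau> \<omega>" using symplectic_from_pairs[of "{}"] by auto
qed

lemma symplectic_iff_odd:
  assumes "CARD('n) = 2 * m + 1"
  shows "(\<exists>\<omega>. invariant_symplectic lam P \<tau> \<omega>) \<longleftrightarrow> (\<exists>\<P> l. opposite_pairs lam (UNIV - {l}) \<P> \<and> lam l = 0)"
proof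
  assume "\<exists>\<omega>. invariant_symplectic lam P \<tau> \<omega>"
  then obtain \<P> R where PR: "card R \<le> 1" "\<forall>l\<in>R. lam l = 0" "opposite_pairs lam (UNIV - R) \<P>"
    using pairs_from_symplectic by blast
  have "even (card (UNIV - R))" using opposite_pairs_even[OF _ PR(3)] by simp
  then have "R \<noteq> {}" using assms by auto
  then have "0 < card R" by (simp add: card_gt_0_iff)
  then have "card R = 1" using PR(1) by linarith
  then obtain l where "R = {l}" using card_1_singletonE by blast
  then show "\<exists>\<P> l. opposite_pairs lam (UNIV - {l}) \<P> \<and> lam l = 0" using PR by auto
next
  assume "\<exists>\<P> l. opposite_pairs lam (UNIV - {l}) \<P> \<and> lam l = 0"
  then obtain \<P> l where "opposite_pairs lam (UNIV - {l}) \<P>" "lam l = 0" by blast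
  then show "\<exists>\<omega>. invariant_symplectic lam P \<tau> \<omega>" using symplectic_from_pairs[of "{l}" \<P>] by auto
qed

lemma invariant_symplectic_hard_lefschetz:
  "invariant_symplectic lam P \<tau> \<omega> \<Longrightarrow> hard_lefschetz (nakamura lam P \<tau>) \<omega>"
  unfolding invariant_symplectic_iff nakamura_def using symplectic_hard_lefschetz by blast

end

theorem theorem1p1:
  fixes M :: "int^'n^'n" and P :: "real^'n^'n" and lam :: "'n::finite \<Rightarrow> real"
    and \<tau> :: real and m :: nat
  assumes "det M = 1"
    and "invertible P"
    and "P ** (\<chi> i j. real_of_int (M $ i $ j)) ** matrix_inv P = diag_mat (\<lambda>i. exp (lam i))"
    and "\<exists>j. lam j \<noteq> 0"
    and "\<tau> \<noteq> 0"
  shows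
    "(CARD('n) = 2 * m \<longrightarrow>
       ((\<exists>\<omega>. invariant_symplectic lam P \<tau> \<omega>) \<longleftrightarrow>
        (\<exists>\<P>. partition_on (UNIV :: 'n set) \<P> \<and>
             (\<forall>B\<in>\<P>. \<exists>i j. i \<noteq> j \<and> B = {i, j} \<and> lam i + lam j = 0)))) \<and>
     (CARD('n) = 2 * m + 1 \<longrightarrow>
       ((\<exists>\<omega>. invariant_symplectic lam P \<tau> \<omega>) \<longleftrightarrow>
        (\<exists>\<P> l. partition_on (UNIV - {l} :: 'n set) \<P> \<and>
             (\<forall>B\<in>\<P>. \<exists>i j. i \<noteq> j \<and> B = {i, j} \<and> lam i + lam j = 0) \<and> lam l = 0))) \<and>
     (\<forall>\<omega>. invariant_symplectic lam P \<tau> \<omega> \<longrightarrow> hard_lefschetz (nakamura lam P \<tau>) \<omega>)"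
proof -
  interpret nakamura_data M P lam \<tau>
    by (rule nakamura_data.intro[OF assms(1,2,3,5)])
  show ?thesis
    using symplectic_iff_even[of m] symplectic_iff_odd[of m] invariant_symplectic_hard_lefschetz
    unfolding opposite_pairs_def conj_assoc by blast
qed

end
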